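(* Let $k$ be a commutative ring, let $G$ be a group and let $\mathcal{C}$ be a free $G$-category over $k$. Then the quotient category $\mathcal{C}/G$ is $G$-graded (that is, it carries a $G$-grading) and the smash product category $(\mathcal{C}/G)\# G$ is isomorphic to $\mathcal{C}$.
   Context: Category over $k$: a small category $\mathcal{C}$ with object set $\mathcal{C}_0$ such that each morphism set ${}_y\mathcal{C}_x$ (morphisms from $x$ to $y$) is a $k$-module and composition is $k$-bilinear. $G$-category over $k$: a category $\mathcal{C}$ over $k$ with an action of $G$ on the set $\mathcal{C}_0$ and $k$-module maps $s:{}_y\mathcal{C}_x\to{}_{sy}\mathcal{C}_{sx}$ for each $s\in G$ and each pair of objects $x,y$, such that $s(gf)=(sg)(sf)$ for composable $g,f$, $(ts)f=t(sf)$ and $1f=f$. It is free if the action of $G$ on $\mathcal{C}_0$ is free. Quotient category $\mathcal{C}/G$ (for $\mathcal{C}$ a free $G$-category): the category over $k$ whose objects are the $G$-orbits of $\mathcal{C}_0$, with morphisms ${}_\beta(\mathcal{C}/G)_\alpha=\left(\bigoplus_{x\in\alpha,\,y\in\beta}{}_y\mathcal{C}_x\right)/G$ from $\alpha$ to $\beta$, where for a $kG$-module $X$ one sets $X/G=X/(\ker\epsilon)X$ with $\epsilon:kG\to k$ the augmentation map. Composition is induced by that of $\mathcal{C}$: if $f\in{}_y\mathcal{C}_x$ and $g\in{}_z\mathcal{C}_{y'}$ with $y,y'$ in the same orbit, and $s$ is the unique element of $G$ with $sy=y'$, then $[g][f]=[g\circ(sf)]$. $G$-graded category over $k$: a category $\mathcal{B}$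 over $k$ with decompositions into $k$-modules ${}_y\mathcal{B}_x=\bigoplus_{s\in G}{}_y\mathcal{B}_x^{\,s}$ for each pair of objects, such that ${}_z\mathcal{B}_y^{\,t}\;{}_y\mathcal{B}_x^{\,s}\subset{}_z\mathcal{B}_x^{\,ts}$ and ${}_x1_x\in{}_x\mathcal{B}_x^{\,1}$. Smash product category $\mathcal{B}\# G$ of a $G$-graded category $\mathcal{B}$ over $k$: objects $\mathcal{B}_0\times G$, morphisms ${}_{(y,t)}(\mathcal{B}\# G)_{(x,s)}={}_y\mathcal{B}_x^{\,t^{-1}s}$ from $(x,s)$ to $(y,t)$, composition given by the graded composition ${}_z\mathcal{B}_y^{\,u^{-1}t}\otimes_k{}_y\mathcal{B}_x^{\,t^{-1}s}\to{}_z\mathcal{B}_x^{\,u^{-1}s}$ of $\mathcal{B}$. The category $(\mathcal{C}/G)\# G$ is formed with respect to the $G$-grading of $\mathcal{C}/G$ whose existence is asserted. *)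

theory Defs
  imports
    "HOL-Algebra.Module"
    "HOL-Algebra.AbelCoset"
    "HOL-Algebra.Generated_Groups"
    "HOL-Algebra.Group_Action"
begin

section \<open>Module constructions\<close>

text \<open>
  Modules are records of HOL-Algebra, whose locale \<^locale>\<open>module\<close> says nothing about the fields
  \<^const>\<open>mult\<close> and \<^const>\<open>one\<close>; they are left \<^term>\<open>undefined\<close> in the constructions below.
\<close>

definition module_hom ::
  "('k, 'r) ring_scheme \<Rightarrow> ('k, 'm, 'a) module_scheme \<Rightarrow> ('k, 'n, 'b) module_scheme \<Rightarrow> ('m \<Rightarrow> 'n) set"
  where
  "module_hom k M N =
    {h \<in> hom (add_monoid M) (add_monoid N).
      \<forall>r\<in>carrier k. \<forall>m\<in>carrier M. h (r \<odot>\<^bsub>M\<^esub> m) = r \<odot>\<^bsub>N\<^esub> h m}"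

definition direct_sum :: "'i set \<Rightarrow> ('i \<Rightarrow> ('k, 'm) module) \<Rightarrow> ('k, 'i \<Rightarrow> 'm) module" where
  "direct_sum I M =
    \<lparr>carrier = {c \<in> (\<Pi>\<^sub>E i\<in>I. carrier (M i)). finite {i \<in> I. c i \<noteq> \<zero>\<^bsub>M i\<^esub>}},
     mult = undefined,
     one = undefined,
     zero = (\<lambda>i\<in>I. \<zero>\<^bsub>M i\<^esub>),
     add = (\<lambda>c d. \<lambda>i\<in>I. c i \<oplus>\<^bsub>M i\<^esub> d i),
     smult = (\<lambda>r c. \<lambda>i\<in>I. r \<odot>\<^bsub>M i\<^esub> c i)\<rparr>"

definition direct_sum_inj :: "'i set \<Rightarrow> ('i \<Rightarrow> ('k, 'm) module) \<Rightarrow> 'i \<Rightarrow> 'm \<Rightarrow> 'i \<Rightarrow> 'm" where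
  "direct_sum_inj I M i m = (\<lambda>j\<in>I. if j = i then m else \<zero>\<^bsub>M j\<^esub>)"

definition internal_direct_sum ::
  "('k, 'r) ring_scheme \<Rightarrow> ('k, 'm) module \<Rightarrow> 'i set \<Rightarrow> ('i \<Rightarrow> 'm set) \<Rightarrow> bool" where
  "internal_direct_sum k M I N \<longleftrightarrow>
    (\<forall>i\<in>I. submodule (N i) k M) \<and>
    (\<forall>m\<in>carrier M. \<exists>!c. c \<in> (\<Pi>\<^sub>E i\<in>I. N i) \<and> finite {i \<in> I. c i \<noteq> \<zero>\<^bsub>M\<^esub>} \<and>
       m = (\<Oplus>\<^bsub>M\<^esub>i\<in>{i \<in> I. c i \<noteq> \<zero>\<^bsub>M\<^esub>}. c i))"

text \<open>
  As with \<^const>\<open>A_FactGroup\<close> and the multiplication of a quotient ring, operations on cosets are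
  unions over all representatives; each union is a single coset when \<^term>\<open>N\<close> is a submodule.
\<close>

definition quotient_module :: "('k, 'm) module \<Rightarrow> 'm set \<Rightarrow> ('k, 'm set) module" where
  "quotient_module M N =
    \<lparr>carrier = a_rcosets\<^bsub>M\<^esub> N,
     mult = undefined,
     one = undefined,
     zero = N,
     add = (\<lambda>A B. A <+>\<^bsub>M\<^esub> B),
     smult = (\<lambda>r A. \<Union>m\<in>A. N +>\<^bsub>M\<^esub> (r \<odot>\<^bsub>M\<^esub> m))\<rparr>"


section \<open>Coinvariants of a module over a group algebra\<close>

text \<open>
  Elements of the group algebra \<open>kG\<close> are the finitely supported functions from \<open>G\<close> to \<open>k\<close>.
  A \<open>kG\<close>-module is a \<open>k\<close>-module \<open>X\<close> together with an action \<open>\<sigma>\<close> of \<open>G\<close> on it, extended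
  \<open>k\<close>-linearly to \<open>kG\<close>.  The product of \<open>kG\<close> plays no role in forming \<open>X/(ker \<epsilon>)X\<close>.
\<close>

definition group_algebra_carrier ::
  "('k, 'r) ring_scheme \<Rightarrow> ('g, 'h) monoid_scheme \<Rightarrow> ('g \<Rightarrow> 'k) set" where
  "group_algebra_carrier k G =
    {a \<in> carrier G \<rightarrow>\<^sub>E carrier k. finite {s \<in> carrier G. a s \<noteq> \<zero>\<^bsub>k\<^esub>}}"

definition augmentation ::
  "('k, 'r) ring_scheme \<Rightarrow> ('g, 'h) monoid_scheme \<Rightarrow> ('g \<Rightarrow> 'k) \<Rightarrow> 'k" where
  "augmentation k G a = (\<Oplus>\<^bsub>k\<^esub>s\<in>{s \<in> carrier G. a s \<noteq> \<zero>\<^bsub>k\<^esub>}. a s)"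

definition augmentation_ideal ::
  "('k, 'r) ring_scheme \<Rightarrow> ('g, 'h) monoid_scheme \<Rightarrow> ('g \<Rightarrow> 'k) set" where
  "augmentation_ideal k G = {a \<in> group_algebra_carrier k G. augmentation k G a = \<zero>\<^bsub>k\<^esub>}"

definition group_algebra_smult ::
  "('k, 'r) ring_scheme \<Rightarrow> ('g, 'h) monoid_scheme \<Rightarrow> ('k, 'm) module \<Rightarrow> ('g \<Rightarrow> 'm \<Rightarrow> 'm) \<Rightarrow>
    ('g \<Rightarrow> 'k) \<Rightarrow> 'm \<Rightarrow> 'm" where
  "group_algebra_smult k G X \<sigma> a m =
    (\<Oplus>\<^bsub>X\<^esub>s\<in>{s \<in> carrier G. a s \<noteq> \<zero>\<^bsub>k\<^esub>}. a s \<odot>\<^bsub>X\<^esub> \<sigma> s m)"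

text \<open>\<open>(ker \<epsilon>)X\<close>, the additive subgroup generated by the products \<open>a x\<close> with \<open>\<epsilon>(a) = 0\<close>\<close>

definition augmentation_submodule ::
  "('k, 'r) ring_scheme \<Rightarrow> ('g, 'h) monoid_scheme \<Rightarrow> ('k, 'm) module \<Rightarrow> ('g \<Rightarrow> 'm \<Rightarrow> 'm) \<Rightarrow> 'm set"
  where
  "augmentation_submodule k G X \<sigma> =
    generate (add_monoid X)
      {group_algebra_smult k G X \<sigma> a m | a m. a \<in> augmentation_ideal k G \<and> m \<in> carrier X}"

definition coinvariants ::
  "('k, 'r) ring_scheme \<Rightarrow> ('g, 'h) monoid_scheme \<Rightarrow> ('k, 'm) module \<Rightarrow> ('g \<Rightarrow> 'm \<Rightarrow> 'm) \<Rightarrow>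
    ('k, 'm set) module" where
  "coinvariants k G X \<sigma> = quotient_module X (augmentation_submodule k G X \<sigma>)"


section \<open>Categories over a commutative ring\<close>

text \<open>
  Indices are ordered as in the notation \<open>\<^sub>yC\<^sub>x\<close>: \<open>Hom C y x\<close> is the module of morphisms
  from \<open>x\<close> to \<open>y\<close>, and \<open>Comp C z y x g f\<close> is the composite \<open>g f\<close> of \<open>f\<close> from \<open>x\<close> to \<open>y\<close> and
  \<open>g\<close> from \<open>y\<close> to \<open>z\<close>.  Different morphism modules may share elements of the type \<open>'m\<close>, so every
  operation on morphisms takes the objects as arguments.
\<close>

record ('o, 'm, 'k) k_cat =
  Ob :: "'o set"
  Hom :: "'o \<Rightarrow> 'o \<Rightarrow> ('k, 'm) module"
  Comp :: "'o \<Rightarrow> 'o \<Rightarrow> 'o \<Rightarrow> 'm \<Rightarrow> 'm \<Rightarrow> 'm"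
  Id :: "'o \<Rightarrow> 'm"

locale k_category = cring k
  for k :: "('k, 'r) ring_scheme" (structure) +
  fixes C :: "('o, 'm, 'k) k_cat"
  assumes Hom_module:
      "\<lbrakk>x \<in> Ob C; y \<in> Ob C\<rbrakk> \<Longrightarrow> module k (Hom C y x)"
    and Comp_linear_left:
      "\<lbrakk>x \<in> Ob C; y \<in> Ob C; z \<in> Ob C; f \<in> carrier (Hom C y x)\<rbrakk> \<Longrightarrow>
        (\<lambda>g. Comp C z y x g f) \<in> module_hom k (Hom C z y) (Hom C z x)"
    and Comp_linear_right:
      "\<lbrakk>x \<in> Ob C; y \<in> Ob C; z \<in> Ob C; g \<in> carrier (Hom C z y)\<rbrakk> \<Longrightarrow>
        (\<lambda>f. Comp C z y x g f) \<in> module_hom k (Hom C y x) (Hom C z x)"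
    and Comp_assoc:
      "\<lbrakk>w \<in> Ob C; x \<in> Ob C; y \<in> Ob C; z \<in> Ob C;
        f \<in> carrier (Hom C x w); g \<in> carrier (Hom C y x); h \<in> carrier (Hom C z y)\<rbrakk> \<Longrightarrow>
        Comp C z x w (Comp C z y x h g) f = Comp C z y w h (Comp C y x w g f)"
    and Id_closed:
      "x \<in> Ob C \<Longrightarrow> Id C x \<in> carrier (Hom C x x)"
    and Id_left:
      "\<lbrakk>x \<in> Ob C; y \<in> Ob C; f \<in> carrier (Hom C y x)\<rbrakk> \<Longrightarrow> Comp C y y x (Id C y) f = f"
    and Id_right:
      "\<lbrakk>x \<in> Ob C; y \<in> Ob C; f \<in> carrier (Hom C y x)\<rbrakk> \<Longrightarrow> Comp C y x x f (Id C x) = f"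

locale k_functor = A: k_category k A + B: k_category k B
  for k :: "('k, 'r) ring_scheme" (structure)
    and A :: "('o, 'm, 'k) k_cat" and B :: "('p, 'n, 'k) k_cat" +
  fixes F :: "'o \<Rightarrow> 'p" and Fm :: "'o \<Rightarrow> 'o \<Rightarrow> 'm \<Rightarrow> 'n"
  assumes F_closed:
      "x \<in> Ob A \<Longrightarrow> F x \<in> Ob B"
    and Fm_linear:
      "\<lbrakk>x \<in> Ob A; y \<in> Ob A\<rbrakk> \<Longrightarrow> Fm y x \<in> module_hom k (Hom A y x) (Hom B (F y) (F x))"
    and Fm_Comp:
      "\<lbrakk>x \<in> Ob A; y \<in> Ob A; z \<in> Ob A; f \<in> carrier (Hom A y x); g \<in> carrier (Hom A z y)\<rbrakk> \<Longrightarrow>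
        Fm z x (Comp A z y x g f) = Comp B (F z) (F y) (F x) (Fm z y g) (Fm y x f)"
    and Fm_Id:
      "x \<in> Ob A \<Longrightarrow> Fm x x (Id A x) = Id B (F x)"

definition k_isomorphic ::
  "('k, 'r) ring_scheme \<Rightarrow> ('o, 'm, 'k) k_cat \<Rightarrow> ('p, 'n, 'k) k_cat \<Rightarrow> bool" where
  "k_isomorphic k A B \<longleftrightarrow>
    (\<exists>F Fm. k_functor k A B F Fm \<and>
      bij_betw F (Ob A) (Ob B) \<and>
      (\<forall>x\<in>Ob A. \<forall>y\<in>Ob A. bij_betw (Fm y x) (carrier (Hom A y x)) (carrier (Hom B (F y) (F x)))))"


section \<open>\<open>G\<close>-categories and their quotients\<close>

text \<open>
  \<open>\<phi> s\<close> is the action of \<open>s\<close> on objects, and \<open>\<psi> s y x\<close> its action on morphisms from \<open>x\<close> to \<open>y\<close>.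
\<close>

locale G_category = k_category k C + group_action G "Ob C" \<phi>
  for k :: "('k, 'r) ring_scheme"
    and G :: "('g, 'h) monoid_scheme" (structure)
    and C :: "('o, 'm, 'k) k_cat"
    and \<phi> :: "'g \<Rightarrow> 'o \<Rightarrow> 'o" +
  fixes \<psi> :: "'g \<Rightarrow> 'o \<Rightarrow> 'o \<Rightarrow> 'm \<Rightarrow> 'm"
  assumes act_linear:
      "\<lbrakk>s \<in> carrier G; x \<in> Ob C; y \<in> Ob C\<rbrakk> \<Longrightarrow>
        \<psi> s y x \<in> module_hom k (Hom C y x) (Hom C (\<phi> s y) (\<phi> s x))"
    and act_Comp:
      "\<lbrakk>s \<in> carrier G; x \<in> Ob C; y \<in> Ob C; z \<in> Ob C;
        f \<in> carrier (Hom C y x); g \<in> carrier (Hom C z y)\<rbrakk> \<Longrightarrow>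
        \<psi> s z x (Comp C z y x g f) =
          Comp C (\<phi> s z) (\<phi> s y) (\<phi> s x) (\<psi> s z y g) (\<psi> s y x f)"
    and act_mult:
      "\<lbrakk>s \<in> carrier G; t \<in> carrier G; x \<in> Ob C; y \<in> Ob C; f \<in> carrier (Hom C y x)\<rbrakk> \<Longrightarrow>
        \<psi> (t \<otimes> s) y x f = \<psi> t (\<phi> s y) (\<phi> s x) (\<psi> s y x f)"
    and act_one:
      "\<lbrakk>x \<in> Ob C; y \<in> Ob C; f \<in> carrier (Hom C y x)\<rbrakk> \<Longrightarrow> \<psi> \<one> y x f = f"

locale free_G_category = G_category +
  assumes free: "x \<in> Ob C \<Longrightarrow> stabilizer G \<phi> x = {\<one>}"

text \<open>
  The \<open>kG\<close>-module \<open>\<Oplus> \<^sub>yC\<^sub>x\<close> over \<open>x \<in> \<alpha>\<close>, \<open>y \<in> \<beta>\<close>, indexed by the pairs \<open>(y, x)\<close>.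
  The \<open>(y, x)\<close>-component of \<open>s \<xi>\<close> is the image under \<open>s\<close> of the
  \<open>(s\<^sup>-\<^sup>1 y, s\<^sup>-\<^sup>1 x)\<close>-component of \<open>\<xi>\<close>.
\<close>

definition orbit_module :: "('o, 'm, 'k) k_cat \<Rightarrow> 'o set \<Rightarrow> 'o set \<Rightarrow> ('k, 'o \<times> 'o \<Rightarrow> 'm) module" where
  "orbit_module C \<beta> \<alpha> = direct_sum (\<beta> \<times> \<alpha>) (\<lambda>(y, x). Hom C y x)"

definition orbit_module_inj ::
  "('o, 'm, 'k) k_cat \<Rightarrow> 'o set \<Rightarrow> 'o set \<Rightarrow> 'o \<Rightarrow> 'o \<Rightarrow> 'm \<Rightarrow> 'o \<times> 'o \<Rightarrow> 'm" where
  "orbit_module_inj C \<beta> \<alpha> y x f = direct_sum_inj (\<beta> \<times> \<alpha>) (\<lambda>(y, x). Hom C y x) (y, x) f"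

definition orbit_module_act ::
  "('g, 'h) monoid_scheme \<Rightarrow> ('g \<Rightarrow> 'o \<Rightarrow> 'o) \<Rightarrow> ('g \<Rightarrow> 'o \<Rightarrow> 'o \<Rightarrow> 'm \<Rightarrow> 'm) \<Rightarrow>
    'o set \<Rightarrow> 'o set \<Rightarrow> 'g \<Rightarrow> ('o \<times> 'o \<Rightarrow> 'm) \<Rightarrow> 'o \<times> 'o \<Rightarrow> 'm" where
  "orbit_module_act G \<phi> \<psi> \<beta> \<alpha> s \<xi> =
    (\<lambda>(y, x)\<in>\<beta> \<times> \<alpha>.
      let y' = \<phi> (inv\<^bsub>G\<^esub> s) y; x' = \<phi> (inv\<^bsub>G\<^esub> s) x in \<psi> s y' x' (\<xi> (y', x')))"

definition orbit_submodule ::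
  "('k, 'r) ring_scheme \<Rightarrow> ('g, 'h) monoid_scheme \<Rightarrow> ('o, 'm, 'k) k_cat \<Rightarrow>
    ('g \<Rightarrow> 'o \<Rightarrow> 'o) \<Rightarrow> ('g \<Rightarrow> 'o \<Rightarrow> 'o \<Rightarrow> 'm \<Rightarrow> 'm) \<Rightarrow> 'o set \<Rightarrow> 'o set \<Rightarrow> ('o \<times> 'o \<Rightarrow> 'm) set" where
  "orbit_submodule k G C \<phi> \<psi> \<beta> \<alpha> =
    augmentation_submodule k G (orbit_module C \<beta> \<alpha>) (orbit_module_act G \<phi> \<psi> \<beta> \<alpha>)"

text \<open>the class, in the quotient by the augmentation submodule, of an element of the direct sum\<close>

definition orbit_class ::
  "('k, 'r) ring_scheme \<Rightarrow> ('g, 'h) monoid_scheme \<Rightarrow> ('o, 'm, 'k) k_cat \<Rightarrow>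
    ('g \<Rightarrow> 'o \<Rightarrow> 'o) \<Rightarrow> ('g \<Rightarrow> 'o \<Rightarrow> 'o \<Rightarrow> 'm \<Rightarrow> 'm) \<Rightarrow> 'o set \<Rightarrow> 'o set \<Rightarrow>
    ('o \<times> 'o \<Rightarrow> 'm) \<Rightarrow> ('o \<times> 'o \<Rightarrow> 'm) set" where
  "orbit_class k G C \<phi> \<psi> \<beta> \<alpha> \<xi> =
    orbit_submodule k G C \<phi> \<psi> \<beta> \<alpha> +>\<^bsub>orbit_module C \<beta> \<alpha>\<^esub> \<xi>"

definition translation :: "('g, 'h) monoid_scheme \<Rightarrow> ('g \<Rightarrow> 'o \<Rightarrow> 'o) \<Rightarrow> 'o \<Rightarrow> 'o \<Rightarrow> 'g" where
  "translation G \<phi> y y' = (THE s. s \<in> carrier G \<and> \<phi> s y = y')"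

text \<open>
  The bilinear extension to direct sums of the rule sending \<open>g \<in> \<^sub>zC\<^sub>y\<^sub>'\<close> and \<open>f \<in> \<^sub>yC\<^sub>x\<close>,
  where \<open>s y = y'\<close>, to \<open>g (s f)\<close>, a morphism from \<open>s x\<close> to \<open>z\<close>.
\<close>

definition orbit_module_comp ::
  "('g, 'h) monoid_scheme \<Rightarrow> ('o, 'm, 'k) k_cat \<Rightarrow>
    ('g \<Rightarrow> 'o \<Rightarrow> 'o) \<Rightarrow> ('g \<Rightarrow> 'o \<Rightarrow> 'o \<Rightarrow> 'm \<Rightarrow> 'm) \<Rightarrow> 'o set \<Rightarrow> 'o set \<Rightarrow> 'o set \<Rightarrow>
    ('o \<times> 'o \<Rightarrow> 'm) \<Rightarrow> ('o \<times> 'o \<Rightarrow> 'm) \<Rightarrow> 'o \<times> 'o \<Rightarrow> 'm" where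
  "orbit_module_comp G C \<phi> \<psi> \<gamma> \<beta> \<alpha> \<eta> \<xi> =
    finsum (orbit_module C \<gamma> \<alpha>)
      (\<lambda>(z, y').
        finsum (orbit_module C \<gamma> \<alpha>)
          (\<lambda>(y, x).
            let s = translation G \<phi> y y' in
              orbit_module_inj C \<gamma> \<alpha> z (\<phi> s x)
                (Comp C z y' (\<phi> s x) (\<eta> (z, y')) (\<psi> s y x (\<xi> (y, x)))))
          {(y, x) \<in> \<beta> \<times> \<alpha>. \<xi> (y, x) \<noteq> \<zero>\<^bsub>Hom C y x\<^esub>})
      {(z, y') \<in> \<gamma> \<times> \<beta>. \<eta> (z, y') \<noteq> \<zero>\<^bsub>Hom C z y'\<^esub>}"

definition quotient_category ::
  "('k, 'r) ring_scheme \<Rightarrow> ('g, 'h) monoid_scheme \<Rightarrow> ('o, 'm, 'k) k_cat \<Rightarrow>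
    ('g \<Rightarrow> 'o \<Rightarrow> 'o) \<Rightarrow> ('g \<Rightarrow> 'o \<Rightarrow> 'o \<Rightarrow> 'm \<Rightarrow> 'm) \<Rightarrow> ('o set, ('o \<times> 'o \<Rightarrow> 'm) set, 'k) k_cat"
  where
  "quotient_category k G C \<phi> \<psi> =
    \<lparr>Ob = orbits G (Ob C) \<phi>,
     Hom = (\<lambda>\<beta> \<alpha>. coinvariants k G (orbit_module C \<beta> \<alpha>) (orbit_module_act G \<phi> \<psi> \<beta> \<alpha>)),
     Comp = (\<lambda>\<gamma> \<beta> \<alpha> B A. \<Union>\<eta>\<in>B. \<Union>\<xi>\<in>A.
       orbit_class k G C \<phi> \<psi> \<gamma> \<alpha> (orbit_module_comp G C \<phi> \<psi> \<gamma> \<beta> \<alpha> \<eta> \<xi>)),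
     Id = (\<lambda>\<alpha>. \<Union>x\<in>\<alpha>. orbit_class k G C \<phi> \<psi> \<alpha> \<alpha> (orbit_module_inj C \<alpha> \<alpha> x x (Id C x)))\<rparr>"


section \<open>Graded categories and smash products\<close>

text \<open>\<open>D s y x\<close> is the component of degree \<open>s\<close> of the module of morphisms from \<open>x\<close> to \<open>y\<close>.\<close>

locale G_graded_category = k_category k B + group G
  for k :: "('k, 'r) ring_scheme"
    and G :: "('g, 'h) monoid_scheme" (structure)
    and B :: "('o, 'm, 'k) k_cat" +
  fixes D :: "'g \<Rightarrow> 'o \<Rightarrow> 'o \<Rightarrow> 'm set"
  assumes decomposition:
      "\<lbrakk>x \<in> Ob B; y \<in> Ob B\<rbrakk> \<Longrightarrow> internal_direct_sum k (Hom B y x) (carrier G) (\<lambda>s. D s y x)"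
    and Comp_degree:
      "\<lbrakk>x \<in> Ob B; y \<in> Ob B; z \<in> Ob B; s \<in> carrier G; t \<in> carrier G;
        f \<in> D s y x; g \<in> D t z y\<rbrakk> \<Longrightarrow> Comp B z y x g f \<in> D (t \<otimes> s) z x"
    and Id_degree:
      "x \<in> Ob B \<Longrightarrow> Id B x \<in> D \<one> x x"

definition smash_product ::
  "('g, 'h) monoid_scheme \<Rightarrow> ('o, 'm, 'k) k_cat \<Rightarrow> ('g \<Rightarrow> 'o \<Rightarrow> 'o \<Rightarrow> 'm set) \<Rightarrow>
    ('o \<times> 'g, 'm, 'k) k_cat" where
  "smash_product G B D =
    \<lparr>Ob = Ob B \<times> carrier G,
     Hom = (\<lambda>(y, t) (x, s). (Hom B y x)\<lparr>carrier := D (inv\<^bsub>G\<^esub> t \<otimes>\<^bsub>G\<^esub> s) y x\<rparr>),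
     Comp = (\<lambda>(z, u) (y, t) (x, s). Comp B z y x),
     Id = (\<lambda>(x, s). Id B x)\<rparr>"

end

theory Submission
  imports Defs
begin

text \<open>
  Choose a representative \<open>r \<alpha>\<close> of every orbit \<open>\<alpha>\<close>.  Since the action is free, each class in
  \<open>\<^sub>\<beta>(C/G)\<^sub>\<alpha>\<close> is in a unique way a finite sum of classes of morphisms \<open>s (r \<alpha>) \<rightarrow> r \<beta>\<close>, and
  the summand at \<open>s\<close> is declared to have degree \<open>s\<close>.  Composing \<open>g : t (r \<beta>) \<rightarrow> r \<gamma>\<close> with
  \<open>f : s (r \<alpha>) \<rightarrow> r \<beta>\<close> yields \<open>g (t f) : t s (r \<alpha>) \<rightarrow> r \<gamma>\<close>, so degrees multiply.  The isomorphism
  sends \<open>(\<alpha>, s)\<close> to \<open>s (r \<alpha>)\<close>, and a class of degree \<open>t\<^sup>-\<^sup>1 s\<close> represented by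
  \<open>f : t\<^sup>-\<^sup>1 s (r \<alpha>) \<rightarrow> r \<beta>\<close> to \<open>t f : s (r \<alpha>) \<rightarrow> t (r \<beta>)\<close>.  Uniqueness of \<open>f\<close> is detected by the
  \<open>G\<close>-invariant maps \<open>\<xi> \<mapsto> \<Sum>\<^sub>u u\<^sup>-\<^sup>1 \<xi>(u y, u x)\<close>, which descend to coinvariants.
\<close>

section \<open>Module homomorphisms\<close>

text \<open>The grading depends on the choice of representatives: replacing each
  \<open>r \<alpha>\<close> by \<open>h_\<alpha> (r \<alpha>)\<close> turns degree s into
  \<open>h_\<beta> s h_\<alpha>^-1\<close>. Two obstacles shape the proof. Equality of classes means
  that a difference lies in a generated submodule, so independence of classes cannot be read off
  from coordinates and has to be detected by maps out of the quotient. The sum defining these maps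
  makes sense for infinite G because freeness lets a component of \<xi> at (y', x') contribute for
  at most one u, the one with u y = y'. Moreover, composition is prescribed only on single
  components. Its bilinear extension \<open>P\<close> to direct sums is already associative,
  invariant under G in the right argument and right unital, but in the left argument it is only
  equivariant, and the left unit law fails before passing to classes. Identities are therefore
  checked on single components, extended by linearity, and then carried over to classes.\<close>

lemma module_homI:
  assumes "\<And>m. m \<in> carrier M \<Longrightarrow> h m \<in> carrier N"
    and "\<And>m n. \<lbrakk>m \<in> carrier M; n \<in> carrier M\<rbrakk> \<Longrightarrow> h (m \<oplus>\<^bsub>M\<^esub> n) = h m \<oplus>\<^bsub>N\<^esub> h n"
    and "\<And>r m. \<lbrakk>r \<in> carrier k; m \<in> carrier M\<rbrakk> \<Longrightarrow> h (r \<odot>\<^bsub>M\<^esub> m) = r \<odot>\<^bsub>N\<^esub> h m"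
  shows "h \<in> module_hom k M N"
  using assms by (auto simp: module_hom_def hom_def)

lemma module_homD:
  assumes "h \<in> module_hom k M N"
  shows module_hom_closed: "m \<in> carrier M \<Longrightarrow> h m \<in> carrier N"
    and module_hom_add: "\<lbrakk>m \<in> carrier M; n \<in> carrier M\<rbrakk> \<Longrightarrow> h (m \<oplus>\<^bsub>M\<^esub> n) = h m \<oplus>\<^bsub>N\<^esub> h n"
    and module_hom_smult: "\<lbrakk>r \<in> carrier k; m \<in> carrier M\<rbrakk> \<Longrightarrow> h (r \<odot>\<^bsub>M\<^esub> m) = r \<odot>\<^bsub>N\<^esub> h m"
  using assms by (auto simp: module_hom_def hom_def)

lemma abelian_group_hom_of_module_hom:
  assumes "module k M" and "module k N" and "h \<in> module_hom k M N"
  shows "abelian_group_hom M N h"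
proof -
  interpret M: module k M by fact
  interpret N: module k N by fact
  show ?thesis
    using assms(3) by unfold_locales (simp add: module_hom_def)
qed

lemma module_hom_zero:
  assumes "module k M" and "module k N" and "h \<in> module_hom k M N"
  shows "h \<zero>\<^bsub>M\<^esub> = \<zero>\<^bsub>N\<^esub>"
  using abelian_group_hom.hom_zero[OF abelian_group_hom_of_module_hom[OF assms]] .

lemma module_hom_uminus:
  assumes "module k M" and "module k N" and "h \<in> module_hom k M N" and "m \<in> carrier M"
  shows "h (\<ominus>\<^bsub>M\<^esub> m) = \<ominus>\<^bsub>N\<^esub> h m"
  using abelian_group_hom.hom_a_inv[OF abelian_group_hom_of_module_hom[OF assms(1-3)]] assms(4) .

lemma module_hom_minus:
  assumes "module k M" and "module k N" and "h \<in> module_hom k M N"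
    and "m \<in> carrier M" and "n \<in> carrier M"
  shows "h (m \<ominus>\<^bsub>M\<^esub> n) = h m \<ominus>\<^bsub>N\<^esub> h n"
proof -
  interpret M: module k M by fact
  show ?thesis
    using assms(4,5) unfolding a_minus_def
    by (simp add: module_hom_add[OF assms(3)] module_hom_uminus[OF assms(1-3)])
qed

lemma module_hom_finsum:
  assumes "module k M" and "module k N" and h: "h \<in> module_hom k M N"
    and "finite F" and "f \<in> F \<rightarrow> carrier M"
  shows "h (\<Oplus>\<^bsub>M\<^esub>i\<in>F. f i) = (\<Oplus>\<^bsub>N\<^esub>i\<in>F. h (f i))"
  using assms(4,5)
proof induction
  interpret M: module k M by fact
  interpret N: module k N by fact
  {
    case empty
    then show ?case
      by (simp add: module_hom_zero[OF assms(1-3)])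
  next
    case (insert i F)
    moreover have "(\<lambda>i. h (f i)) \<in> F \<rightarrow> carrier N"
      using insert.prems by (auto intro: module_hom_closed[OF h])
    ultimately show ?case
      using module_hom_closed[OF h] by (simp add: module_hom_add[OF h] Pi_iff)
  }
qed

lemma module_hom_ident: "(\<lambda>m. m) \<in> module_hom k M M"
  by (rule module_homI) auto

lemma module_hom_comp:
  assumes "f \<in> module_hom k L M" and "g \<in> module_hom k M N"
  shows "(\<lambda>l. g (f l)) \<in> module_hom k L N"
  using assms by (intro module_homI) (simp_all add: module_homD)

lemma module_hom_const_zero:
  assumes "module k N"
  shows "(\<lambda>m. \<zero>\<^bsub>N\<^esub>) \<in> module_hom k M N"
proof -
  interpret N: module k N by fact
  show ?thesis
    by (intro module_homI) simp_all
qed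

text \<open>Maps on a quotient are known here only through their values on classes. Surjectivity of
  \<open>q\<close> lets each linearity equation be pulled back to \<open>M\<close>, where it is the
  linearity of \<open>f\<close>.\<close>

lemma module_hom_factor:
  assumes M: "module k M" and q: "q \<in> module_hom k M Q" and surj: "carrier Q = q ` carrier M"
    and f: "f \<in> module_hom k M N" and eq: "\<And>m. m \<in> carrier M \<Longrightarrow> g (q m) = f m"
  shows "g \<in> module_hom k Q N"
proof -
  interpret M: module k M by fact
  show ?thesis
  proof (rule module_homI)
    fix a b assume "a \<in> carrier Q" "b \<in> carrier Q"
    then obtain m n where "m \<in> carrier M" "a = q m" "n \<in> carrier M" "b = q n"
      by (auto simp: surj)
    then show "g (a \<oplus>\<^bsub>Q\<^esub> b) = g a \<oplus>\<^bsub>N\<^esub> g b"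
      by (simp add: module_hom_add[OF q, symmetric] eq module_hom_add[OF f])
  next
    fix r a assume "r \<in> carrier k" "a \<in> carrier Q"
    then obtain m where "r \<in> carrier k" "m \<in> carrier M" "a = q m"
      by (auto simp: surj)
    then show "g (r \<odot>\<^bsub>Q\<^esub> a) = r \<odot>\<^bsub>N\<^esub> g a"
      by (simp add: module_hom_smult[OF q, symmetric] eq module_hom_smult[OF f])
  qed (auto simp: surj eq module_hom_closed[OF f])
qed

text \<open>Morphism modules of a smash product are those of the graded category with a smaller
  carrier and the same operations; this is how linear maps pass to them.\<close>

lemma module_hom_restrict:
  assumes "h \<in> module_hom k M N" and "S \<subseteq> carrier M" and "h ` S \<subseteq> T"
  shows "h \<in> module_hom k (M\<lparr>carrier := S\<rparr>) (N\<lparr>carrier := T\<rparr>)"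
  using assms by (auto simp: subset_iff module_homD intro!: module_homI)

lemma module_hom_sum:
  assumes N: "module k N" and "finite F" and "\<And>i. i \<in> F \<Longrightarrow> h i \<in> module_hom k M N"
  shows "(\<lambda>m. \<Oplus>\<^bsub>N\<^esub>i\<in>F. h i m) \<in> module_hom k M N"
proof -
  interpret N: module k N by fact
  have closed: "(\<lambda>i. h i m) \<in> F \<rightarrow> carrier N" if "m \<in> carrier M" for m
    using that assms(3) by (auto dest: module_hom_closed)
  show ?thesis
  proof (rule module_homI)
    fix m n assume mn: "m \<in> carrier M" "n \<in> carrier M"
    have "(\<Oplus>\<^bsub>N\<^esub>i\<in>F. h i (m \<oplus>\<^bsub>M\<^esub> n)) = (\<Oplus>\<^bsub>N\<^esub>i\<in>F. h i m \<oplus>\<^bsub>N\<^esub> h i n)"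
      using mn closed by (intro N.finsum_cong') (auto simp: module_hom_add[OF assms(3)])
    also have "\<dots> = (\<Oplus>\<^bsub>N\<^esub>i\<in>F. h i m) \<oplus>\<^bsub>N\<^esub> (\<Oplus>\<^bsub>N\<^esub>i\<in>F. h i n)"
      using mn closed by (intro N.finsum_addf) auto
    finally show "(\<Oplus>\<^bsub>N\<^esub>i\<in>F. h i (m \<oplus>\<^bsub>M\<^esub> n)) = (\<Oplus>\<^bsub>N\<^esub>i\<in>F. h i m) \<oplus>\<^bsub>N\<^esub> (\<Oplus>\<^bsub>N\<^esub>i\<in>F. h i n)" .
  next
    fix r m assume rm: "r \<in> carrier k" "m \<in> carrier M"
    have "(\<Oplus>\<^bsub>N\<^esub>i\<in>F. h i (r \<odot>\<^bsub>M\<^esub> m)) = (\<Oplus>\<^bsub>N\<^esub>i\<in>F. r \<odot>\<^bsub>N\<^esub> h i m)"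
      using rm closed[OF rm(2)] by (intro N.finsum_cong') (auto simp: module_hom_smult[OF assms(3)])
    also have "\<dots> = r \<odot>\<^bsub>N\<^esub> (\<Oplus>\<^bsub>N\<^esub>i\<in>F. h i m)"
      using rm closed assms(2) by (simp add: N.finsum_smult_ldistr)
    finally show "(\<Oplus>\<^bsub>N\<^esub>i\<in>F. h i (r \<odot>\<^bsub>M\<^esub> m)) = r \<odot>\<^bsub>N\<^esub> (\<Oplus>\<^bsub>N\<^esub>i\<in>F. h i m)" .
  qed (auto intro!: N.finsum_closed dest: closed)
qed

lemma module_hom_image_submodule:
  assumes M: "module k M" and N: "module k N" and h: "h \<in> module_hom k M N"
  shows "submodule (h ` carrier M) k N"
proof -
  interpret M: module k M by fact
  interpret N: module k N by fact
  show ?thesis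
  proof (rule N.submoduleI)
    show "h ` carrier M \<subseteq> carrier N"
      using module_hom_closed[OF h] by blast
    show "\<zero>\<^bsub>N\<^esub> \<in> h ` carrier M"
      by (rule image_eqI[where x = "\<zero>\<^bsub>M\<^esub>"]) (simp_all add: module_hom_zero[OF assms])
  next
    fix a assume "a \<in> h ` carrier M"
    then obtain m where "m \<in> carrier M" "a = h m" by blast
    then show "\<ominus>\<^bsub>N\<^esub> a \<in> h ` carrier M"
      by (intro image_eqI[where x = "\<ominus>\<^bsub>M\<^esub> m"]) (simp_all add: module_hom_uminus[OF assms])
  next
    fix a b assume "a \<in> h ` carrier M" "b \<in> h ` carrier M"
    then obtain m n where "m \<in> carrier M" "a = h m" "n \<in> carrier M" "b = h n" by blast
    then show "a \<oplus>\<^bsub>N\<^esub> b \<in> h ` carrier M"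
      by (intro image_eqI[where x = "m \<oplus>\<^bsub>M\<^esub> n"]) (simp_all add: module_hom_add[OF h])
  next
    fix a b assume a: "a \<in> carrier k" and "b \<in> h ` carrier M"
    then obtain m where "m \<in> carrier M" "b = h m" by blast
    with a show "a \<odot>\<^bsub>N\<^esub> b \<in> h ` carrier M"
      by (intro image_eqI[where x = "a \<odot>\<^bsub>M\<^esub> m"]) (simp_all add: module_hom_smult[OF h])
  qed
qed

section \<open>Direct sums\<close>

lemma direct_sum_carrierD:
  assumes "c \<in> carrier (direct_sum I M)"
  shows "i \<in> I \<Longrightarrow> c i \<in> carrier (M i)"
    and "c \<in> extensional I"
    and "finite {i \<in> I. c i \<noteq> \<zero>\<^bsub>M i\<^esub>}"
  using assms by (auto simp: direct_sum_def PiE_def)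

lemma direct_sum_carrierI:
  assumes "\<And>i. i \<in> I \<Longrightarrow> c i \<in> carrier (M i)"
    and "c \<in> extensional I"
    and "finite {i \<in> I. c i \<noteq> \<zero>\<^bsub>M i\<^esub>}"
  shows "c \<in> carrier (direct_sum I M)"
  using assms by (auto simp: direct_sum_def PiE_def)

lemma direct_sum_simps:
  "\<zero>\<^bsub>direct_sum I M\<^esub> = (\<lambda>i\<in>I. \<zero>\<^bsub>M i\<^esub>)"
  "c \<oplus>\<^bsub>direct_sum I M\<^esub> d = (\<lambda>i\<in>I. c i \<oplus>\<^bsub>M i\<^esub> d i)"
  "r \<odot>\<^bsub>direct_sum I M\<^esub> c = (\<lambda>i\<in>I. r \<odot>\<^bsub>M i\<^esub> c i)"
  by (simp_all add: direct_sum_def)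

lemma module_direct_sum:
  assumes "cring k" and M: "\<And>i. i \<in> I \<Longrightarrow> module k (M i)"
  shows "module k (direct_sum I M)"
proof -
  let ?S = "direct_sum I M"
  note abel = module.axioms(2)[OF M]
  note amon = abelian_group.axioms(1)[OF abel]
  have add: "c \<oplus>\<^bsub>?S\<^esub> d \<in> carrier ?S" if c: "c \<in> carrier ?S" and d: "d \<in> carrier ?S" for c d
  proof (rule direct_sum_carrierI)
    have "{i \<in> I. (c \<oplus>\<^bsub>?S\<^esub> d) i \<noteq> \<zero>\<^bsub>M i\<^esub>}
        \<subseteq> {i \<in> I. c i \<noteq> \<zero>\<^bsub>M i\<^esub>} \<union> {i \<in> I. d i \<noteq> \<zero>\<^bsub>M i\<^esub>}"
      by (auto simp: direct_sum_simps abelian_monoid.l_zero[OF amon] abelian_monoid.zero_closed[OF amon])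
    then show "finite {i \<in> I. (c \<oplus>\<^bsub>?S\<^esub> d) i \<noteq> \<zero>\<^bsub>M i\<^esub>}"
      using direct_sum_carrierD(3)[OF c] direct_sum_carrierD(3)[OF d]
      by (meson finite_UnI finite_subset)
  qed (auto simp: direct_sum_simps direct_sum_carrierD[OF c] direct_sum_carrierD[OF d]
      abelian_monoid.a_closed[OF amon])
  have zero: "\<zero>\<^bsub>?S\<^esub> \<in> carrier ?S"
    by (rule direct_sum_carrierI) (auto simp: direct_sum_simps abelian_monoid.zero_closed[OF amon])
  have neg: "\<exists>d\<in>carrier ?S. d \<oplus>\<^bsub>?S\<^esub> c = \<zero>\<^bsub>?S\<^esub>" if c: "c \<in> carrier ?S" for c
  proof
    let ?d = "\<lambda>i\<in>I. \<ominus>\<^bsub>M i\<^esub> c i"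
    show "?d \<in> carrier ?S"
    proof (rule direct_sum_carrierI)
      have "{i \<in> I. ?d i \<noteq> \<zero>\<^bsub>M i\<^esub>} \<subseteq> {i \<in> I. c i \<noteq> \<zero>\<^bsub>M i\<^esub>}"
        by (auto simp: abelian_group.minus_equality[OF abel] abelian_monoid.l_zero[OF amon]
            abelian_monoid.zero_closed[OF amon])
      then show "finite {i \<in> I. ?d i \<noteq> \<zero>\<^bsub>M i\<^esub>}"
        using direct_sum_carrierD(3)[OF c] by (rule finite_subset)
    qed (auto simp: direct_sum_carrierD[OF c] abelian_group.a_inv_closed[OF abel])
    show "?d \<oplus>\<^bsub>?S\<^esub> c = \<zero>\<^bsub>?S\<^esub>"
      by (auto simp: direct_sum_simps direct_sum_carrierD[OF c] abelian_group.l_neg[OF abel])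
  qed
  have smult: "r \<odot>\<^bsub>?S\<^esub> c \<in> carrier ?S" if r: "r \<in> carrier k" and c: "c \<in> carrier ?S" for r c
  proof (rule direct_sum_carrierI)
    have "{i \<in> I. (r \<odot>\<^bsub>?S\<^esub> c) i \<noteq> \<zero>\<^bsub>M i\<^esub>} \<subseteq> {i \<in> I. c i \<noteq> \<zero>\<^bsub>M i\<^esub>}"
      by (auto simp: direct_sum_simps r module.smult_r_null[OF M])
    then show "finite {i \<in> I. (r \<odot>\<^bsub>?S\<^esub> c) i \<noteq> \<zero>\<^bsub>M i\<^esub>}"
      using direct_sum_carrierD(3)[OF c] by (rule finite_subset)
  qed (auto simp: direct_sum_simps direct_sum_carrierD[OF c] r module.smult_closed[OF M])
  have "abelian_group ?S"
  proof (rule abelian_groupI)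
    fix c d e assume *: "c \<in> carrier ?S" "d \<in> carrier ?S" "e \<in> carrier ?S"
    then show "c \<oplus>\<^bsub>?S\<^esub> d \<oplus>\<^bsub>?S\<^esub> e = c \<oplus>\<^bsub>?S\<^esub> (d \<oplus>\<^bsub>?S\<^esub> e)"
      unfolding direct_sum_simps
      by (intro restrict_ext) (simp add: abelian_monoid.a_assoc[OF amon] direct_sum_carrierD)
  next
    fix c d assume *: "c \<in> carrier ?S" "d \<in> carrier ?S"
    then show "c \<oplus>\<^bsub>?S\<^esub> d = d \<oplus>\<^bsub>?S\<^esub> c"
      unfolding direct_sum_simps
      by (intro restrict_ext) (simp add: abelian_monoid.a_comm[OF amon] direct_sum_carrierD)
  next
    fix c assume *: "c \<in> carrier ?S"
    show "\<zero>\<^bsub>?S\<^esub> \<oplus>\<^bsub>?S\<^esub> c = c"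
      unfolding direct_sum_simps using direct_sum_carrierD[OF *]
      by (auto simp: extensional_def fun_eq_iff abelian_monoid.l_zero[OF amon])
  qed (use add zero neg in auto)
  then show ?thesis
  proof (rule moduleI[OF assms(1)])
    fix c assume *: "c \<in> carrier ?S"
    show "\<one>\<^bsub>k\<^esub> \<odot>\<^bsub>?S\<^esub> c = c"
      unfolding direct_sum_simps using direct_sum_carrierD[OF *]
      by (auto simp: extensional_def fun_eq_iff module.smult_one[OF M])
  qed (use smult in \<open>auto simp: direct_sum_simps fun_eq_iff direct_sum_carrierD module.smult_l_distr[OF M]
        module.smult_r_distr[OF M] module.smult_assoc1[OF M]\<close>)
qed

lemma direct_sum_inj_hom:
  assumes M: "\<And>i. i \<in> I \<Longrightarrow> module k (M i)" and i: "i \<in> I"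
  shows "direct_sum_inj I M i \<in> module_hom k (M i) (direct_sum I M)"
proof -
  note amon = abelian_group.axioms(1)[OF module.axioms(2)[OF M]]
  show ?thesis
  proof (rule module_homI)
    fix m assume "m \<in> carrier (M i)"
    then show "direct_sum_inj I M i m \<in> carrier (direct_sum I M)"
      using i by (intro direct_sum_carrierI)
        (auto simp: direct_sum_inj_def abelian_monoid.zero_closed[OF amon] intro: finite_subset[of _ "{i}"])
  qed (use i in \<open>auto simp: direct_sum_inj_def direct_sum_simps fun_eq_iff abelian_monoid.l_zero[OF amon]
        abelian_monoid.zero_closed[OF amon] module.smult_r_null[OF M]\<close>)
qed

text \<open>Induction on a finite set \<open>F\<close> bounding the support, for all elements at
  once: the component at a new index is split off with \<open>direct_sum_inj\<close>, and what
  remains is supported in \<open>F\<close>.\<close>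

lemma direct_sum_induct [consumes 3, case_names zero inj add]:
  assumes "cring k" and M: "\<And>i. i \<in> I \<Longrightarrow> module k (M i)" and c: "c \<in> carrier (direct_sum I M)"
    and zero: "P \<zero>\<^bsub>direct_sum I M\<^esub>"
    and inj: "\<And>i m. \<lbrakk>i \<in> I; m \<in> carrier (M i)\<rbrakk> \<Longrightarrow> P (direct_sum_inj I M i m)"
    and add: "\<And>c d. \<lbrakk>c \<in> carrier (direct_sum I M); d \<in> carrier (direct_sum I M); P c; P d\<rbrakk> \<Longrightarrow>
      P (c \<oplus>\<^bsub>direct_sum I M\<^esub> d)"
  shows "P c"
proof -
  note amon = abelian_group.axioms(1)[OF module.axioms(2)[OF M]]
  have "\<forall>c\<in>carrier (direct_sum I M). {i \<in> I. c i \<noteq> \<zero>\<^bsub>M i\<^esub>} \<subseteq> F \<longrightarrow> P c" if "finite F" for F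
    using that
  proof induction
    case empty
    show ?case
    proof (intro ballI impI)
      fix c assume c: "c \<in> carrier (direct_sum I M)" and "{i \<in> I. c i \<noteq> \<zero>\<^bsub>M i\<^esub>} \<subseteq> {}"
      then have "c = \<zero>\<^bsub>direct_sum I M\<^esub>"
        using direct_sum_carrierD(2)[OF c] by (auto simp: direct_sum_simps fun_eq_iff extensional_def)
      with zero show "P c" by simp
    qed
  next
    case (insert i F)
    show ?case
    proof (intro ballI impI)
      fix c assume c: "c \<in> carrier (direct_sum I M)" and supp: "{i \<in> I. c i \<noteq> \<zero>\<^bsub>M i\<^esub>} \<subseteq> insert i F"
      show "P c"
      proof (cases "i \<in> I")
        case False
        then show ?thesis using supp insert.IH c by auto
      next
        case True
        let ?d = "\<lambda>j\<in>I. if j = i then \<zero>\<^bsub>M j\<^esub> else c j"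
        have d: "?d \<in> carrier (direct_sum I M)"
          by (rule direct_sum_carrierI)
            (auto simp: direct_sum_carrierD[OF c] abelian_monoid.zero_closed[OF amon]
              intro: finite_subset[OF _ direct_sum_carrierD(3)[OF c]])
        have "{i \<in> I. ?d i \<noteq> \<zero>\<^bsub>M i\<^esub>} \<subseteq> F"
          using supp by auto
        then have "P ?d"
          using insert.IH d by blast
        then have "P (direct_sum_inj I M i (c i) \<oplus>\<^bsub>direct_sum I M\<^esub> ?d)"
          using inj[OF True] direct_sum_carrierD(1)[OF c True] d
            module_hom_closed[OF direct_sum_inj_hom[of I k M i, OF M True]]
          by (intro add) auto
        moreover have "direct_sum_inj I M i (c i) \<oplus>\<^bsub>direct_sum I M\<^esub> ?d = c"
          using True direct_sum_carrierD[OF c]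
          by (auto simp: direct_sum_simps direct_sum_inj_def fun_eq_iff extensional_def
              abelian_monoid.l_zero[OF amon] abelian_monoid.r_zero[OF amon])
        ultimately show ?thesis
          by simp
      qed
    qed
  qed
  then show ?thesis
    using direct_sum_carrierD(3)[OF c] c by blast
qed

lemma direct_sum_hom_eqI:
  assumes "cring k" and M: "\<And>i. i \<in> I \<Longrightarrow> module k (M i)" and N: "module k N"
    and f: "f \<in> module_hom k (direct_sum I M) N" and g: "g \<in> module_hom k (direct_sum I M) N"
    and eq: "\<And>i m. \<lbrakk>i \<in> I; m \<in> carrier (M i)\<rbrakk> \<Longrightarrow> f (direct_sum_inj I M i m) = g (direct_sum_inj I M i m)"
    and c: "c \<in> carrier (direct_sum I M)"
  shows "f c = g c"
proof (rule direct_sum_induct[of k I M c "\<lambda>c. f c = g c", OF assms(1) M c])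
  have S: "module k (direct_sum I M)"
    using assms(1) M by (rule module_direct_sum)
  show "f \<zero>\<^bsub>direct_sum I M\<^esub> = g \<zero>\<^bsub>direct_sum I M\<^esub>"
    by (simp add: module_hom_zero[OF S N f] module_hom_zero[OF S N g])
qed (auto simp: eq module_hom_add[OF f] module_hom_add[OF g])

text \<open>The map out of the direct sum given by its universal property. Summing over the support
  makes sense for infinite \<open>I\<close> and gives the exact shape of the two sums in
  \<open>orbit_module_comp\<close>.\<close>

definition direct_sum_lift ::
  "'i set \<Rightarrow> ('i \<Rightarrow> ('k, 'm) module) \<Rightarrow> ('k, 'n) module \<Rightarrow> ('i \<Rightarrow> 'm \<Rightarrow> 'n) \<Rightarrow> ('i \<Rightarrow> 'm) \<Rightarrow> 'n" where
  "direct_sum_lift I M N h c = (\<Oplus>\<^bsub>N\<^esub>i\<in>{i \<in> I. c i \<noteq> \<zero>\<^bsub>M i\<^esub>}. h i (c i))"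

text \<open>The support varies with \<open>c\<close>, so sums for different elements are comparable
  only over a common index set. Enlarging the set is harmless because each \<open>h i\<close> sends
  zero to zero.\<close>

lemma direct_sum_lift_superset:
  assumes M: "\<And>i. i \<in> I \<Longrightarrow> module k (M i)" and N: "module k N"
    and h: "\<And>i. i \<in> I \<Longrightarrow> h i \<in> module_hom k (M i) N"
    and c: "c \<in> carrier (direct_sum I M)"
    and F: "finite F" "F \<subseteq> I" "{i \<in> I. c i \<noteq> \<zero>\<^bsub>M i\<^esub>} \<subseteq> F"
  shows "direct_sum_lift I M N h c = (\<Oplus>\<^bsub>N\<^esub>i\<in>F. h i (c i))"
proof -
  interpret N: module k N by fact
  show ?thesis
    unfolding direct_sum_lift_def
  proof (rule N.add.finprod_mono_neutral_cong_left[OF F(1,3)])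
    fix i assume "i \<in> F - {i \<in> I. c i \<noteq> \<zero>\<^bsub>M i\<^esub>}"
    then show "h i (c i) = \<zero>\<^bsub>N\<^esub>"
      using F(2) module_hom_zero[OF M N h] by auto
  qed (use F(2) direct_sum_carrierD(1)[OF c] module_hom_closed[OF h] in auto)
qed

lemma direct_sum_lift_hom:
  assumes M: "\<And>i. i \<in> I \<Longrightarrow> module k (M i)" and N: "module k N"
    and h: "\<And>i. i \<in> I \<Longrightarrow> h i \<in> module_hom k (M i) N"
  shows "direct_sum_lift I M N h \<in> module_hom k (direct_sum I M) N"
proof -
  interpret N: module k N by fact
  interpret S: module k "direct_sum I M"
    using N.R.cring_axioms M by (rule module_direct_sum)
  note lift = direct_sum_lift_superset[OF M N h]
  have closed: "(\<lambda>i. h i (c i)) \<in> F \<rightarrow> carrier N" if "c \<in> carrier (direct_sum I M)" "F \<subseteq> I" for c F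
    using that direct_sum_carrierD(1)[OF that(1)] module_hom_closed[OF h] by (simp add: Pi_iff subset_iff)
  show ?thesis
  proof (rule module_homI)
    fix c assume "c \<in> carrier (direct_sum I M)"
    then show "direct_sum_lift I M N h c \<in> carrier N"
      unfolding direct_sum_lift_def by (intro N.finsum_closed closed) auto
  next
    fix c d assume c: "c \<in> carrier (direct_sum I M)" and d: "d \<in> carrier (direct_sum I M)"
    \<comment> \<open>The supports of \<open>c\<close>, \<open>d\<close> and their sum may all
      differ, so the three sums are taken over the union and added termwise.\<close>
    define F where "F = {i \<in> I. c i \<noteq> \<zero>\<^bsub>M i\<^esub>} \<union> {i \<in> I. d i \<noteq> \<zero>\<^bsub>M i\<^esub>} \<union>
      {i \<in> I. (c \<oplus>\<^bsub>direct_sum I M\<^esub> d) i \<noteq> \<zero>\<^bsub>M i\<^esub>}"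
    have F: "finite F" "F \<subseteq> I"
      using direct_sum_carrierD(3)[OF c] direct_sum_carrierD(3)[OF d]
        direct_sum_carrierD(3)[OF S.a_closed[OF c d]] by (auto simp: F_def)
    have "direct_sum_lift I M N h (c \<oplus>\<^bsub>direct_sum I M\<^esub> d) =
        (\<Oplus>\<^bsub>N\<^esub>i\<in>F. h i ((c \<oplus>\<^bsub>direct_sum I M\<^esub> d) i))"
      using c d F by (intro lift) (auto simp: F_def)
    also have "\<dots> = (\<Oplus>\<^bsub>N\<^esub>i\<in>F. h i (c i) \<oplus>\<^bsub>N\<^esub> h i (d i))"
      using F(2) closed[OF c F(2)] closed[OF d F(2)]
      by (intro N.finsum_cong')
        (auto simp: direct_sum_simps subset_iff module_hom_add[OF h] direct_sum_carrierD(1)[OF c]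
          direct_sum_carrierD(1)[OF d])
    also have "\<dots> = (\<Oplus>\<^bsub>N\<^esub>i\<in>F. h i (c i)) \<oplus>\<^bsub>N\<^esub> (\<Oplus>\<^bsub>N\<^esub>i\<in>F. h i (d i))"
      using closed[OF c F(2)] closed[OF d F(2)] by (rule N.finsum_addf)
    also have "(\<Oplus>\<^bsub>N\<^esub>i\<in>F. h i (c i)) = direct_sum_lift I M N h c"
      using c F by (intro lift[symmetric]) (auto simp: F_def)
    also have "(\<Oplus>\<^bsub>N\<^esub>i\<in>F. h i (d i)) = direct_sum_lift I M N h d"
      using d F by (intro lift[symmetric]) (auto simp: F_def)
    finally show "direct_sum_lift I M N h (c \<oplus>\<^bsub>direct_sum I M\<^esub> d) =
      direct_sum_lift I M N h c \<oplus>\<^bsub>N\<^esub> direct_sum_lift I M N h d" .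
  next
    fix r c assume r: "r \<in> carrier k" and c: "c \<in> carrier (direct_sum I M)"
    let ?F = "{i \<in> I. c i \<noteq> \<zero>\<^bsub>M i\<^esub>}"
    have F: "finite ?F" "?F \<subseteq> I"
      using direct_sum_carrierD(3)[OF c] by auto
    have "direct_sum_lift I M N h (r \<odot>\<^bsub>direct_sum I M\<^esub> c) =
        (\<Oplus>\<^bsub>N\<^esub>i\<in>?F. h i ((r \<odot>\<^bsub>direct_sum I M\<^esub> c) i))"
      using r F by (intro lift S.smult_closed[OF r c]) (auto simp: direct_sum_simps module.smult_r_null[OF M])
    also have "\<dots> = (\<Oplus>\<^bsub>N\<^esub>i\<in>?F. r \<odot>\<^bsub>N\<^esub> h i (c i))"
      using closed[OF c F(2)] r
      by (intro N.finsum_cong')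
        (auto simp: direct_sum_simps module_hom_smult[OF h] direct_sum_carrierD(1)[OF c])
    also have "\<dots> = r \<odot>\<^bsub>N\<^esub> direct_sum_lift I M N h c"
      using r F(1) closed[OF c F(2)] by (simp add: direct_sum_lift_def N.finsum_smult_ldistr)
    finally show "direct_sum_lift I M N h (r \<odot>\<^bsub>direct_sum I M\<^esub> c) = r \<odot>\<^bsub>N\<^esub> direct_sum_lift I M N h c" .
  qed
qed

lemma direct_sum_lift_inj:
  assumes M: "\<And>i. i \<in> I \<Longrightarrow> module k (M i)" and N: "module k N"
    and h: "\<And>i. i \<in> I \<Longrightarrow> h i \<in> module_hom k (M i) N"
    and i: "i \<in> I" and m: "m \<in> carrier (M i)"
  shows "direct_sum_lift I M N h (direct_sum_inj I M i m) = h i m"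
proof -
  interpret N: module k N by fact
  \<comment> \<open>The index set is \<open>{i}\<close> and not the support, which is empty when
    \<open>m\<close> is zero.\<close>
  have "direct_sum_lift I M N h (direct_sum_inj I M i m) =
      (\<Oplus>\<^bsub>N\<^esub>j\<in>{i}. h j (direct_sum_inj I M i m j))"
    using i module_hom_closed[OF direct_sum_inj_hom[of I k M i, OF M i] m]
    by (intro direct_sum_lift_superset[OF M N h]) (auto simp: direct_sum_inj_def)
  also have "\<dots> = h i m"
    using i m module_hom_closed[OF h[OF i] m] by (simp add: direct_sum_inj_def)
  finally show ?thesis .
qed

text \<open>Both families are padded by zeros to \<open>F \<union> E\<close> and added termwise;
  each \<open>N i\<close> contains zero and is closed under addition. This is the additive step in
  proving that the degree parts span.\<close>

lemma finite_sums_add: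
  assumes M: "module k M" and N: "\<And>i. i \<in> I \<Longrightarrow> submodule (N i) k M"
    and F: "finite F" "F \<subseteq> I" "c \<in> (\<Pi> i\<in>F. N i)"
    and E: "finite E" "E \<subseteq> I" "d \<in> (\<Pi> i\<in>E. N i)"
  shows "\<exists>e H. finite H \<and> H \<subseteq> I \<and> e \<in> (\<Pi> i\<in>H. N i) \<and>
    (\<Oplus>\<^bsub>M\<^esub>i\<in>F. c i) \<oplus>\<^bsub>M\<^esub> (\<Oplus>\<^bsub>M\<^esub>i\<in>E. d i) = (\<Oplus>\<^bsub>M\<^esub>i\<in>H. e i)"
proof -
  interpret M: module k M by fact
  have sub: "a i \<in> carrier M" if "a \<in> (\<Pi> i\<in>A. N i)" "A \<subseteq> I" "i \<in> A" for a A i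
    using that M.submoduleE(1)[OF N] by blast
  have zero: "\<zero>\<^bsub>M\<^esub> \<in> N i" if "i \<in> I" for i
    using subgroup.one_closed[OF submodule.axioms(1)[OF N[OF that]]] by simp
  have ext: "(\<Oplus>\<^bsub>M\<^esub>i\<in>A. a i) = (\<Oplus>\<^bsub>M\<^esub>i\<in>F \<union> E. if i \<in> A then a i else \<zero>\<^bsub>M\<^esub>)"
    if a: "a \<in> (\<Pi> i\<in>A. N i)" and A: "A \<subseteq> F \<union> E" for a A
  proof -
    have "a i \<in> carrier M" if "i \<in> A" for i
      using sub[OF a _ that] A F(2) E(2) by blast
    then show ?thesis
      using A F(1) E(1) by (intro M.add.finprod_mono_neutral_cong_left) auto
  qed
  let ?c = "\<lambda>i. if i \<in> F then c i else \<zero>\<^bsub>M\<^esub>" and ?d = "\<lambda>i. if i \<in> E then d i else \<zero>\<^bsub>M\<^esub>"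
  have closed: "?c \<in> F \<union> E \<rightarrow> carrier M" "?d \<in> F \<union> E \<rightarrow> carrier M"
    using sub[OF F(3,2)] sub[OF E(3,2)] by auto
  have "(\<Oplus>\<^bsub>M\<^esub>i\<in>F. c i) \<oplus>\<^bsub>M\<^esub> (\<Oplus>\<^bsub>M\<^esub>i\<in>E. d i) = (\<Oplus>\<^bsub>M\<^esub>i\<in>F \<union> E. ?c i \<oplus>\<^bsub>M\<^esub> ?d i)"
    using ext[OF F(3)] ext[OF E(3)] M.finsum_addf[OF closed] by simp
  moreover have "(\<lambda>i. ?c i \<oplus>\<^bsub>M\<^esub> ?d i) \<in> (\<Pi> i\<in>F \<union> E. N i)"
    using F(2,3) E(2,3) zero by (auto simp: subset_iff intro!: M.submoduleE(5)[OF N])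
  ultimately show ?thesis
    using F(1,2) E(1,2) by blast
qed

text \<open>A spanning family with orthogonal projections is a direct sum: applying
  \<open>p i\<close> to any finite decomposition of \<open>m\<close> returns its term at
  \<open>i\<close>. This forces uniqueness and leaves the family of all \<open>p i m\<close> as the
  only candidate, which has finite support because some finite decomposition exists.\<close>

lemma internal_direct_sumI:
  assumes M: "module k M" and N: "\<And>i. i \<in> I \<Longrightarrow> submodule (N i) k M"
    and p: "\<And>i. i \<in> I \<Longrightarrow> p i \<in> module_hom k M M"
    and p_range: "\<And>i m. \<lbrakk>i \<in> I; m \<in> carrier M\<rbrakk> \<Longrightarrow> p i m \<in> N i"
    and p_ident: "\<And>i m. \<lbrakk>i \<in> I; m \<in> N i\<rbrakk> \<Longrightarrow> p i m = m"
    and p_zero: "\<And>i j m. \<lbrakk>i \<in> I; j \<in> I; i \<noteq> j; m \<in> N j\<rbrakk> \<Longrightarrow> p i m = \<zero>\<^bsub>M\<^esub>"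
    and spanning: "\<And>m. m \<in> carrier M \<Longrightarrow> \<exists>c F. finite F \<and> F \<subseteq> I \<and> c \<in> (\<Pi> i\<in>F. N i) \<and> m = (\<Oplus>\<^bsub>M\<^esub>i\<in>F. c i)"
  shows "internal_direct_sum k M I N"
proof -
  interpret M: module k M by fact
  have sub: "n \<in> carrier M" if "i \<in> I" "n \<in> N i" for i n
    using M.submoduleE(1)[OF N] that by blast
  have proj: "p i (\<Oplus>\<^bsub>M\<^esub>j\<in>F. c j) = (if i \<in> F then c i else \<zero>\<^bsub>M\<^esub>)"
    if "i \<in> I" "finite F" "F \<subseteq> I" "c \<in> (\<Pi> j\<in>F. N j)" for i F c
  proof -
    have c: "c \<in> F \<rightarrow> carrier M"
      using that sub by blast
    have "p i (\<Oplus>\<^bsub>M\<^esub>j\<in>F. c j) = (\<Oplus>\<^bsub>M\<^esub>j\<in>F. p i (c j))"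
      using that c by (intro module_hom_finsum[OF M M p])
    also have "\<dots> = (\<Oplus>\<^bsub>M\<^esub>j\<in>F. if i = j then c j else \<zero>\<^bsub>M\<^esub>)"
      using that c p_ident p_zero by (intro M.finsum_cong') (auto simp: Pi_iff subset_iff)
    also have "\<dots> = (if i \<in> F then c i else \<zero>\<^bsub>M\<^esub>)"
    proof (cases "i \<in> F")
      case True
      then show ?thesis
        using that c by (simp add: M.add.finprod_singleton)
    next
      case False
      then have "(\<Oplus>\<^bsub>M\<^esub>j\<in>F. if i = j then c j else \<zero>\<^bsub>M\<^esub>) = (\<Oplus>\<^bsub>M\<^esub>j\<in>F. \<zero>\<^bsub>M\<^esub>)"
        by (intro M.finsum_cong') auto
      then show ?thesis
        using False by simp
    qed
    finally show ?thesis .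
  qed
  have "\<exists>!c. c \<in> (\<Pi>\<^sub>E i\<in>I. N i) \<and> finite {i \<in> I. c i \<noteq> \<zero>\<^bsub>M\<^esub>} \<and>
      m = (\<Oplus>\<^bsub>M\<^esub>i\<in>{i \<in> I. c i \<noteq> \<zero>\<^bsub>M\<^esub>}. c i)" if m: "m \<in> carrier M" for m
  proof (rule ex1I[of _ "\<lambda>i\<in>I. p i m"])
    obtain c F where F: "finite F" "F \<subseteq> I" and c: "c \<in> (\<Pi> i\<in>F. N i)" and m_eq: "m = (\<Oplus>\<^bsub>M\<^esub>i\<in>F. c i)"
      using spanning[OF m] by blast
    have pm: "p i m = (if i \<in> F then c i else \<zero>\<^bsub>M\<^esub>)" if "i \<in> I" for i
      using proj[OF that F c] m_eq by simp
    let ?T = "{i \<in> I. (\<lambda>i\<in>I. p i m) i \<noteq> \<zero>\<^bsub>M\<^esub>}"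
    have TF: "?T \<subseteq> F"
      by (auto simp: pm)
    have "m = (\<Oplus>\<^bsub>M\<^esub>i\<in>?T. (\<lambda>i\<in>I. p i m) i)"
    proof (rule trans[OF m_eq M.add.finprod_mono_neutral_cong_left[symmetric, OF F(1) TF]])
      fix i assume i: "i \<in> F - ?T"
      then show "c i = \<zero>\<^bsub>M\<^esub>"
        using pm F(2) by auto
    qed (use F c sub pm in \<open>auto simp: subset_iff Pi_iff\<close>)
    then show "(\<lambda>i\<in>I. p i m) \<in> (\<Pi>\<^sub>E i\<in>I. N i) \<and> finite ?T \<and> m = (\<Oplus>\<^bsub>M\<^esub>i\<in>?T. (\<lambda>i\<in>I. p i m) i)"
      using p_range m finite_subset[OF TF F(1)] by auto
  next
    fix c assume c: "c \<in> (\<Pi>\<^sub>E i\<in>I. N i) \<and> finite {i \<in> I. c i \<noteq> \<zero>\<^bsub>M\<^esub>} \<and>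
      m = (\<Oplus>\<^bsub>M\<^esub>i\<in>{i \<in> I. c i \<noteq> \<zero>\<^bsub>M\<^esub>}. c i)"
    then have "p i m = c i" if "i \<in> I" for i
      using proj[OF that, of "{i \<in> I. c i \<noteq> \<zero>\<^bsub>M\<^esub>}" c] that by (auto simp: Pi_iff PiE_iff)
    then show "c = (\<lambda>i\<in>I. p i m)"
      using c by (auto simp: PiE_iff extensional_def fun_eq_iff)
  qed
  then show ?thesis
    unfolding internal_direct_sum_def using N by blast
qed

section \<open>Quotients and coinvariants\<close>

text \<open>The module laws are equations and the existence of negatives, all of which pass along a
  surjection that respects the operations. Applied to cosets, this avoids any computation with
  unions of sets.\<close>

lemma module_surj_image:
  assumes M: "module k M" and h: "h \<in> module_hom k M Q"
    and surj: "carrier Q = h ` carrier M" and zero: "h \<zero>\<^bsub>M\<^esub> = \<zero>\<^bsub>Q\<^esub>"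
  shows "module k Q"
proof -
  interpret M: module k M by fact
  note h_simps = module_hom_add[OF h, symmetric] module_hom_smult[OF h, symmetric] zero[symmetric]
  have "abelian_group Q"
  proof (rule abelian_groupI)
    fix a assume "a \<in> carrier Q"
    then obtain m where m: "m \<in> carrier M" "a = h m"
      using surj by blast
    show "\<exists>b\<in>carrier Q. b \<oplus>\<^bsub>Q\<^esub> a = \<zero>\<^bsub>Q\<^esub>"
      by (rule bexI[of _ "h (\<ominus>\<^bsub>M\<^esub> m)"]) (use m surj in \<open>simp_all add: h_simps M.l_neg\<close>)
  qed (auto simp: surj h_simps M.a_ac)
  then show ?thesis
    by (rule moduleI[OF M.R.cring_axioms])
      (auto simp: surj h_simps M.smult_l_distr M.smult_r_distr M.smult_assoc1)
qed

lemma a_rcoset_eq_iff: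
  assumes "abelian_group M" and N: "subgroup N (add_monoid M)"
    and m: "m \<in> carrier M" and n: "n \<in> carrier M"
  shows "N +>\<^bsub>M\<^esub> m = N +>\<^bsub>M\<^esub> n \<longleftrightarrow> m \<ominus>\<^bsub>M\<^esub> n \<in> N"
proof -
  interpret M: abelian_group M by fact
  have sub: "N \<subseteq> carrier M"
    using subgroup.subset[OF N] by simp
  show ?thesis
    using M.a_coset_add_inv1[of N m n] M.a_coset_add_inv2[of N m n]
      M.a_coset_join1[of N "m \<ominus>\<^bsub>M\<^esub> n"] M.a_coset_join2[of "m \<ominus>\<^bsub>M\<^esub> n" N] m n N sub
    unfolding a_minus_def by (metis M.a_closed M.a_inv_closed)
qed

text \<open>Scalar multiplication of cosets is a union over representatives. Two representatives of
  a coset differ by some n in \<open>N\<close>, hence their multiples differ by r n, again in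
  \<open>N\<close>; so the union is a single coset and the projection is linear. The module laws
  then come from \<open>module_surj_image\<close>.\<close>

lemma
  assumes M: "module k M" and N: "submodule N k M"
  shows quotient_class_hom: "(\<lambda>m. N +>\<^bsub>M\<^esub> m) \<in> module_hom k M (quotient_module M N)" (is ?hom)
    and module_quotient_module: "module k (quotient_module M N)" (is ?module)
    and quotient_module_carrier: "carrier (quotient_module M N) = (\<lambda>m. N +>\<^bsub>M\<^esub> m) ` carrier M" (is ?carrier)
proof -
  interpret M: module k M by fact
  interpret N: abelian_subgroup N M
    using N M.abelian_group_axioms
    by (intro abelian_subgroupI3 additive_subgroup.intro) (auto simp: submodule_def)
  have sub: "subgroup N (add_monoid M)"
    using N by (simp add: submodule_def)
  show ?hom
  proof (rule module_homI)
    fix r m assume r: "r \<in> carrier k" and m: "m \<in> carrier M"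
    have "N +>\<^bsub>M\<^esub> (r \<odot>\<^bsub>M\<^esub> m') = N +>\<^bsub>M\<^esub> (r \<odot>\<^bsub>M\<^esub> m)" if m': "m' \<in> N +>\<^bsub>M\<^esub> m" for m'
    proof -
      obtain n where n: "n \<in> N" "m' = n \<oplus>\<^bsub>M\<^esub> m"
        using m' by (auto simp: a_r_coset_def')
      then have nM: "n \<in> carrier M"
        using N.a_subset by blast
      have "r \<odot>\<^bsub>M\<^esub> m' \<ominus>\<^bsub>M\<^esub> r \<odot>\<^bsub>M\<^esub> m = r \<odot>\<^bsub>M\<^esub> n"
        using r m n nM by (simp add: M.smult_r_distr a_minus_def M.a_assoc M.r_neg)
      then have "r \<odot>\<^bsub>M\<^esub> m' \<ominus>\<^bsub>M\<^esub> r \<odot>\<^bsub>M\<^esub> m \<in> N"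
        using submodule.smult_closed[OF N r n(1)] by simp
      then show ?thesis
        using a_rcoset_eq_iff[OF M.abelian_group_axioms sub M.smult_closed[OF r, of m'] M.smult_closed[OF r m]]
          m n nM by simp
    qed
    moreover have "m \<in> N +>\<^bsub>M\<^esub> m"
      using m by (rule N.a_rcos_self)
    ultimately have "(\<Union>m'\<in>N +>\<^bsub>M\<^esub> m. N +>\<^bsub>M\<^esub> (r \<odot>\<^bsub>M\<^esub> m')) = N +>\<^bsub>M\<^esub> (r \<odot>\<^bsub>M\<^esub> m)"
      by (intro SUP_eq_const) blast+
    then show "N +>\<^bsub>M\<^esub> (r \<odot>\<^bsub>M\<^esub> m) = r \<odot>\<^bsub>quotient_module M N\<^esub> (N +>\<^bsub>M\<^esub> m)"
      by (simp add: quotient_module_def)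
  qed (simp_all add: quotient_module_def N.a_rcos_sum M.a_rcosetsI N.a_subset)
  show ?carrier
    by (auto simp: quotient_module_def A_RCOSETS_def')
  show ?module
  proof (rule module_surj_image[OF M \<open>?hom\<close> \<open>?carrier\<close>])
    show "N +>\<^bsub>M\<^esub> \<zero>\<^bsub>M\<^esub> = \<zero>\<^bsub>quotient_module M N\<^esub>"
      by (simp add: quotient_module_def N.a_subset)
  qed
qed

section \<open>Coinvariants of a G-module and their universal property\<close>

locale G_module = X: module k X + group G
  for k :: "('k, 'r) ring_scheme" and G :: "('g, 'h) monoid_scheme" (structure) and X :: "('k, 'm) module" +
  fixes \<sigma> :: "'g \<Rightarrow> 'm \<Rightarrow> 'm"
  assumes action_linear: "s \<in> carrier G \<Longrightarrow> \<sigma> s \<in> module_hom k X X"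
    and action_one: "m \<in> carrier X \<Longrightarrow> \<sigma> \<one> m = m"
begin

abbreviation differences :: "'m set" where
  "differences \<equiv> {\<sigma> s m \<ominus>\<^bsub>X\<^esub> m | s m. s \<in> carrier G \<and> m \<in> carrier X}"

lemma differences_subset: "differences \<subseteq> carrier X"
  using module_hom_closed[OF action_linear] by auto

lemma subgroup_generate_differences: "subgroup (generate (add_monoid X) differences) (add_monoid X)"
  using differences_subset by (intro X.add.generate_is_subgroup) simp

text \<open>Moving each coefficient inside the linear map \<open>\<sigma> s\<close> gives: the sum
  of a_s (s m) equals the sum of the differences s (a_s m) - a_s m, plus (sum of a_s) m. The last
  term vanishes for a in the augmentation ideal.\<close>

lemma group_algebra_smult_in_generate:
  assumes a: "a \<in> augmentation_ideal k G" and m: "m \<in> carrier X"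
  shows "group_algebra_smult k G X \<sigma> a m \<in> generate (add_monoid X) differences" (is "_ \<in> ?H")
proof -
  interpret H: additive_subgroup ?H X
    by (rule additive_subgroup.intro[OF subgroup_generate_differences])
  have ak: "a s \<in> carrier k" if "s \<in> carrier G" for s
    using a that by (auto simp: augmentation_ideal_def group_algebra_carrier_def)
  \<comment> \<open>Partial sums of the coefficients need not vanish, so the induction carries the
    term (sum of a_s) m along; it is discarded only for the full support.\<close>
  have "\<exists>h\<in>?H. (\<Oplus>\<^bsub>X\<^esub>s\<in>F. a s \<odot>\<^bsub>X\<^esub> \<sigma> s m) = h \<oplus>\<^bsub>X\<^esub> (\<Oplus>\<^bsub>k\<^esub>s\<in>F. a s) \<odot>\<^bsub>X\<^esub> m"
    if "finite F" "F \<subseteq> carrier G" for F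
    using that
  proof induction
    case empty
    show ?case
      using m by (intro bexI[of _ "\<zero>\<^bsub>X\<^esub>"]) auto
  next
    case (insert s F)
    then obtain h where h: "h \<in> ?H"
      and eq: "(\<Oplus>\<^bsub>X\<^esub>s\<in>F. a s \<odot>\<^bsub>X\<^esub> \<sigma> s m) = h \<oplus>\<^bsub>X\<^esub> (\<Oplus>\<^bsub>k\<^esub>s\<in>F. a s) \<odot>\<^bsub>X\<^esub> m"
      by auto
    have hX: "h \<in> carrier X"
      using h H.a_subset by blast
    have s: "s \<in> carrier G" and F: "F \<subseteq> carrier G"
      using insert.prems by auto
    have sm: "\<sigma> s m \<in> carrier X" "a s \<odot>\<^bsub>X\<^esub> m \<in> carrier X" "a s \<in> carrier k"
      using module_hom_closed[OF action_linear] s ak m by auto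
    have sumF: "(\<Oplus>\<^bsub>k\<^esub>s\<in>F. a s) \<in> carrier k"
      using F ak by (intro X.R.finsum_closed) auto
    let ?d = "\<sigma> s (a s \<odot>\<^bsub>X\<^esub> m) \<ominus>\<^bsub>X\<^esub> (a s \<odot>\<^bsub>X\<^esub> m)"
    have d: "?d \<in> ?H"
      using s sm(2) by (intro generate.incl) blast
    have "(\<Oplus>\<^bsub>X\<^esub>s\<in>insert s F. a s \<odot>\<^bsub>X\<^esub> \<sigma> s m) =
        a s \<odot>\<^bsub>X\<^esub> \<sigma> s m \<oplus>\<^bsub>X\<^esub> (\<Oplus>\<^bsub>X\<^esub>s\<in>F. a s \<odot>\<^bsub>X\<^esub> \<sigma> s m)"
      using insert.hyps sm F ak m module_hom_closed[OF action_linear]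
      by (intro X.finsum_insert) (auto simp: subset_iff)
    also have "\<dots> = (?d \<oplus>\<^bsub>X\<^esub> (a s \<odot>\<^bsub>X\<^esub> m)) \<oplus>\<^bsub>X\<^esub> (h \<oplus>\<^bsub>X\<^esub> (\<Oplus>\<^bsub>k\<^esub>s\<in>F. a s) \<odot>\<^bsub>X\<^esub> m)"
      using sm m s by (simp add: eq module_hom_smult[OF action_linear] a_minus_def X.a_assoc X.l_neg)
    also have "\<dots> = (?d \<oplus>\<^bsub>X\<^esub> h) \<oplus>\<^bsub>X\<^esub> (a s \<oplus>\<^bsub>k\<^esub> (\<Oplus>\<^bsub>k\<^esub>s\<in>F. a s)) \<odot>\<^bsub>X\<^esub> m"
      using sm m sumF hX d H.a_subset by (simp add: X.smult_l_distr X.a_ac subset_iff)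
    also have "a s \<oplus>\<^bsub>k\<^esub> (\<Oplus>\<^bsub>k\<^esub>s\<in>F. a s) = (\<Oplus>\<^bsub>k\<^esub>s\<in>insert s F. a s)"
      using insert.hyps sm F ak by (intro X.R.finsum_insert[symmetric]) auto
    finally show ?case
      using h d by blast
  qed
  moreover have "finite {s \<in> carrier G. a s \<noteq> \<zero>\<^bsub>k\<^esub>}"
    and "(\<Oplus>\<^bsub>k\<^esub>s\<in>{s \<in> carrier G. a s \<noteq> \<zero>\<^bsub>k\<^esub>}. a s) = \<zero>\<^bsub>k\<^esub>"
    using a by (auto simp: augmentation_ideal_def group_algebra_carrier_def augmentation_def)
  ultimately obtain h where "h \<in> ?H" "group_algebra_smult k G X \<sigma> a m = h \<oplus>\<^bsub>X\<^esub> \<zero>\<^bsub>k\<^esub> \<odot>\<^bsub>X\<^esub> m"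
    unfolding group_algebra_smult_def by (metis (no_types, lifting) mem_Collect_eq subsetI)
  then show ?thesis
    using m H.a_subset by (simp add: subset_iff)
qed

lemma difference_in_augmentation_submodule:
  assumes s: "s \<in> carrier G" and m: "m \<in> carrier X"
  shows "\<sigma> s m \<ominus>\<^bsub>X\<^esub> m \<in> augmentation_submodule k G X \<sigma>"
proof (cases "s = \<one>")
  case True
  then show ?thesis
    using m generate.one[of "add_monoid X"] by (simp add: action_one augmentation_submodule_def a_minus_def X.r_neg)
next
  case False
  \<comment> \<open>This is s - 1 in the group algebra. For \<open>s = \<one>\<close> the formula
    would give the unit of the algebra instead of zero, hence the case distinction.\<close>
  let ?a = "\<lambda>u\<in>carrier G. if u = s then \<one>\<^bsub>k\<^esub> else if u = \<one> then \<ominus>\<^bsub>k\<^esub> \<one>\<^bsub>k\<^esub> else \<zero>\<^bsub>k\<^esub>"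
  let ?S = "{u \<in> carrier G. ?a u \<noteq> \<zero>\<^bsub>k\<^esub>}"
  \<comment> \<open>The support can be smaller than \<open>{s, \<one>}\<close>, since
    \<open>k\<close> may be the zero ring; both sums below are therefore extended to the
    pair.\<close>
  have S: "?S \<subseteq> {s, \<one>}"
    by auto
  have sm: "\<sigma> s m \<in> carrier X"
    using module_hom_closed[OF action_linear] s m by blast
  have "augmentation k G ?a = (\<Oplus>\<^bsub>k\<^esub>u\<in>{s, \<one>}. ?a u)"
    unfolding augmentation_def using S s
    by (intro X.R.add.finprod_mono_neutral_cong_left) auto
  also have "\<dots> = \<zero>\<^bsub>k\<^esub>"
    using False s by (simp add: X.R.r_neg)
  finally have "?a \<in> augmentation_ideal k G"
    using finite_subset[OF S] by (auto simp: augmentation_ideal_def group_algebra_carrier_def)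
  moreover have "group_algebra_smult k G X \<sigma> ?a m = \<sigma> s m \<ominus>\<^bsub>X\<^esub> m"
  proof -
    have "group_algebra_smult k G X \<sigma> ?a m = (\<Oplus>\<^bsub>X\<^esub>u\<in>{s, \<one>}. ?a u \<odot>\<^bsub>X\<^esub> \<sigma> u m)"
      unfolding group_algebra_smult_def using S s m sm
      by (intro X.add.finprod_mono_neutral_cong_left) (auto simp: action_one)
    also have "\<dots> = \<sigma> s m \<ominus>\<^bsub>X\<^esub> m"
      using False s m sm by (simp add: action_one X.smult_l_minus a_minus_def)
    finally show ?thesis .
  qed
  ultimately show ?thesis
    unfolding augmentation_submodule_def using m by (intro generate.incl) (force intro: sym)
qed

text \<open>The elements s - 1 account for the whole augmentation ideal, so a linear map kills the
  augmentation submodule as soon as it is unchanged by every \<open>\<sigma> s\<close>.\<close>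

lemma augmentation_submodule_eq:
  "augmentation_submodule k G X \<sigma> = generate (add_monoid X) differences"
proof
  have sub: "{group_algebra_smult k G X \<sigma> a m | a m. a \<in> augmentation_ideal k G \<and> m \<in> carrier X}
      \<subseteq> generate (add_monoid X) differences"
    using group_algebra_smult_in_generate by blast
  then show "augmentation_submodule k G X \<sigma> \<subseteq> generate (add_monoid X) differences"
    unfolding augmentation_submodule_def
    by (rule X.add.generate_subgroup_incl[OF _ subgroup_generate_differences])
  have "subgroup (augmentation_submodule k G X \<sigma>) (add_monoid X)"
    unfolding augmentation_submodule_def
    using sub subgroup.subset[OF subgroup_generate_differences]
    by (intro X.add.generate_is_subgroup) simp
  then show "generate (add_monoid X) differences \<subseteq> augmentation_submodule k G X \<sigma>"
    using difference_in_augmentation_submodule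
    by (intro X.add.generate_subgroup_incl) auto
qed

lemma augmentation_submodule_induct [consumes 1, case_names zero difference uminus add]:
  assumes "n \<in> augmentation_submodule k G X \<sigma>"
    and zero: "P \<zero>\<^bsub>X\<^esub>"
    and difference: "\<And>s m. \<lbrakk>s \<in> carrier G; m \<in> carrier X\<rbrakk> \<Longrightarrow> P (\<sigma> s m \<ominus>\<^bsub>X\<^esub> m)"
    and uminus: "\<And>m. \<lbrakk>m \<in> carrier X; P m\<rbrakk> \<Longrightarrow> P (\<ominus>\<^bsub>X\<^esub> m)"
    and add: "\<And>m n. \<lbrakk>m \<in> carrier X; n \<in> carrier X; P m; P n\<rbrakk> \<Longrightarrow> P (m \<oplus>\<^bsub>X\<^esub> n)"
  shows "P n"
proof -
  have closed: "h \<in> carrier X" if "h \<in> generate (add_monoid X) differences" for h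
    using subgroup.subset[OF subgroup_generate_differences] that by auto
  from assms(1) have "n \<in> generate (add_monoid X) differences"
    by (simp add: augmentation_submodule_eq)
  then show ?thesis
  proof induction
    case (inv h)
    then have "P (\<ominus>\<^bsub>X\<^esub> h)"
      using difference subsetD[OF differences_subset] by (intro uminus) blast+
    then show ?case
      by (simp add: a_inv_def)
  qed (use zero difference add closed in auto)
qed

text \<open>Generation closes only under the additive structure. Closure under scalars holds because
  r (s m - m) = s (r m) - r m is again a difference.\<close>

lemma submodule_augmentation_submodule: "submodule (augmentation_submodule k G X \<sigma>) k X"
proof (rule submodule.intro)
  show "subgroup (augmentation_submodule k G X \<sigma>) (add_monoid X)"
    using subgroup_generate_differences by (simp add: augmentation_submodule_eq)
  then interpret A: additive_subgroup "augmentation_submodule k G X \<sigma>" X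
    by (rule additive_subgroup.intro)
  show "submodule_axioms (augmentation_submodule k G X \<sigma>) k X"
  proof
    fix r n assume r: "r \<in> carrier k" and "n \<in> augmentation_submodule k G X \<sigma>"
    from this(2) show "r \<odot>\<^bsub>X\<^esub> n \<in> augmentation_submodule k G X \<sigma>"
    proof (induction rule: augmentation_submodule_induct)
      case (difference s m)
      then have "r \<odot>\<^bsub>X\<^esub> (\<sigma> s m \<ominus>\<^bsub>X\<^esub> m) = \<sigma> s (r \<odot>\<^bsub>X\<^esub> m) \<ominus>\<^bsub>X\<^esub> r \<odot>\<^bsub>X\<^esub> m"
        using r module_hom_closed[OF action_linear]
        by (simp add: module_hom_smult[OF action_linear] a_minus_def X.smult_r_distr X.smult_r_minus)
      then show ?case
        using r difference by (simp add: difference_in_augmentation_submodule)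
    qed (use r in \<open>auto simp: X.smult_r_distr X.smult_r_minus\<close>)
  qed
qed

definition coinvariant_class :: "'m \<Rightarrow> 'm set" where
  "coinvariant_class m = augmentation_submodule k G X \<sigma> +>\<^bsub>X\<^esub> m"

lemma module_coinvariants: "module k (coinvariants k G X \<sigma>)"
  unfolding coinvariants_def
  by (rule module_quotient_module[OF X.module_axioms submodule_augmentation_submodule])

lemma coinvariant_class_hom: "coinvariant_class \<in> module_hom k X (coinvariants k G X \<sigma>)"
  unfolding coinvariants_def coinvariant_class_def[abs_def]
  by (rule quotient_class_hom[OF X.module_axioms submodule_augmentation_submodule])

lemma coinvariants_carrier: "carrier (coinvariants k G X \<sigma>) = coinvariant_class ` carrier X"
  unfolding coinvariants_def coinvariant_class_def[abs_def]
  by (rule quotient_module_carrier[OF X.module_axioms submodule_augmentation_submodule])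

lemma subgroup_augmentation_submodule: "subgroup (augmentation_submodule k G X \<sigma>) (add_monoid X)"
  using submodule_augmentation_submodule by (simp add: submodule_def)

lemma coinvariant_class_eq_iff:
  assumes "m \<in> carrier X" and "n \<in> carrier X"
  shows "coinvariant_class m = coinvariant_class n \<longleftrightarrow> m \<ominus>\<^bsub>X\<^esub> n \<in> augmentation_submodule k G X \<sigma>"
  unfolding coinvariant_class_def
  by (rule a_rcoset_eq_iff[OF X.abelian_group_axioms subgroup_augmentation_submodule assms])

lemma coinvariant_class_action:
  assumes "s \<in> carrier G" and "m \<in> carrier X"
  shows "coinvariant_class (\<sigma> s m) = coinvariant_class m"
  using assms module_hom_closed[OF action_linear] difference_in_augmentation_submodule
  by (simp add: coinvariant_class_eq_iff)

lemma coinvariant_class_memD: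
  assumes "n \<in> coinvariant_class m" and "m \<in> carrier X"
  shows "n \<in> carrier X" and "coinvariant_class n = coinvariant_class m"
proof -
  show "n \<in> carrier X"
    using assms subgroup.subset[OF subgroup_augmentation_submodule]
    by (auto simp: coinvariant_class_def a_r_coset_def')
  show "coinvariant_class n = coinvariant_class m"
    using X.a_repr_independence[OF assms(1)[unfolded coinvariant_class_def] assms(2)
        subgroup_augmentation_submodule] by (simp add: coinvariant_class_def)
qed

lemma coinvariant_class_self: "m \<in> carrier X \<Longrightarrow> m \<in> coinvariant_class m"
  unfolding coinvariant_class_def
  using X.add.rcos_self[of m "augmentation_submodule k G X \<sigma>"] subgroup_augmentation_submodule
  by (simp add: a_r_coset_def)

text \<open>The universal property of coinvariants: an invariant linear map kills every difference s
  m - m, hence everything these generate, and so depends on the class alone.\<close>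

lemma invariant_hom_factors:
  assumes Y: "module k Y" and f: "f \<in> module_hom k X Y"
    and inv: "\<And>s m. \<lbrakk>s \<in> carrier G; m \<in> carrier X\<rbrakk> \<Longrightarrow> f (\<sigma> s m) = f m"
    and m: "m \<in> carrier X" and n: "n \<in> carrier X"
    and eq: "coinvariant_class m = coinvariant_class n"
  shows "f m = f n"
proof -
  interpret Y: module k Y by fact
  note f_simps = module_hom_minus[OF X.module_axioms Y f] module_hom_uminus[OF X.module_axioms Y f]
    module_hom_zero[OF X.module_axioms Y f] module_hom_add[OF f]
  have "f h = \<zero>\<^bsub>Y\<^esub>" if "h \<in> augmentation_submodule k G X \<sigma>" for h
    using that
  proof (induction rule: augmentation_submodule_induct)
    case (difference s m)
    then show ?case
      using module_hom_closed[OF action_linear] module_hom_closed[OF f]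
      by (simp add: f_simps inv a_minus_def Y.r_neg)
  qed (simp_all add: f_simps)
  then have "f m \<ominus>\<^bsub>Y\<^esub> f n = \<zero>\<^bsub>Y\<^esub>"
    using eq m n by (simp add: coinvariant_class_eq_iff f_simps[symmetric])
  then show ?thesis
    using module_hom_closed[OF f m] module_hom_closed[OF f n]
    by (simp add: a_minus_def Y.add.inv_solve_right')
qed

end

section \<open>The orbit modules of a free action\<close>

sublocale G_category \<subseteq> grp: group G
  using group_hom by (rule group_hom.axioms(1))

context G_category
begin

abbreviation orbs :: "'o set set" where
  "orbs \<equiv> orbits G (Ob C) \<phi>"

abbreviation X :: "'o set \<Rightarrow> 'o set \<Rightarrow> ('k, 'o \<times> 'o \<Rightarrow> 'm) module" where
  "X \<equiv> orbit_module C"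

abbreviation \<iota> :: "'o set \<Rightarrow> 'o set \<Rightarrow> 'o \<Rightarrow> 'o \<Rightarrow> 'm \<Rightarrow> 'o \<times> 'o \<Rightarrow> 'm" where
  "\<iota> \<equiv> orbit_module_inj C"

abbreviation \<sigma> :: "'o set \<Rightarrow> 'o set \<Rightarrow> 'g \<Rightarrow> ('o \<times> 'o \<Rightarrow> 'm) \<Rightarrow> 'o \<times> 'o \<Rightarrow> 'm" where
  "\<sigma> \<equiv> orbit_module_act G \<phi> \<psi>"

abbreviation P :: "'o set \<Rightarrow> 'o set \<Rightarrow> 'o set \<Rightarrow> ('o \<times> 'o \<Rightarrow> 'm) \<Rightarrow> ('o \<times> 'o \<Rightarrow> 'm) \<Rightarrow> 'o \<times> 'o \<Rightarrow> 'm" where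
  "P \<equiv> orbit_module_comp G C \<phi> \<psi>"

abbreviation cls :: "'o set \<Rightarrow> 'o set \<Rightarrow> ('o \<times> 'o \<Rightarrow> 'm) \<Rightarrow> ('o \<times> 'o \<Rightarrow> 'm) set" where
  "cls \<equiv> orbit_class k G C \<phi> \<psi>"

lemma act_closed: "\<lbrakk>s \<in> carrier G; x \<in> Ob C\<rbrakk> \<Longrightarrow> \<phi> s x \<in> Ob C"
  by (rule element_image) auto

lemma orbits_memD: "\<lbrakk>\<alpha> \<in> orbs; x \<in> \<alpha>\<rbrakk> \<Longrightarrow> x \<in> Ob C"
  using orbits_coverture by blast

lemma orbits_act_closed:
  assumes "\<alpha> \<in> orbs" and "x \<in> \<alpha>" and "s \<in> carrier G"
  shows "\<phi> s x \<in> \<alpha>"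
proof -
  obtain w where w: "w \<in> Ob C" "\<alpha> = orbit G \<phi> w"
    using assms(1) by (auto simp: orbits_def)
  then obtain t where "t \<in> carrier G" "x = \<phi> t w"
    using assms(2) by (auto simp: orbit_def)
  then have "\<phi> s x = \<phi> (s \<otimes> t) w" "s \<otimes> t \<in> carrier G"
    using assms(3) w by (simp_all add: composition_rule)
  then show ?thesis
    using w by (auto simp: orbit_def)
qed

lemma act_cancel:
  assumes "s \<in> carrier G" and "x \<in> Ob C"
  shows "\<phi> (inv s) (\<phi> s x) = x" and "\<phi> s (\<phi> (inv s) x) = x"
  using orbit_sym_aux[OF assms refl] orbit_sym_aux[of "inv s" x] assms by simp_all

lemma act_one_object: "x \<in> Ob C \<Longrightarrow> \<phi> \<one> x = x"
  using id_eq_one by (metis restrict_apply')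

lemma orbits_transitive:
  assumes "\<alpha> \<in> orbs" and "x \<in> \<alpha>" and "y \<in> \<alpha>"
  obtains s where "s \<in> carrier G" and "\<phi> s x = y"
proof -
  obtain w where w: "w \<in> Ob C" "\<alpha> = orbit G \<phi> w"
    using assms(1) by (auto simp: orbits_def)
  then obtain s t where st: "s \<in> carrier G" "x = \<phi> s w" "t \<in> carrier G" "y = \<phi> t w"
    using assms(2,3) by (auto simp: orbit_def)
  have "\<phi> (t \<otimes> inv s) x = \<phi> t (\<phi> (inv s) x)"
    using st(1,3) orbits_memD[OF assms(1,2)] by (intro composition_rule) simp_all
  also have "\<dots> = y"
    by (simp only: st(2,4) act_cancel(1)[OF st(1) w(1)])
  finally show ?thesis
    using that[of "t \<otimes> inv s"] st(1,3) by simp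
qed

lemmas act_closed_hom = module_hom_closed[OF act_linear]

text \<open>The axioms of a G-category speak only of composites, so preservation of identities is
  derived from invertibility. If i is the image of the identity of s x under the inverse of s, then
  s i is that identity, and applying s to the composite of the identity of x with i yields the
  claim.\<close>

lemma act_Id:
  assumes s: "s \<in> carrier G" and x: "x \<in> Ob C"
  shows "\<psi> s x x (Id C x) = Id C (\<phi> s x)"
proof -
  let ?e = "\<psi> s x x (Id C x)" and ?i = "\<psi> (inv s) (\<phi> s x) (\<phi> s x) (Id C (\<phi> s x))"
  have sx: "\<phi> s x \<in> Ob C"
    using s x by (rule act_closed)
  have i: "?i \<in> carrier (Hom C x x)"
    using act_closed_hom[of "inv s" "\<phi> s x" "\<phi> s x"] s sx x by (simp add: Id_closed act_cancel)
  have "\<psi> s x x ?i = Id C (\<phi> s x)"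
    using act_mult[of "inv s" s "\<phi> s x" "\<phi> s x" "Id C (\<phi> s x)"] s x sx
    by (simp add: act_cancel Id_closed act_one)
  then have "Id C (\<phi> s x) = \<psi> s x x (Comp C x x x (Id C x) ?i)"
    using x i by (simp add: Id_left)
  also have "\<dots> = Comp C (\<phi> s x) (\<phi> s x) (\<phi> s x) ?e (\<psi> s x x ?i)"
    using s x i by (simp add: act_Comp Id_closed)
  also have "\<dots> = ?e"
    using act_closed_hom[OF s x x Id_closed[OF x]] sx \<open>\<psi> s x x ?i = _\<close> by (simp add: Id_right)
  finally show ?thesis ..
qed

lemma Hom_orbit_module:
  assumes "\<beta> \<in> orbs" and "\<alpha> \<in> orbs"
  shows "i \<in> \<beta> \<times> \<alpha> \<Longrightarrow> module k (case i of (y, x) \<Rightarrow> Hom C y x)"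
  using assms by (auto intro!: Hom_module dest: orbits_memD)

lemma module_X:
  assumes "\<beta> \<in> orbs" and "\<alpha> \<in> orbs"
  shows "module k (X \<beta> \<alpha>)"
  unfolding orbit_module_def using cring_axioms Hom_orbit_module[OF assms] by (rule module_direct_sum)

lemma \<iota>_hom:
  assumes "\<beta> \<in> orbs" and "\<alpha> \<in> orbs" and "y \<in> \<beta>" and "x \<in> \<alpha>"
  shows "\<iota> \<beta> \<alpha> y x \<in> module_hom k (Hom C y x) (X \<beta> \<alpha>)"
  using direct_sum_inj_hom[of "\<beta> \<times> \<alpha>" k "\<lambda>(y, x). Hom C y x" "(y, x)", OF Hom_orbit_module[OF assms(1,2)]]
    assms(3,4)
  by (simp add: orbit_module_def orbit_module_inj_def[abs_def])

lemmas \<iota>_closed = module_hom_closed[OF \<iota>_hom]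

lemma X_hom_eqI:
  assumes "\<beta> \<in> orbs" and "\<alpha> \<in> orbs" and "module k N"
    and "f \<in> module_hom k (X \<beta> \<alpha>) N" and "g \<in> module_hom k (X \<beta> \<alpha>) N"
    and "\<And>y x m. \<lbrakk>y \<in> \<beta>; x \<in> \<alpha>; m \<in> carrier (Hom C y x)\<rbrakk> \<Longrightarrow> f (\<iota> \<beta> \<alpha> y x m) = g (\<iota> \<beta> \<alpha> y x m)"
    and "\<xi> \<in> carrier (X \<beta> \<alpha>)"
  shows "f \<xi> = g \<xi>"
proof (rule direct_sum_hom_eqI[OF cring_axioms Hom_orbit_module[OF assms(1,2)] assms(3)
      assms(4,5)[unfolded orbit_module_def] _ assms(7)[unfolded orbit_module_def]])
  fix i m assume "i \<in> \<beta> \<times> \<alpha>" "m \<in> carrier (case i of (y, x) \<Rightarrow> Hom C y x)"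
  then show "f (direct_sum_inj (\<beta> \<times> \<alpha>) (\<lambda>(y, x). Hom C y x) i m) =
      g (direct_sum_inj (\<beta> \<times> \<alpha>) (\<lambda>(y, x). Hom C y x) i m)"
    using assms(6)[unfolded orbit_module_inj_def] by (cases i) simp
qed

lemma \<sigma>_hom:
  assumes \<beta>: "\<beta> \<in> orbs" and \<alpha>: "\<alpha> \<in> orbs" and s: "s \<in> carrier G"
  shows "\<sigma> \<beta> \<alpha> s \<in> module_hom k (X \<beta> \<alpha>) (X \<beta> \<alpha>)"
proof -
  have mem: "\<phi> (inv s) y \<in> \<beta>" "\<phi> (inv s) x \<in> \<alpha>" "\<phi> (inv s) y \<in> Ob C" "\<phi> (inv s) x \<in> Ob C"
      "y \<in> Ob C" "x \<in> Ob C" if "y \<in> \<beta>" "x \<in> \<alpha>" for y x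
    using that s by (simp_all add: orbits_act_closed[OF \<beta>] orbits_act_closed[OF \<alpha>]
        orbits_memD[OF \<beta>] orbits_memD[OF \<alpha>] act_closed)
  have lin: "\<psi> s (\<phi> (inv s) y) (\<phi> (inv s) x) \<in> module_hom k (Hom C (\<phi> (inv s) y) (\<phi> (inv s) x)) (Hom C y x)"
    if "y \<in> \<beta>" "x \<in> \<alpha>" for y x
    using act_linear[OF s mem(4,3)[OF that]] mem[OF that] s by (simp add: act_cancel)
  note comps = direct_sum_carrierD(1)[of _ "\<beta> \<times> \<alpha>" "\<lambda>(y, x). Hom C y x" "(_, _)",
      folded orbit_module_def, unfolded mem_Times_iff prod.case fst_conv snd_conv]
  show ?thesis
  proof (rule module_homI)
    fix \<xi> assume \<xi>: "\<xi> \<in> carrier (X \<beta> \<alpha>)"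
    show "\<sigma> \<beta> \<alpha> s \<xi> \<in> carrier (X \<beta> \<alpha>)"
      unfolding orbit_module_def
    proof (rule direct_sum_carrierI)
      \<comment> \<open>Acting by \<open>s\<close> translates the support by \<open>s\<close> in
        both coordinates, so it stays finite.\<close>
      have "{i \<in> \<beta> \<times> \<alpha>. \<sigma> \<beta> \<alpha> s \<xi> i \<noteq> \<zero>\<^bsub>(case i of (y, x) \<Rightarrow> Hom C y x)\<^esub>}
          \<subseteq> (\<lambda>(y, x). (\<phi> s y, \<phi> s x)) ` {i \<in> \<beta> \<times> \<alpha>. \<xi> i \<noteq> \<zero>\<^bsub>(case i of (y, x) \<Rightarrow> Hom C y x)\<^esub>}" (is "?L \<subseteq> ?R")
      proof
        fix i assume "i \<in> ?L"
        then obtain y x where i: "i = (y, x)" "y \<in> \<beta>" "x \<in> \<alpha>"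
            and nz: "\<psi> s (\<phi> (inv s) y) (\<phi> (inv s) x) (\<xi> (\<phi> (inv s) y, \<phi> (inv s) x)) \<noteq> \<zero>\<^bsub>Hom C y x\<^esub>"
          by (auto simp: orbit_module_act_def Let_def)
        then have "\<xi> (\<phi> (inv s) y, \<phi> (inv s) x) \<noteq> \<zero>\<^bsub>Hom C (\<phi> (inv s) y) (\<phi> (inv s) x)\<^esub>"
          using module_hom_zero[OF Hom_module Hom_module lin] mem[OF i(2,3)] by metis
        then show "i \<in> ?R"
          using i mem[OF i(2,3)] s
          by (intro image_eqI[of _ _ "(\<phi> (inv s) y, \<phi> (inv s) x)"]) (auto simp: act_cancel)
      qed
      then show "finite ?L"
        using direct_sum_carrierD(3)[OF \<xi>[unfolded orbit_module_def]] by (meson finite_imageI finite_subset)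
    qed (auto simp: orbit_module_act_def Let_def intro!: module_hom_closed[OF lin] comps[OF \<xi>] mem)
  qed (auto simp: orbit_module_act_def orbit_module_def direct_sum_simps Let_def fun_eq_iff mem
      module_hom_add[OF lin] module_hom_smult[OF lin] comps[unfolded orbit_module_def])
qed

lemma \<sigma>_\<iota>:
  assumes \<beta>: "\<beta> \<in> orbs" and \<alpha>: "\<alpha> \<in> orbs" and s: "s \<in> carrier G"
    and y: "y \<in> \<beta>" and x: "x \<in> \<alpha>" and f: "f \<in> carrier (Hom C y x)"
  shows "\<sigma> \<beta> \<alpha> s (\<iota> \<beta> \<alpha> y x f) = \<iota> \<beta> \<alpha> (\<phi> s y) (\<phi> s x) (\<psi> s y x f)"
proof
  fix i
  show "\<sigma> \<beta> \<alpha> s (\<iota> \<beta> \<alpha> y x f) i = \<iota> \<beta> \<alpha> (\<phi> s y) (\<phi> s x) (\<psi> s y x f) i"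
  proof (cases "i \<in> \<beta> \<times> \<alpha>")
    case False
    then show ?thesis
      by (auto simp: orbit_module_act_def orbit_module_inj_def direct_sum_inj_def)
  next
    case True
    then obtain y' x' where i: "i = (y', x')" "y' \<in> \<beta>" "x' \<in> \<alpha>"
      by blast
    have mem: "\<phi> (inv s) y' \<in> \<beta>" "\<phi> (inv s) x' \<in> \<alpha>" "\<phi> (inv s) y' \<in> Ob C" "\<phi> (inv s) x' \<in> Ob C"
      "y \<in> Ob C" "x \<in> Ob C" "y' \<in> Ob C" "x' \<in> Ob C"
      using i s y x by (simp_all add: orbits_act_closed[OF \<beta>] orbits_act_closed[OF \<alpha>]
        orbits_memD[OF \<beta>] orbits_memD[OF \<alpha>] act_closed)
    have iff: "\<phi> (inv s) y' = y \<longleftrightarrow> y' = \<phi> s y" "\<phi> (inv s) x' = x \<longleftrightarrow> x' = \<phi> s x"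
      using s mem by (auto simp: act_cancel)
    have "\<psi> s (\<phi> (inv s) y') (\<phi> (inv s) x') \<zero>\<^bsub>Hom C (\<phi> (inv s) y') (\<phi> (inv s) x')\<^esub> = \<zero>\<^bsub>Hom C y' x'\<^esub>"
      using module_hom_zero[OF Hom_module Hom_module act_linear[OF s mem(4,3)]] mem s
      by (simp add: act_cancel)
    then show ?thesis
      using i mem s iff by (auto simp: orbit_module_act_def orbit_module_inj_def direct_sum_inj_def Let_def)
  qed
qed

lemma orbit_G_module:
  assumes \<beta>: "\<beta> \<in> orbs" and \<alpha>: "\<alpha> \<in> orbs"
  shows "G_module k G (X \<beta> \<alpha>) (\<sigma> \<beta> \<alpha>)"
proof (intro G_module.intro G_module_axioms.intro)
  fix \<xi> assume \<xi>: "\<xi> \<in> carrier (X \<beta> \<alpha>)"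
  show "\<sigma> \<beta> \<alpha> \<one> \<xi> = \<xi>"
  proof (rule X_hom_eqI[OF \<beta> \<alpha> module_X[OF \<beta> \<alpha>] \<sigma>_hom[OF \<beta> \<alpha>] module_hom_ident _ \<xi>])
    fix y x m assume *: "y \<in> \<beta>" "x \<in> \<alpha>" "m \<in> carrier (Hom C y x)"
    moreover have "y \<in> Ob C" "x \<in> Ob C"
      using * \<beta> \<alpha> by (auto dest: orbits_memD)
    ultimately show "\<sigma> \<beta> \<alpha> \<one> (\<iota> \<beta> \<alpha> y x m) = \<iota> \<beta> \<alpha> y x m"
      using \<beta> \<alpha> by (simp add: \<sigma>_\<iota> act_one act_one_object)
  qed simp
qed (use assms module_X \<sigma>_hom grp.is_group in auto)

lemma cls_eq:
  assumes "\<beta> \<in> orbs" and "\<alpha> \<in> orbs"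
  shows "cls \<beta> \<alpha> = G_module.coinvariant_class k G (X \<beta> \<alpha>) (\<sigma> \<beta> \<alpha>)"
  by (simp add: fun_eq_iff orbit_class_def orbit_submodule_def
      G_module.coinvariant_class_def[OF orbit_G_module[OF assms]])

end

section \<open>Composition on orbit modules\<close>

context free_G_category
begin

lemma act_free:
  assumes "x \<in> Ob C" and "s \<in> carrier G" and "t \<in> carrier G" and "\<phi> s x = \<phi> t x"
  shows "s = t"
proof -
  have "\<phi> (inv t \<otimes> s) x = x"
    using assms by (simp add: composition_rule act_cancel)
  then have "inv t \<otimes> s \<in> stabilizer G \<phi> x"
    using assms by (simp add: stabilizer_def)
  then have "inv t \<otimes> s = \<one>"
    using free[OF assms(1)] by blast
  then show ?thesis
    using grp.inv_equality[of "inv t" s] assms(2,3) grp.inv_comm by force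
qed

lemma translation_eqI:
  assumes "x \<in> Ob C" and "s \<in> carrier G" and "\<phi> s x = y"
  shows "translation G \<phi> x y = s"
  unfolding translation_def
proof (rule the_equality)
  fix t assume "t \<in> carrier G \<and> \<phi> t x = y"
  then show "t = s"
    using act_free[of x t s] assms by simp
qed (use assms in simp)

text \<open>The contribution of a single pair of components to a composite. The index pairs come
  first so that partial applications are the linear maps expected by
  \<open>direct_sum_lift\<close>.\<close>

definition comp_inj where
  "comp_inj \<gamma> \<alpha> = (\<lambda>(z, y') (y, x) g f. let s = translation G \<phi> y y' in
     \<iota> \<gamma> \<alpha> z (\<phi> s x) (Comp C z y' (\<phi> s x) g (\<psi> s y x f)))"

lemma comp_inj_act:
  assumes "y \<in> Ob C" and "s \<in> carrier G"
  shows "comp_inj \<gamma> \<alpha> (z, \<phi> s y) (y, x) g f =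
    \<iota> \<gamma> \<alpha> z (\<phi> s x) (Comp C z (\<phi> s y) (\<phi> s x) g (\<psi> s y x f))"
  using translation_eqI[OF assms refl] by (simp add: comp_inj_def)

lemma
  assumes \<gamma>: "\<gamma> \<in> orbs" and \<beta>: "\<beta> \<in> orbs" and \<alpha>: "\<alpha> \<in> orbs"
    and z: "z \<in> \<gamma>" and y': "y' \<in> \<beta>" and y: "y \<in> \<beta>" and x: "x \<in> \<alpha>"
  shows comp_inj_hom_right: "g \<in> carrier (Hom C z y') \<Longrightarrow>
      comp_inj \<gamma> \<alpha> (z, y') (y, x) g \<in> module_hom k (Hom C y x) (X \<gamma> \<alpha>)"
    and comp_inj_hom_left: "f \<in> carrier (Hom C y x) \<Longrightarrow>
      (\<lambda>g. comp_inj \<gamma> \<alpha> (z, y') (y, x) g f) \<in> module_hom k (Hom C z y') (X \<gamma> \<alpha>)"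
proof -
  obtain s where s: "s \<in> carrier G" "\<phi> s y = y'"
    using orbits_transitive[OF \<beta> y y'] .
  have mem: "z \<in> Ob C" "y' \<in> Ob C" "y \<in> Ob C" "x \<in> Ob C" "\<phi> s x \<in> Ob C" "\<phi> s x \<in> \<alpha>"
    using z y' y x s by (simp_all add: orbits_act_closed[OF \<alpha>]
        orbits_memD[OF \<gamma>] orbits_memD[OF \<beta>] orbits_memD[OF \<alpha>] act_closed)
  have eq: "comp_inj \<gamma> \<alpha> (z, y') (y, x) g f = \<iota> \<gamma> \<alpha> z (\<phi> s x) (Comp C z y' (\<phi> s x) g (\<psi> s y x f))" for g f
    using comp_inj_act[of y s] mem s by simp
  note \<iota> = \<iota>_hom[OF \<gamma> \<alpha> z mem(6)] and act = act_linear[OF s(1) mem(4,3), unfolded s(2)]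
  show "comp_inj \<gamma> \<alpha> (z, y') (y, x) g \<in> module_hom k (Hom C y x) (X \<gamma> \<alpha>)" if g: "g \<in> carrier (Hom C z y')"
    using module_hom_comp[OF module_hom_comp[OF act Comp_linear_right[OF mem(5,2,1) g]] \<iota>]
    by (simp add: eq[abs_def])
  show "(\<lambda>g. comp_inj \<gamma> \<alpha> (z, y') (y, x) g f) \<in> module_hom k (Hom C z y') (X \<gamma> \<alpha>)"
    if f: "f \<in> carrier (Hom C y x)"
    using module_hom_comp[OF Comp_linear_left[OF mem(5,2,1) module_hom_closed[OF act f]] \<iota>]
    by (simp add: eq)
qed

definition comp_lift where
  "comp_lift \<gamma> \<beta> \<alpha> \<xi> p g =
    direct_sum_lift (\<beta> \<times> \<alpha>) (\<lambda>(y, x). Hom C y x) (X \<gamma> \<alpha>) (\<lambda>q. comp_inj \<gamma> \<alpha> p q g) \<xi>"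

text \<open>Reading the double sum as one lift nested in another makes its linearity and its values
  on single components instances of the universal property.\<close>

lemma P_eq:
  "P \<gamma> \<beta> \<alpha> \<eta> \<xi> = direct_sum_lift (\<gamma> \<times> \<beta>) (\<lambda>(z, y). Hom C z y) (X \<gamma> \<alpha>) (comp_lift \<gamma> \<beta> \<alpha> \<xi>) \<eta>"
  by (simp add: orbit_module_comp_def comp_lift_def direct_sum_lift_def comp_inj_def case_prod_unfold Let_def
      mem_Times_iff conj_assoc)

context
  fixes \<gamma> \<beta> \<alpha>
  assumes \<gamma>: "\<gamma> \<in> orbs" and \<beta>: "\<beta> \<in> orbs" and \<alpha>: "\<alpha> \<in> orbs"
begin

lemma comp_lift_hom_right:
  assumes "z \<in> \<gamma>" and "y' \<in> \<beta>" and "g \<in> carrier (Hom C z y')"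
  shows "(\<lambda>\<xi>. comp_lift \<gamma> \<beta> \<alpha> \<xi> (z, y') g) \<in> module_hom k (X \<beta> \<alpha>) (X \<gamma> \<alpha>)"
  unfolding comp_lift_def[abs_def] orbit_module_def[of C \<beta> \<alpha>]
  by (rule direct_sum_lift_hom[OF Hom_orbit_module[OF \<beta> \<alpha>] module_X[OF \<gamma> \<alpha>]])
    (use comp_inj_hom_right[OF \<gamma> \<beta> \<alpha> assms(1,2)] assms(3) in auto)

lemma comp_lift_hom_left:
  assumes "z \<in> \<gamma>" and "y' \<in> \<beta>" and \<xi>: "\<xi> \<in> carrier (X \<beta> \<alpha>)"
  shows "comp_lift \<gamma> \<beta> \<alpha> \<xi> (z, y') \<in> module_hom k (Hom C z y') (X \<gamma> \<alpha>)"
  unfolding comp_lift_def[abs_def] direct_sum_lift_def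
proof (rule module_hom_sum[OF module_X[OF \<gamma> \<alpha>]])
  show "finite {i \<in> \<beta> \<times> \<alpha>. \<xi> i \<noteq> \<zero>\<^bsub>(case i of (y, x) \<Rightarrow> Hom C y x)\<^esub>}"
    using direct_sum_carrierD(3)[OF \<xi>[unfolded orbit_module_def]] .
  fix i assume "i \<in> {i \<in> \<beta> \<times> \<alpha>. \<xi> i \<noteq> \<zero>\<^bsub>(case i of (y, x) \<Rightarrow> Hom C y x)\<^esub>}"
  then show "(\<lambda>g. comp_inj \<gamma> \<alpha> (z, y') i g (\<xi> i)) \<in> module_hom k (Hom C z y') (X \<gamma> \<alpha>)"
    using direct_sum_carrierD(1)[OF \<xi>[unfolded orbit_module_def]] assms(1,2)
    by (auto intro!: comp_inj_hom_left[OF \<gamma> \<beta> \<alpha>])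
qed

text \<open>Here the range of the outer sum varies with \<eta>, so linearity has to come from
  \<open>direct_sum_lift_hom\<close>.\<close>

lemma P_hom_left:
  assumes "\<xi> \<in> carrier (X \<beta> \<alpha>)"
  shows "(\<lambda>\<eta>. P \<gamma> \<beta> \<alpha> \<eta> \<xi>) \<in> module_hom k (X \<gamma> \<beta>) (X \<gamma> \<alpha>)"
  unfolding P_eq orbit_module_def[of C \<gamma> \<beta>]
  by (rule direct_sum_lift_hom[OF Hom_orbit_module[OF \<gamma> \<beta>] module_X[OF \<gamma> \<alpha>]])
    (use comp_lift_hom_left assms in auto)

text \<open>With \<eta> fixed the outer sum has a fixed finite range, so it is a finite sum of maps
  linear in \<xi>.\<close>

lemma P_hom_right:
  assumes \<eta>: "\<eta> \<in> carrier (X \<gamma> \<beta>)"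
  shows "P \<gamma> \<beta> \<alpha> \<eta> \<in> module_hom k (X \<beta> \<alpha>) (X \<gamma> \<alpha>)"
  unfolding P_eq[abs_def] direct_sum_lift_def
proof (rule module_hom_sum[OF module_X[OF \<gamma> \<alpha>]])
  show "finite {i \<in> \<gamma> \<times> \<beta>. \<eta> i \<noteq> \<zero>\<^bsub>(case i of (y, x) \<Rightarrow> Hom C y x)\<^esub>}"
    using direct_sum_carrierD(3)[OF \<eta>[unfolded orbit_module_def]] .
  fix i assume "i \<in> {i \<in> \<gamma> \<times> \<beta>. \<eta> i \<noteq> \<zero>\<^bsub>(case i of (y, x) \<Rightarrow> Hom C y x)\<^esub>}"
  then show "(\<lambda>\<xi>. comp_lift \<gamma> \<beta> \<alpha> \<xi> i (\<eta> i)) \<in> module_hom k (X \<beta> \<alpha>) (X \<gamma> \<alpha>)"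
    using direct_sum_carrierD(1)[OF \<eta>[unfolded orbit_module_def]]
    by (auto intro!: comp_lift_hom_right)
qed

lemmas P_closed = module_hom_closed[OF P_hom_right]

text \<open>On single components both lifts collapse to one term, and freeness identifies the
  translation with \<open>s\<close>. Together with bilinearity this determines \<open>P\<close>;
  later identities about \<open>P\<close> are reduced to this rule.\<close>

lemma P_\<iota>:
  assumes z: "z \<in> \<gamma>" and y: "y \<in> \<beta>" and x: "x \<in> \<alpha>" and s: "s \<in> carrier G"
    and g: "g \<in> carrier (Hom C z (\<phi> s y))" and f: "f \<in> carrier (Hom C y x)"
  shows "P \<gamma> \<beta> \<alpha> (\<iota> \<gamma> \<beta> z (\<phi> s y) g) (\<iota> \<beta> \<alpha> y x f) =
    \<iota> \<gamma> \<alpha> z (\<phi> s x) (Comp C z (\<phi> s y) (\<phi> s x) g (\<psi> s y x f))"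
proof -
  have sy: "\<phi> s y \<in> \<beta>"
    using orbits_act_closed[OF \<beta> y s] .
  have "P \<gamma> \<beta> \<alpha> (\<iota> \<gamma> \<beta> z (\<phi> s y) g) (\<iota> \<beta> \<alpha> y x f) = comp_lift \<gamma> \<beta> \<alpha> (\<iota> \<beta> \<alpha> y x f) (z, \<phi> s y) g"
    unfolding P_eq orbit_module_inj_def[of C \<gamma> \<beta>]
    by (rule direct_sum_lift_inj[OF Hom_orbit_module[OF \<gamma> \<beta>] module_X[OF \<gamma> \<alpha>]])
      (use comp_lift_hom_left \<iota>_closed[OF \<beta> \<alpha> y x f] z sy g in auto)
  also have "\<dots> = comp_inj \<gamma> \<alpha> (z, \<phi> s y) (y, x) g f"
    unfolding comp_lift_def orbit_module_inj_def
    by (rule direct_sum_lift_inj[OF Hom_orbit_module[OF \<beta> \<alpha>] module_X[OF \<gamma> \<alpha>]])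
      (use comp_inj_hom_right[OF \<gamma> \<beta> \<alpha> z sy] y x f g in auto)
  finally show ?thesis
    using comp_inj_act[OF orbits_memD[OF \<beta> y] s] by simp
qed

end

end

section \<open>Smash products\<close>

text \<open>Degrees in a smash product match: a morphism from level s to level t composed with one
  from t to u lands in the degree belonging to s and u.\<close>

lemma (in group) inv_mult_cancel_middle:
  assumes "u \<in> carrier G" and "t \<in> carrier G" and "s \<in> carrier G"
  shows "(inv u \<otimes> t) \<otimes> (inv t \<otimes> s) = inv u \<otimes> s"
proof -
  have "t \<otimes> (inv t \<otimes> s) = s"
    using assms by (simp add: m_assoc[symmetric])
  then show ?thesis
    using assms by (simp add: m_assoc)
qed

text \<open>All equations are inherited from \<open>B\<close>, because the operations are those of
  \<open>B\<close> restricted to degree parts. What has to be shown is closure: composites and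
  identities have the prescribed degree.\<close>

lemma k_category_smash_product:
  assumes "G_graded_category k G B D"
  shows "k_category k (smash_product G B D)"
proof -
  interpret G_graded_category k G B D by fact
  have sub: "submodule (D s y x) k (Hom B y x)" if "s \<in> carrier G" "x \<in> Ob B" "y \<in> Ob B" for s x y
    using decomposition[OF that(2,3)] that(1) by (simp add: internal_direct_sum_def)
  have sub_carrier: "f \<in> carrier (Hom B y x)" if "f \<in> D s y x" "s \<in> carrier G" "x \<in> Ob B" "y \<in> Ob B" for f s x y
    using module.submoduleE(1)[OF Hom_module[OF that(3,4)] sub[OF that(2-4)]] that(1) by blast
  have degree: "Comp B z y x g f \<in> D (inv\<^bsub>G\<^esub> u \<otimes>\<^bsub>G\<^esub> s) z x"
    if "x \<in> Ob B" "y \<in> Ob B" "z \<in> Ob B" "s \<in> carrier G" "t \<in> carrier G" "u \<in> carrier G"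
      "f \<in> D (inv\<^bsub>G\<^esub> t \<otimes>\<^bsub>G\<^esub> s) y x" "g \<in> D (inv\<^bsub>G\<^esub> u \<otimes>\<^bsub>G\<^esub> t) z y" for x y z s t u f g
  proof -
    show ?thesis
      using Comp_degree[OF that(1-3) _ _ that(7,8)] group.inv_mult_cancel_middle[OF is_group that(6,5,4)] that(4-6)
      by (simp add: group.is_monoid[OF is_group] monoid.m_closed)
  qed
  show ?thesis
  proof (intro k_category.intro k_category_axioms.intro)
    show "cring k" by (rule cring_axioms)
  next
    fix p q assume "p \<in> Ob (smash_product G B D)" "q \<in> Ob (smash_product G B D)"
    then show "module k (Hom (smash_product G B D) q p)"
      by (auto simp: smash_product_def intro!: submodule.submodule_is_module[OF sub] Hom_module)
  next
    fix p q r f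
    assume *: "p \<in> Ob (smash_product G B D)" "q \<in> Ob (smash_product G B D)" "r \<in> Ob (smash_product G B D)"
      "f \<in> carrier (Hom (smash_product G B D) q p)"
    obtain x s y t z u where pqr: "p = (x, s)" "q = (y, t)" "r = (z, u)"
      by (metis surj_pair)
    have mem: "x \<in> Ob B" "y \<in> Ob B" "z \<in> Ob B" "s \<in> carrier G" "t \<in> carrier G" "u \<in> carrier G"
      and f: "f \<in> D (inv\<^bsub>G\<^esub> t \<otimes>\<^bsub>G\<^esub> s) y x"
      using * by (simp_all add: pqr smash_product_def)
    have "(\<lambda>g. Comp B z y x g f) \<in> module_hom k
        (Hom B z y\<lparr>carrier := D (inv\<^bsub>G\<^esub> u \<otimes>\<^bsub>G\<^esub> t) z y\<rparr>) (Hom B z x\<lparr>carrier := D (inv\<^bsub>G\<^esub> u \<otimes>\<^bsub>G\<^esub> s) z x\<rparr>)"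
      using mem f by (intro module_hom_restrict[OF Comp_linear_left] sub_carrier[OF f] image_subsetI degree subsetI
          sub_carrier[of _ "inv\<^bsub>G\<^esub> u \<otimes>\<^bsub>G\<^esub> t"]) simp_all
    then show "(\<lambda>g. Comp (smash_product G B D) r q p g f)
        \<in> module_hom k (Hom (smash_product G B D) r q) (Hom (smash_product G B D) r p)"
      by (simp add: pqr smash_product_def)
  next
    fix p q r g
    assume *: "p \<in> Ob (smash_product G B D)" "q \<in> Ob (smash_product G B D)" "r \<in> Ob (smash_product G B D)"
      "g \<in> carrier (Hom (smash_product G B D) r q)"
    obtain x s y t z u where pqr: "p = (x, s)" "q = (y, t)" "r = (z, u)"
      by (metis surj_pair)
    have mem: "x \<in> Ob B" "y \<in> Ob B" "z \<in> Ob B" "s \<in> carrier G" "t \<in> carrier G" "u \<in> carrier G"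
      and g: "g \<in> D (inv\<^bsub>G\<^esub> u \<otimes>\<^bsub>G\<^esub> t) z y"
      using * by (simp_all add: pqr smash_product_def)
    have "(\<lambda>f. Comp B z y x g f) \<in> module_hom k
        (Hom B y x\<lparr>carrier := D (inv\<^bsub>G\<^esub> t \<otimes>\<^bsub>G\<^esub> s) y x\<rparr>) (Hom B z x\<lparr>carrier := D (inv\<^bsub>G\<^esub> u \<otimes>\<^bsub>G\<^esub> s) z x\<rparr>)"
      using mem g by (intro module_hom_restrict[OF Comp_linear_right] sub_carrier[OF g] image_subsetI degree subsetI
          sub_carrier[of _ "inv\<^bsub>G\<^esub> t \<otimes>\<^bsub>G\<^esub> s"]) simp_all
    then show "(\<lambda>f. Comp (smash_product G B D) r q p g f)
        \<in> module_hom k (Hom (smash_product G B D) q p) (Hom (smash_product G B D) r p)"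
      by (simp add: pqr smash_product_def)
  next
    fix w p q r f g h
    assume "w \<in> Ob (smash_product G B D)" "p \<in> Ob (smash_product G B D)" "q \<in> Ob (smash_product G B D)"
      "r \<in> Ob (smash_product G B D)" "f \<in> carrier (Hom (smash_product G B D) p w)"
      "g \<in> carrier (Hom (smash_product G B D) q p)" "h \<in> carrier (Hom (smash_product G B D) r q)"
    then show "Comp (smash_product G B D) r p w (Comp (smash_product G B D) r q p h g) f =
        Comp (smash_product G B D) r q w h (Comp (smash_product G B D) q p w g f)"
      by (auto simp: smash_product_def intro!: Comp_assoc sub_carrier)
  next
    fix p assume "p \<in> Ob (smash_product G B D)"
    then show "Id (smash_product G B D) p \<in> carrier (Hom (smash_product G B D) p p)"
      by (auto simp: smash_product_def Id_degree)
  qed (auto simp: smash_product_def intro!: Id_left Id_right sub_carrier)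
qed

section \<open>The quotient category and its grading\<close>

context free_G_category
begin

lemma X_bihom_eqI:
  assumes "\<gamma> \<in> orbs" and "\<beta> \<in> orbs" and "\<delta> \<in> orbs" and "\<alpha> \<in> orbs" and N: "module k N"
    and hom: "\<And>\<xi>. \<xi> \<in> carrier (X \<delta> \<alpha>) \<Longrightarrow> (\<lambda>\<eta>. f \<eta> \<xi>) \<in> module_hom k (X \<gamma> \<beta>) N"
      "\<And>\<xi>. \<xi> \<in> carrier (X \<delta> \<alpha>) \<Longrightarrow> (\<lambda>\<eta>. g \<eta> \<xi>) \<in> module_hom k (X \<gamma> \<beta>) N"
      "\<And>\<eta>. \<eta> \<in> carrier (X \<gamma> \<beta>) \<Longrightarrow> f \<eta> \<in> module_hom k (X \<delta> \<alpha>) N"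
      "\<And>\<eta>. \<eta> \<in> carrier (X \<gamma> \<beta>) \<Longrightarrow> g \<eta> \<in> module_hom k (X \<delta> \<alpha>) N"
    and eq: "\<And>z y' y x a b. \<lbrakk>z \<in> \<gamma>; y' \<in> \<beta>; y \<in> \<delta>; x \<in> \<alpha>; a \<in> carrier (Hom C z y'); b \<in> carrier (Hom C y x)\<rbrakk> \<Longrightarrow>
      f (\<iota> \<gamma> \<beta> z y' a) (\<iota> \<delta> \<alpha> y x b) = g (\<iota> \<gamma> \<beta> z y' a) (\<iota> \<delta> \<alpha> y x b)"
    and \<eta>: "\<eta> \<in> carrier (X \<gamma> \<beta>)" and \<xi>: "\<xi> \<in> carrier (X \<delta> \<alpha>)"
  shows "f \<eta> \<xi> = g \<eta> \<xi>"
proof (rule X_hom_eqI[OF assms(3,4) N hom(3)[OF \<eta>] hom(4)[OF \<eta>] _ \<xi>])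
  fix y x b assume b: "y \<in> \<delta>" "x \<in> \<alpha>" "b \<in> carrier (Hom C y x)"
  then have \<iota>b: "\<iota> \<delta> \<alpha> y x b \<in> carrier (X \<delta> \<alpha>)"
    using \<iota>_closed assms(3,4) by blast
  show "f \<eta> (\<iota> \<delta> \<alpha> y x b) = g \<eta> (\<iota> \<delta> \<alpha> y x b)"
    using b by (intro X_hom_eqI[OF assms(1,2) N hom(1)[OF \<iota>b] hom(2)[OF \<iota>b] _ \<eta>] eq)
qed

text \<open>If t takes s y to y', then t s takes y to y'. Composing g with s f gives g (t (s f)),
  and composing g with f gives g ((t s) f): the same morphism with the same source. Invariance thus
  holds in the direct sum itself.\<close>

lemma P_\<sigma>_right:
  assumes \<gamma>: "\<gamma> \<in> orbs" and \<beta>: "\<beta> \<in> orbs" and \<alpha>: "\<alpha> \<in> orbs" and s: "s \<in> carrier G"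
    and \<eta>: "\<eta> \<in> carrier (X \<gamma> \<beta>)" and \<xi>: "\<xi> \<in> carrier (X \<beta> \<alpha>)"
  shows "P \<gamma> \<beta> \<alpha> \<eta> (\<sigma> \<beta> \<alpha> s \<xi>) = P \<gamma> \<beta> \<alpha> \<eta> \<xi>"
proof (rule X_bihom_eqI[OF \<gamma> \<beta> \<beta> \<alpha> module_X[OF \<gamma> \<alpha>] _ _ _ _ _ \<eta> \<xi>, where f = "\<lambda>\<eta> \<xi>. P \<gamma> \<beta> \<alpha> \<eta> (\<sigma> \<beta> \<alpha> s \<xi>)"])
  fix z y' y x g f
  assume *: "z \<in> \<gamma>" "y' \<in> \<beta>" "y \<in> \<beta>" "x \<in> \<alpha>" "g \<in> carrier (Hom C z y')" "f \<in> carrier (Hom C y x)"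
  have mem: "\<phi> s y \<in> \<beta>" "\<phi> s x \<in> \<alpha>" "y \<in> Ob C" "x \<in> Ob C"
    using * s by (simp_all add: orbits_act_closed[OF \<beta>] orbits_act_closed[OF \<alpha>]
        orbits_memD[OF \<beta>] orbits_memD[OF \<alpha>])
  obtain t where t: "t \<in> carrier G" "\<phi> t (\<phi> s y) = y'"
    using orbits_transitive[OF \<beta> mem(1) *(2)] .
  have ts: "t \<otimes> s \<in> carrier G" "\<phi> (t \<otimes> s) y = y'" "\<phi> (t \<otimes> s) x = \<phi> t (\<phi> s x)"
    using t s mem by (simp_all add: composition_rule)
  have "P \<gamma> \<beta> \<alpha> (\<iota> \<gamma> \<beta> z y' g) (\<iota> \<beta> \<alpha> (\<phi> s y) (\<phi> s x) (\<psi> s y x f)) =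
      \<iota> \<gamma> \<alpha> z (\<phi> t (\<phi> s x)) (Comp C z y' (\<phi> t (\<phi> s x)) g (\<psi> t (\<phi> s y) (\<phi> s x) (\<psi> s y x f)))"
    using P_\<iota>[OF \<gamma> \<beta> \<alpha> *(1) mem(1,2) t(1) _ act_closed_hom[OF s mem(4,3) *(6)], unfolded t(2), OF *(5)] .
  also have "\<dots> = P \<gamma> \<beta> \<alpha> (\<iota> \<gamma> \<beta> z y' g) (\<iota> \<beta> \<alpha> y x f)"
    using P_\<iota>[OF \<gamma> \<beta> \<alpha> *(1,3,4) ts(1) _ *(6), unfolded ts(2,3), OF *(5)] act_mult[OF s t(1) mem(4,3) *(6)] by simp
  finally show "P \<gamma> \<beta> \<alpha> (\<iota> \<gamma> \<beta> z y' g) (\<sigma> \<beta> \<alpha> s (\<iota> \<beta> \<alpha> y x f)) = P \<gamma> \<beta> \<alpha> (\<iota> \<gamma> \<beta> z y' g) (\<iota> \<beta> \<alpha> y x f)"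
    by (simp add: \<sigma>_\<iota>[OF \<beta> \<alpha> s *(3,4,6)])
qed (use P_hom_left[OF \<gamma> \<beta> \<alpha>] P_hom_right[OF \<gamma> \<beta> \<alpha>] module_hom_closed[OF \<sigma>_hom[OF \<beta> \<alpha> s]]
    module_hom_comp[OF \<sigma>_hom[OF \<beta> \<alpha> s] P_hom_right[OF \<gamma> \<beta> \<alpha>]] in auto)

text \<open>If t takes y to y', then s t takes y to s y', and (s g)((s t) f) = s (g (t f)).
  Translating the left factor translates the composite, so only its class is unchanged.\<close>

lemma P_\<sigma>_left:
  assumes \<gamma>: "\<gamma> \<in> orbs" and \<beta>: "\<beta> \<in> orbs" and \<alpha>: "\<alpha> \<in> orbs" and s: "s \<in> carrier G"
    and \<eta>: "\<eta> \<in> carrier (X \<gamma> \<beta>)" and \<xi>: "\<xi> \<in> carrier (X \<beta> \<alpha>)"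
  shows "P \<gamma> \<beta> \<alpha> (\<sigma> \<gamma> \<beta> s \<eta>) \<xi> = \<sigma> \<gamma> \<alpha> s (P \<gamma> \<beta> \<alpha> \<eta> \<xi>)"
proof (rule X_bihom_eqI[OF \<gamma> \<beta> \<beta> \<alpha> module_X[OF \<gamma> \<alpha>] _ _ _ _ _ \<eta> \<xi>,
      where f = "\<lambda>\<eta> \<xi>. P \<gamma> \<beta> \<alpha> (\<sigma> \<gamma> \<beta> s \<eta>) \<xi>" and g = "\<lambda>\<eta> \<xi>. \<sigma> \<gamma> \<alpha> s (P \<gamma> \<beta> \<alpha> \<eta> \<xi>)"])
  fix z y' y x g f
  assume *: "z \<in> \<gamma>" "y' \<in> \<beta>" "y \<in> \<beta>" "x \<in> \<alpha>" "g \<in> carrier (Hom C z y')" "f \<in> carrier (Hom C y x)"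
  obtain t where t: "t \<in> carrier G" "\<phi> t y = y'"
    using orbits_transitive[OF \<beta> *(3,2)] .
  have mem: "\<phi> s z \<in> \<gamma>" "\<phi> t x \<in> \<alpha>" "z \<in> Ob C" "y' \<in> Ob C" "y \<in> Ob C" "x \<in> Ob C" "\<phi> t x \<in> Ob C"
    using * s t(1) by (simp_all add: orbits_act_closed[OF \<gamma>] orbits_act_closed[OF \<alpha>] orbits_memD[OF \<gamma>]
        orbits_memD[OF \<beta>] orbits_memD[OF \<alpha>] act_closed)
  have st: "s \<otimes> t \<in> carrier G" "\<phi> (s \<otimes> t) y = \<phi> s y'" "\<phi> (s \<otimes> t) x = \<phi> s (\<phi> t x)"
    using t s mem by (simp_all add: composition_rule)
  have tf: "\<psi> t y x f \<in> carrier (Hom C y' (\<phi> t x))"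
    using act_closed_hom[OF t(1) mem(6,5) *(6)] t(2) by simp
  have "P \<gamma> \<beta> \<alpha> (\<iota> \<gamma> \<beta> (\<phi> s z) (\<phi> s y') (\<psi> s z y' g)) (\<iota> \<beta> \<alpha> y x f) =
      \<iota> \<gamma> \<alpha> (\<phi> s z) (\<phi> s (\<phi> t x)) (\<psi> s z (\<phi> t x) (Comp C z y' (\<phi> t x) g (\<psi> t y x f)))"
    using P_\<iota>[OF \<gamma> \<beta> \<alpha> mem(1) *(3,4) st(1) _ *(6), unfolded st(2,3), OF act_closed_hom[OF s mem(4,3) *(5)]]
      act_mult[OF t(1) s mem(6,5) *(6)] act_Comp[OF s mem(7,4,3) tf *(5)] t(2) by simp
  also have "\<dots> = \<sigma> \<gamma> \<alpha> s (\<iota> \<gamma> \<alpha> z (\<phi> t x) (Comp C z y' (\<phi> t x) g (\<psi> t y x f)))"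
    using \<sigma>_\<iota>[OF \<gamma> \<alpha> s *(1) mem(2) module_hom_closed[OF Comp_linear_right[OF mem(7,4,3) *(5)] tf]] ..
  also have "\<dots> = \<sigma> \<gamma> \<alpha> s (P \<gamma> \<beta> \<alpha> (\<iota> \<gamma> \<beta> z y' g) (\<iota> \<beta> \<alpha> y x f))"
    using P_\<iota>[OF \<gamma> \<beta> \<alpha> *(1,3,4) t(1) _ *(6), unfolded t(2), OF *(5)] by simp
  finally show "P \<gamma> \<beta> \<alpha> (\<sigma> \<gamma> \<beta> s (\<iota> \<gamma> \<beta> z y' g)) (\<iota> \<beta> \<alpha> y x f) =
      \<sigma> \<gamma> \<alpha> s (P \<gamma> \<beta> \<alpha> (\<iota> \<gamma> \<beta> z y' g) (\<iota> \<beta> \<alpha> y x f))"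
    by (simp add: \<sigma>_\<iota>[OF \<gamma> \<beta> s *(1,2,5)])
qed (use P_hom_right[OF \<gamma> \<beta> \<alpha>] module_hom_closed[OF \<sigma>_hom[OF \<gamma> \<beta> s]]
    module_hom_comp[OF \<sigma>_hom[OF \<gamma> \<beta> s] P_hom_left[OF \<gamma> \<beta> \<alpha>]]
    module_hom_comp[OF P_hom_right[OF \<gamma> \<beta> \<alpha>] \<sigma>_hom[OF \<gamma> \<alpha> s]]
    module_hom_comp[OF P_hom_left[OF \<gamma> \<beta> \<alpha>] \<sigma>_hom[OF \<gamma> \<alpha> s]] in auto)

text \<open>With s y = y' and t z = z', both sides come down to (h (t g)) ((t s) f) = h (t (g (s
  f))), which is associativity in \<open>C\<close> and functoriality of t. Linearity is used first
  in \<xi>, then in \<zeta> and \<eta> together.\<close>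

lemma P_assoc:
  assumes \<delta>: "\<delta> \<in> orbs" and \<gamma>: "\<gamma> \<in> orbs" and \<beta>: "\<beta> \<in> orbs" and \<alpha>: "\<alpha> \<in> orbs"
    and \<zeta>: "\<zeta> \<in> carrier (X \<delta> \<gamma>)" and \<eta>: "\<eta> \<in> carrier (X \<gamma> \<beta>)" and \<xi>: "\<xi> \<in> carrier (X \<beta> \<alpha>)"
  shows "P \<delta> \<beta> \<alpha> (P \<delta> \<gamma> \<beta> \<zeta> \<eta>) \<xi> = P \<delta> \<gamma> \<alpha> \<zeta> (P \<gamma> \<beta> \<alpha> \<eta> \<xi>)"
proof (rule X_hom_eqI[OF \<beta> \<alpha> module_X[OF \<delta> \<alpha>] P_hom_right[OF \<delta> \<beta> \<alpha> P_closed[OF \<delta> \<gamma> \<beta> \<zeta> \<eta>]]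
      module_hom_comp[OF P_hom_right[OF \<gamma> \<beta> \<alpha> \<eta>] P_hom_right[OF \<delta> \<gamma> \<alpha> \<zeta>]] _ \<xi>])
  fix y x f assume f: "y \<in> \<beta>" "x \<in> \<alpha>" "f \<in> carrier (Hom C y x)"
  have \<iota>f: "\<iota> \<beta> \<alpha> y x f \<in> carrier (X \<beta> \<alpha>)"
    using \<iota>_closed[OF \<beta> \<alpha> f] .
  show "P \<delta> \<beta> \<alpha> (P \<delta> \<gamma> \<beta> \<zeta> \<eta>) (\<iota> \<beta> \<alpha> y x f) = P \<delta> \<gamma> \<alpha> \<zeta> (P \<gamma> \<beta> \<alpha> \<eta> (\<iota> \<beta> \<alpha> y x f))"
  proof (rule X_bihom_eqI[OF \<delta> \<gamma> \<gamma> \<beta> module_X[OF \<delta> \<alpha>] _ _ _ _ _ \<zeta> \<eta>,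
      where f = "\<lambda>\<zeta> \<eta>. P \<delta> \<beta> \<alpha> (P \<delta> \<gamma> \<beta> \<zeta> \<eta>) (\<iota> \<beta> \<alpha> y x f)"
      and g = "\<lambda>\<zeta> \<eta>. P \<delta> \<gamma> \<alpha> \<zeta> (P \<gamma> \<beta> \<alpha> \<eta> (\<iota> \<beta> \<alpha> y x f))"])
    fix w z' z y' h g
    assume *: "w \<in> \<delta>" "z' \<in> \<gamma>" "z \<in> \<gamma>" "y' \<in> \<beta>" "h \<in> carrier (Hom C w z')" "g \<in> carrier (Hom C z y')"
    obtain t where t: "t \<in> carrier G" "\<phi> t z = z'"
      using orbits_transitive[OF \<gamma> *(3,2)] .
    obtain s where s: "s \<in> carrier G" "\<phi> s y = y'"
      using orbits_transitive[OF \<beta> f(1) *(4)] .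
    have mem: "w \<in> Ob C" "z' \<in> Ob C" "z \<in> Ob C" "y' \<in> Ob C" "y \<in> Ob C" "x \<in> Ob C"
      "\<phi> s x \<in> Ob C" "\<phi> t y' \<in> Ob C" "\<phi> t (\<phi> s x) \<in> Ob C"
      using * f t(1) s(1) by (simp_all add: orbits_memD[OF \<delta>] orbits_memD[OF \<gamma>] orbits_memD[OF \<beta>]
          orbits_memD[OF \<alpha>] act_closed)
    have sx: "\<phi> s x \<in> \<alpha>"
      using orbits_act_closed[OF \<alpha> f(2) s(1)] .
    have ts: "t \<otimes> s \<in> carrier G" "\<phi> (t \<otimes> s) y = \<phi> t y'" "\<phi> (t \<otimes> s) x = \<phi> t (\<phi> s x)"
      using t s mem by (simp_all add: composition_rule)
    have tg: "\<psi> t z y' g \<in> carrier (Hom C z' (\<phi> t y'))"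
      using act_closed_hom[OF t(1) mem(4,3) *(6)] t(2) by simp
    have sf: "\<psi> s y x f \<in> carrier (Hom C y' (\<phi> s x))"
      using act_closed_hom[OF s(1) mem(6,5) f(3)] s(2) by simp
    have tsf: "\<psi> t y' (\<phi> s x) (\<psi> s y x f) \<in> carrier (Hom C (\<phi> t y') (\<phi> t (\<phi> s x)))"
      using act_closed_hom[OF t(1) mem(7,4) sf] .
    have htg: "Comp C w z' (\<phi> t y') h (\<psi> t z y' g) \<in> carrier (Hom C w (\<phi> t y'))"
      using module_hom_closed[OF Comp_linear_right[OF mem(8,2,1) *(5)] tg] .
    have gsf: "Comp C z y' (\<phi> s x) g (\<psi> s y x f) \<in> carrier (Hom C z (\<phi> s x))"
      using module_hom_closed[OF Comp_linear_right[OF mem(7,4,3) *(6)] sf] .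
    have "P \<delta> \<beta> \<alpha> (P \<delta> \<gamma> \<beta> (\<iota> \<delta> \<gamma> w z' h) (\<iota> \<gamma> \<beta> z y' g)) (\<iota> \<beta> \<alpha> y x f) =
        P \<delta> \<beta> \<alpha> (\<iota> \<delta> \<beta> w (\<phi> t y') (Comp C w z' (\<phi> t y') h (\<psi> t z y' g))) (\<iota> \<beta> \<alpha> y x f)"
      using P_\<iota>[OF \<delta> \<gamma> \<beta> *(1,3,4) t(1) _ *(6), unfolded t(2), OF *(5)] by simp
    also have "\<dots> = \<iota> \<delta> \<alpha> w (\<phi> t (\<phi> s x)) (Comp C w (\<phi> t y') (\<phi> t (\<phi> s x))
        (Comp C w z' (\<phi> t y') h (\<psi> t z y' g)) (\<psi> t y' (\<phi> s x) (\<psi> s y x f)))"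
      using P_\<iota>[OF \<delta> \<beta> \<alpha> *(1) f(1,2) ts(1) _ f(3), unfolded ts(2,3), OF htg]
        act_mult[OF s(1) t(1) mem(6,5) f(3)] s(2) by simp
    also have "\<dots> = \<iota> \<delta> \<alpha> w (\<phi> t (\<phi> s x)) (Comp C w z' (\<phi> t (\<phi> s x)) h
        (\<psi> t z (\<phi> s x) (Comp C z y' (\<phi> s x) g (\<psi> s y x f))))"
      using Comp_assoc[OF mem(9,8,2,1) tsf tg *(5)] act_Comp[OF t(1) mem(7,4,3) sf *(6)] t(2) by simp
    also have "\<dots> = P \<delta> \<gamma> \<alpha> (\<iota> \<delta> \<gamma> w z' h) (\<iota> \<gamma> \<alpha> z (\<phi> s x) (Comp C z y' (\<phi> s x) g (\<psi> s y x f)))"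
      using P_\<iota>[OF \<delta> \<gamma> \<alpha> *(1,3) sx t(1) _ gsf, unfolded t(2), OF *(5)] by simp
    also have "\<dots> = P \<delta> \<gamma> \<alpha> (\<iota> \<delta> \<gamma> w z' h) (P \<gamma> \<beta> \<alpha> (\<iota> \<gamma> \<beta> z y' g) (\<iota> \<beta> \<alpha> y x f))"
      using P_\<iota>[OF \<gamma> \<beta> \<alpha> *(3) f(1,2) s(1) _ f(3), unfolded s(2), OF *(6)] by simp
    finally show "P \<delta> \<beta> \<alpha> (P \<delta> \<gamma> \<beta> (\<iota> \<delta> \<gamma> w z' h) (\<iota> \<gamma> \<beta> z y' g)) (\<iota> \<beta> \<alpha> y x f) =
        P \<delta> \<gamma> \<alpha> (\<iota> \<delta> \<gamma> w z' h) (P \<gamma> \<beta> \<alpha> (\<iota> \<gamma> \<beta> z y' g) (\<iota> \<beta> \<alpha> y x f))" .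
  next
    fix \<eta> assume "\<eta> \<in> carrier (X \<gamma> \<beta>)"
    then show "(\<lambda>\<zeta>. P \<delta> \<beta> \<alpha> (P \<delta> \<gamma> \<beta> \<zeta> \<eta>) (\<iota> \<beta> \<alpha> y x f)) \<in> module_hom k (X \<delta> \<gamma>) (X \<delta> \<alpha>)"
      and "(\<lambda>\<zeta>. P \<delta> \<gamma> \<alpha> \<zeta> (P \<gamma> \<beta> \<alpha> \<eta> (\<iota> \<beta> \<alpha> y x f))) \<in> module_hom k (X \<delta> \<gamma>) (X \<delta> \<alpha>)"
      by (auto intro!: module_hom_comp[OF P_hom_left[OF \<delta> \<gamma> \<beta>] P_hom_left[OF \<delta> \<beta> \<alpha> \<iota>f]]
          P_hom_left[OF \<delta> \<gamma> \<alpha>] P_closed[OF \<gamma> \<beta> \<alpha> _ \<iota>f])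
  next
    fix \<zeta> assume "\<zeta> \<in> carrier (X \<delta> \<gamma>)"
    then show "(\<lambda>\<eta>. P \<delta> \<beta> \<alpha> (P \<delta> \<gamma> \<beta> \<zeta> \<eta>) (\<iota> \<beta> \<alpha> y x f)) \<in> module_hom k (X \<gamma> \<beta>) (X \<delta> \<alpha>)"
      and "(\<lambda>\<eta>. P \<delta> \<gamma> \<alpha> \<zeta> (P \<gamma> \<beta> \<alpha> \<eta> (\<iota> \<beta> \<alpha> y x f))) \<in> module_hom k (X \<gamma> \<beta>) (X \<delta> \<alpha>)"
      by (auto intro!: module_hom_comp[OF P_hom_right[OF \<delta> \<gamma> \<beta>] P_hom_left[OF \<delta> \<beta> \<alpha> \<iota>f]]
          module_hom_comp[OF P_hom_left[OF \<gamma> \<beta> \<alpha> \<iota>f] P_hom_right[OF \<delta> \<gamma> \<alpha>]])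
  qed
qed

section \<open>The quotient category\<close>

abbreviation Q where
  "Q \<equiv> quotient_category k G C \<phi> \<psi>"

lemma Q_simps:
  "Ob Q = orbs"
  "Hom Q \<beta> \<alpha> = coinvariants k G (X \<beta> \<alpha>) (\<sigma> \<beta> \<alpha>)"
  "Comp Q \<gamma> \<beta> \<alpha> B A = (\<Union>\<eta>\<in>B. \<Union>\<xi>\<in>A. cls \<gamma> \<alpha> (P \<gamma> \<beta> \<alpha> \<eta> \<xi>))"
  "Id Q \<alpha> = (\<Union>x\<in>\<alpha>. cls \<alpha> \<alpha> (\<iota> \<alpha> \<alpha> x x (Id C x)))"
  by (simp_all add: quotient_category_def)

context
  fixes \<beta> \<alpha>
  assumes \<beta>: "\<beta> \<in> orbs" and \<alpha>: "\<alpha> \<in> orbs"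
begin

interpretation GM: G_module k G "X \<beta> \<alpha>" "\<sigma> \<beta> \<alpha>"
  by (rule orbit_G_module[OF \<beta> \<alpha>])

lemma module_Q: "module k (Hom Q \<beta> \<alpha>)"
  unfolding Q_simps by (rule GM.module_coinvariants)

lemma cls_hom: "cls \<beta> \<alpha> \<in> module_hom k (X \<beta> \<alpha>) (Hom Q \<beta> \<alpha>)"
  unfolding Q_simps cls_eq[OF \<beta> \<alpha>] by (rule GM.coinvariant_class_hom)

lemma Q_carrier: "carrier (Hom Q \<beta> \<alpha>) = cls \<beta> \<alpha> ` carrier (X \<beta> \<alpha>)"
  unfolding Q_simps cls_eq[OF \<beta> \<alpha>] by (rule GM.coinvariants_carrier)

lemma cls_\<sigma>: "\<lbrakk>s \<in> carrier G; \<xi> \<in> carrier (X \<beta> \<alpha>)\<rbrakk> \<Longrightarrow> cls \<beta> \<alpha> (\<sigma> \<beta> \<alpha> s \<xi>) = cls \<beta> \<alpha> \<xi>"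
  unfolding cls_eq[OF \<beta> \<alpha>] by (rule GM.coinvariant_class_action)

lemma cls_self: "\<xi> \<in> carrier (X \<beta> \<alpha>) \<Longrightarrow> \<xi> \<in> cls \<beta> \<alpha> \<xi>"
  unfolding cls_eq[OF \<beta> \<alpha>] by (rule GM.coinvariant_class_self)

lemma cls_memD:
  assumes "\<xi>' \<in> cls \<beta> \<alpha> \<xi>" and "\<xi> \<in> carrier (X \<beta> \<alpha>)"
  shows "\<xi>' \<in> carrier (X \<beta> \<alpha>)" and "cls \<beta> \<alpha> \<xi>' = cls \<beta> \<alpha> \<xi>"
  using GM.coinvariant_class_memD[of \<xi>' \<xi>] assms unfolding cls_eq[OF \<beta> \<alpha>] by auto

lemma invariant_hom_cls:
  assumes "module k N" and "f \<in> module_hom k (X \<beta> \<alpha>) N"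
    and "\<And>s \<xi>. \<lbrakk>s \<in> carrier G; \<xi> \<in> carrier (X \<beta> \<alpha>)\<rbrakk> \<Longrightarrow> f (\<sigma> \<beta> \<alpha> s \<xi>) = f \<xi>"
    and "\<xi> \<in> carrier (X \<beta> \<alpha>)" and "\<xi>' \<in> carrier (X \<beta> \<alpha>)" and "cls \<beta> \<alpha> \<xi> = cls \<beta> \<alpha> \<xi>'"
  shows "f \<xi> = f \<xi>'"
  by (rule GM.invariant_hom_factors[OF assms(1,2) _ assms(4,5)])
    (use assms(3,6) in \<open>simp_all add: cls_eq[OF \<beta> \<alpha>]\<close>)

lemma cls_\<iota>_act:
  assumes "s \<in> carrier G" and "y \<in> \<beta>" and "x \<in> \<alpha>" and "f \<in> carrier (Hom C y x)"
  shows "cls \<beta> \<alpha> (\<iota> \<beta> \<alpha> (\<phi> s y) (\<phi> s x) (\<psi> s y x f)) = cls \<beta> \<alpha> (\<iota> \<beta> \<alpha> y x f)"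
  using cls_\<sigma>[OF assms(1) \<iota>_closed[OF \<beta> \<alpha> assms(2-4)]] \<sigma>_\<iota>[OF \<beta> \<alpha> assms] by simp

end

text \<open>Representatives are exchanged one factor at a time: in the left factor the class of the
  composite is invariant by equivariance of \<open>P\<close>, in the right factor the composite
  itself is. The union over all representatives therefore consists of equal cosets.\<close>

lemma Comp_Q_cls:
  assumes \<gamma>: "\<gamma> \<in> orbs" and \<beta>: "\<beta> \<in> orbs" and \<alpha>: "\<alpha> \<in> orbs"
    and \<eta>: "\<eta> \<in> carrier (X \<gamma> \<beta>)" and \<xi>: "\<xi> \<in> carrier (X \<beta> \<alpha>)"
  shows "Comp Q \<gamma> \<beta> \<alpha> (cls \<gamma> \<beta> \<eta>) (cls \<beta> \<alpha> \<xi>) = cls \<gamma> \<alpha> (P \<gamma> \<beta> \<alpha> \<eta> \<xi>)"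
proof -
  have "cls \<gamma> \<alpha> (P \<gamma> \<beta> \<alpha> \<eta>' \<xi>') = cls \<gamma> \<alpha> (P \<gamma> \<beta> \<alpha> \<eta> \<xi>)"
    if \<eta>': "\<eta>' \<in> cls \<gamma> \<beta> \<eta>" and \<xi>': "\<xi>' \<in> cls \<beta> \<alpha> \<xi>" for \<eta>' \<xi>'
  proof -
    note \<eta>' = cls_memD[OF \<gamma> \<beta> \<eta>' \<eta>] and \<xi>' = cls_memD[OF \<beta> \<alpha> \<xi>' \<xi>]
    have "cls \<gamma> \<alpha> (P \<gamma> \<beta> \<alpha> \<eta>' \<xi>') = cls \<gamma> \<alpha> (P \<gamma> \<beta> \<alpha> \<eta> \<xi>')"
      by (rule invariant_hom_cls[OF \<gamma> \<beta> module_Q[OF \<gamma> \<alpha>]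
            module_hom_comp[OF P_hom_left[OF \<gamma> \<beta> \<alpha> \<xi>'(1)] cls_hom[OF \<gamma> \<alpha>]] _ \<eta>'(1) \<eta> \<eta>'(2)])
        (simp add: P_\<sigma>_left[OF \<gamma> \<beta> \<alpha> _ _ \<xi>'(1)] cls_\<sigma>[OF \<gamma> \<alpha>] P_closed[OF \<gamma> \<beta> \<alpha> _ \<xi>'(1)])
    also have "P \<gamma> \<beta> \<alpha> \<eta> \<xi>' = P \<gamma> \<beta> \<alpha> \<eta> \<xi>"
      by (rule invariant_hom_cls[OF \<beta> \<alpha> module_X[OF \<gamma> \<alpha>] P_hom_right[OF \<gamma> \<beta> \<alpha> \<eta>]
            P_\<sigma>_right[OF \<gamma> \<beta> \<alpha> _ \<eta>] \<xi>'(1) \<xi> \<xi>'(2)])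
    finally show ?thesis .
  qed
  then have "(\<Union>\<eta>'\<in>cls \<gamma> \<beta> \<eta>. \<Union>\<xi>'\<in>cls \<beta> \<alpha> \<xi>. cls \<gamma> \<alpha> (P \<gamma> \<beta> \<alpha> \<eta>' \<xi>')) = cls \<gamma> \<alpha> (P \<gamma> \<beta> \<alpha> \<eta> \<xi>)"
    using cls_self[OF \<gamma> \<beta> \<eta>] cls_self[OF \<beta> \<alpha> \<xi>] by (intro SUP_eq_const) blast+
  then show ?thesis
    by (simp add: Q_simps)
qed

text \<open>Two objects of an orbit differ by some s, which carries one identity to the other
  (\<open>act_Id\<close>); their classes agree, so the union is one coset.\<close>

lemma Id_Q_cls:
  assumes \<alpha>: "\<alpha> \<in> orbs" and x: "x \<in> \<alpha>"
  shows "Id Q \<alpha> = cls \<alpha> \<alpha> (\<iota> \<alpha> \<alpha> x x (Id C x))"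
proof -
  have "cls \<alpha> \<alpha> (\<iota> \<alpha> \<alpha> x' x' (Id C x')) = cls \<alpha> \<alpha> (\<iota> \<alpha> \<alpha> x x (Id C x))" if x': "x' \<in> \<alpha>" for x'
  proof -
    obtain s where s: "s \<in> carrier G" "\<phi> s x = x'"
      using orbits_transitive[OF \<alpha> x x'] .
    have "x \<in> Ob C"
      using orbits_memD[OF \<alpha> x] .
    then show ?thesis
      using cls_\<iota>_act[OF \<alpha> \<alpha> s(1) x x, of "Id C x"] s by (simp add: act_Id Id_closed)
  qed
  then have "(\<Union>x\<in>\<alpha>. cls \<alpha> \<alpha> (\<iota> \<alpha> \<alpha> x x (Id C x))) = cls \<alpha> \<alpha> (\<iota> \<alpha> \<alpha> x x (Id C x))"
    using x by (intro SUP_eq_const) blast+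
  then show ?thesis
    by (simp add: Q_simps)
qed

definition rep where "rep \<alpha> = (SOME x. x \<in> \<alpha>)"

lemma rep_mem:
  assumes "\<alpha> \<in> orbs"
  shows "rep \<alpha> \<in> \<alpha>"
proof -
  obtain x where "x \<in> Ob C" "\<alpha> = orbit G \<phi> x"
    using assms by (auto simp: orbits_def)
  then have "x \<in> \<alpha>"
    using orbit_refl by simp
  then show ?thesis
    unfolding rep_def by (rule someI)
qed

lemma rep_Ob: "\<alpha> \<in> orbs \<Longrightarrow> rep \<alpha> \<in> Ob C"
  using rep_mem orbits_memD by blast

text \<open>Composing with the identity of z replaces f by s f, where s moves the target of f to z.
  This is in general another element of the direct sum, so the unit law holds only for
  classes.\<close>

lemma P_Id_left:
  assumes \<beta>: "\<beta> \<in> orbs" and \<alpha>: "\<alpha> \<in> orbs" and z: "z \<in> \<beta>" and \<xi>: "\<xi> \<in> carrier (X \<beta> \<alpha>)"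
  shows "cls \<beta> \<alpha> (P \<beta> \<beta> \<alpha> (\<iota> \<beta> \<beta> z z (Id C z)) \<xi>) = cls \<beta> \<alpha> \<xi>"
proof (rule X_hom_eqI[OF \<beta> \<alpha> module_Q[OF \<beta> \<alpha>] _ cls_hom[OF \<beta> \<alpha>] _ \<xi>])
  have zO: "z \<in> Ob C"
    using orbits_memD[OF \<beta> z] .
  have \<iota>z: "\<iota> \<beta> \<beta> z z (Id C z) \<in> carrier (X \<beta> \<beta>)"
    using \<iota>_closed[OF \<beta> \<beta> z z Id_closed[OF zO]] .
  show "(\<lambda>\<xi>. cls \<beta> \<alpha> (P \<beta> \<beta> \<alpha> (\<iota> \<beta> \<beta> z z (Id C z)) \<xi>)) \<in> module_hom k (X \<beta> \<alpha>) (Hom Q \<beta> \<alpha>)"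
    using module_hom_comp[OF P_hom_right[OF \<beta> \<beta> \<alpha> \<iota>z] cls_hom[OF \<beta> \<alpha>]] .
  fix y x f assume f: "y \<in> \<beta>" "x \<in> \<alpha>" "f \<in> carrier (Hom C y x)"
  obtain s where s: "s \<in> carrier G" "\<phi> s y = z"
    using orbits_transitive[OF \<beta> f(1) z] .
  have mem: "y \<in> Ob C" "x \<in> Ob C" "\<phi> s x \<in> Ob C"
    using f s by (simp_all add: orbits_memD[OF \<beta>] orbits_memD[OF \<alpha>] act_closed)
  have sf: "\<psi> s y x f \<in> carrier (Hom C z (\<phi> s x))"
    using act_closed_hom[OF s(1) mem(2,1) f(3)] s(2) by simp
  have "P \<beta> \<beta> \<alpha> (\<iota> \<beta> \<beta> z z (Id C z)) (\<iota> \<beta> \<alpha> y x f) = \<iota> \<beta> \<alpha> z (\<phi> s x) (\<psi> s y x f)"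
    using P_\<iota>[OF \<beta> \<beta> \<alpha> z f(1,2) s(1) _ f(3), unfolded s(2), OF Id_closed[OF zO]] Id_left[OF mem(3) zO sf] by simp
  then show "cls \<beta> \<alpha> (P \<beta> \<beta> \<alpha> (\<iota> \<beta> \<beta> z z (Id C z)) (\<iota> \<beta> \<alpha> y x f)) = cls \<beta> \<alpha> (\<iota> \<beta> \<alpha> y x f)"
    using cls_\<iota>_act[OF \<beta> \<alpha> s(1) f] s(2) by simp
qed

text \<open>On this side it is the identity of w that is translated, to the source of f, where it
  becomes the identity of that source. The law therefore holds without passing to classes.\<close>

lemma P_Id_right:
  assumes \<beta>: "\<beta> \<in> orbs" and \<alpha>: "\<alpha> \<in> orbs" and w: "w \<in> \<alpha>" and \<xi>: "\<xi> \<in> carrier (X \<beta> \<alpha>)"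
  shows "P \<beta> \<alpha> \<alpha> \<xi> (\<iota> \<alpha> \<alpha> w w (Id C w)) = \<xi>"
proof -
  have wO: "w \<in> Ob C"
    using orbits_memD[OF \<alpha> w] .
  have \<iota>w: "\<iota> \<alpha> \<alpha> w w (Id C w) \<in> carrier (X \<alpha> \<alpha>)"
    using \<iota>_closed[OF \<alpha> \<alpha> w w Id_closed[OF wO]] .
  show ?thesis
  proof (rule X_hom_eqI[OF \<beta> \<alpha> module_X[OF \<beta> \<alpha>] P_hom_left[OF \<beta> \<alpha> \<alpha> \<iota>w] module_hom_ident _ \<xi>])
    fix y x f assume f: "y \<in> \<beta>" "x \<in> \<alpha>" "f \<in> carrier (Hom C y x)"
    obtain s where s: "s \<in> carrier G" "\<phi> s w = x"
      using orbits_transitive[OF \<alpha> w f(2)] .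
    have mem: "y \<in> Ob C" "x \<in> Ob C"
      using f by (simp_all add: orbits_memD[OF \<beta>] orbits_memD[OF \<alpha>])
    show "P \<beta> \<alpha> \<alpha> (\<iota> \<beta> \<alpha> y x f) (\<iota> \<alpha> \<alpha> w w (Id C w)) = \<iota> \<beta> \<alpha> y x f"
      using P_\<iota>[OF \<beta> \<alpha> \<alpha> f(1) w w s(1) _ Id_closed[OF wO], unfolded s(2), OF f(3)]
        act_Id[OF s(1) wO] Id_right[OF mem(2,1) f(3)] s(2) by simp
  qed
qed

text \<open>\<open>Comp_Q_cls\<close> carries bilinearity, associativity and the unit laws of
  \<open>P\<close> over to classes. Units are evaluated at \<open>rep\<close>, which
  \<open>Id_Q_cls\<close> permits.\<close>

lemma k_category_Q: "k_category k Q"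
proof (intro k_category.intro k_category_axioms.intro)
  show "cring k" by (rule cring_axioms)
next
  fix \<alpha> \<beta> assume "\<alpha> \<in> Ob Q" "\<beta> \<in> Ob Q"
  then show "module k (Hom Q \<beta> \<alpha>)"
    using module_Q by (simp add: Q_simps(1))
next
  fix \<alpha> \<beta> \<gamma> A assume *: "\<alpha> \<in> Ob Q" "\<beta> \<in> Ob Q" "\<gamma> \<in> Ob Q" and A: "A \<in> carrier (Hom Q \<beta> \<alpha>)"
  note orb = *[unfolded Q_simps(1)]
  obtain \<xi> where \<xi>: "\<xi> \<in> carrier (X \<beta> \<alpha>)" "A = cls \<beta> \<alpha> \<xi>"
    using A by (auto simp: Q_carrier[OF orb(2,1)])
  show "(\<lambda>B. Comp Q \<gamma> \<beta> \<alpha> B A) \<in> module_hom k (Hom Q \<gamma> \<beta>) (Hom Q \<gamma> \<alpha>)"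
    unfolding \<xi>(2)
    by (rule module_hom_factor[OF module_X[OF orb(3,2)] cls_hom[OF orb(3,2)] Q_carrier[OF orb(3,2)]
          module_hom_comp[OF P_hom_left[OF orb(3,2,1) \<xi>(1)] cls_hom[OF orb(3,1)]]])
      (rule Comp_Q_cls[OF orb(3,2,1) _ \<xi>(1)])
next
  fix \<alpha> \<beta> \<gamma> B assume *: "\<alpha> \<in> Ob Q" "\<beta> \<in> Ob Q" "\<gamma> \<in> Ob Q" and B: "B \<in> carrier (Hom Q \<gamma> \<beta>)"
  note orb = *[unfolded Q_simps(1)]
  obtain \<eta> where \<eta>: "\<eta> \<in> carrier (X \<gamma> \<beta>)" "B = cls \<gamma> \<beta> \<eta>"
    using B by (auto simp: Q_carrier[OF orb(3,2)])
  show "(\<lambda>A. Comp Q \<gamma> \<beta> \<alpha> B A) \<in> module_hom k (Hom Q \<beta> \<alpha>) (Hom Q \<gamma> \<alpha>)"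
    unfolding \<eta>(2)
    by (rule module_hom_factor[OF module_X[OF orb(2,1)] cls_hom[OF orb(2,1)] Q_carrier[OF orb(2,1)]
          module_hom_comp[OF P_hom_right[OF orb(3,2,1) \<eta>(1)] cls_hom[OF orb(3,1)]]])
      (rule Comp_Q_cls[OF orb(3,2,1) \<eta>(1)])
next
  fix \<alpha> \<beta> \<gamma> \<delta> A B E
  assume *: "\<alpha> \<in> Ob Q" "\<beta> \<in> Ob Q" "\<gamma> \<in> Ob Q" "\<delta> \<in> Ob Q" and A: "A \<in> carrier (Hom Q \<beta> \<alpha>)"
    and B: "B \<in> carrier (Hom Q \<gamma> \<beta>)" and E: "E \<in> carrier (Hom Q \<delta> \<gamma>)"
  note orb = *[unfolded Q_simps(1)]
  obtain \<xi> where \<xi>: "\<xi> \<in> carrier (X \<beta> \<alpha>)" "A = cls \<beta> \<alpha> \<xi>"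
    using A by (auto simp: Q_carrier[OF orb(2,1)])
  obtain \<eta> where \<eta>: "\<eta> \<in> carrier (X \<gamma> \<beta>)" "B = cls \<gamma> \<beta> \<eta>"
    using B by (auto simp: Q_carrier[OF orb(3,2)])
  obtain \<zeta> where \<zeta>: "\<zeta> \<in> carrier (X \<delta> \<gamma>)" "E = cls \<delta> \<gamma> \<zeta>"
    using E by (auto simp: Q_carrier[OF orb(4,3)])
  show "Comp Q \<delta> \<beta> \<alpha> (Comp Q \<delta> \<gamma> \<beta> E B) A = Comp Q \<delta> \<gamma> \<alpha> E (Comp Q \<gamma> \<beta> \<alpha> B A)"
    using Comp_Q_cls[OF orb(4,3,2) \<zeta>(1) \<eta>(1)] Comp_Q_cls[OF orb(3,2,1) \<eta>(1) \<xi>(1)]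
      Comp_Q_cls[OF orb(4,2,1) P_closed[OF orb(4,3,2) \<zeta>(1) \<eta>(1)] \<xi>(1)]
      Comp_Q_cls[OF orb(4,3,1) \<zeta>(1) P_closed[OF orb(3,2,1) \<eta>(1) \<xi>(1)]]
      P_assoc[OF orb(4,3,2,1) \<zeta>(1) \<eta>(1) \<xi>(1)]
    by (simp only: \<xi>(2) \<eta>(2) \<zeta>(2))
next
  fix \<alpha> assume "\<alpha> \<in> Ob Q"
  then have \<alpha>: "\<alpha> \<in> orbs" by (simp add: Q_simps(1))
  show "Id Q \<alpha> \<in> carrier (Hom Q \<alpha> \<alpha>)"
    unfolding Id_Q_cls[OF \<alpha> rep_mem[OF \<alpha>]]
    by (intro module_hom_closed[OF cls_hom] \<iota>_closed \<alpha> rep_mem Id_closed rep_Ob)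
next
  fix \<alpha> \<beta> A assume *: "\<alpha> \<in> Ob Q" "\<beta> \<in> Ob Q" and A: "A \<in> carrier (Hom Q \<beta> \<alpha>)"
  note orb = *[unfolded Q_simps(1)]
  obtain \<xi> where \<xi>: "\<xi> \<in> carrier (X \<beta> \<alpha>)" "A = cls \<beta> \<alpha> \<xi>"
    using A by (auto simp: Q_carrier[OF orb(2,1)])
  have \<iota>: "\<iota> \<gamma> \<gamma> (rep \<gamma>) (rep \<gamma>) (Id C (rep \<gamma>)) \<in> carrier (X \<gamma> \<gamma>)" if "\<gamma> \<in> orbs" for \<gamma>
    by (intro \<iota>_closed that rep_mem Id_closed rep_Ob)
  show "Comp Q \<beta> \<beta> \<alpha> (Id Q \<beta>) A = A"
    using Comp_Q_cls[OF orb(2,2,1) \<iota>[OF orb(2)] \<xi>(1)] P_Id_left[OF orb(2,1) rep_mem[OF orb(2)] \<xi>(1)]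
    by (simp only: \<xi>(2) Id_Q_cls[OF orb(2) rep_mem[OF orb(2)]])
  show "Comp Q \<beta> \<alpha> \<alpha> A (Id Q \<alpha>) = A"
    using Comp_Q_cls[OF orb(2,1,1) \<xi>(1) \<iota>[OF orb(1)]] P_Id_right[OF orb(2,1) rep_mem[OF orb(1)] \<xi>(1)]
    by (simp only: \<xi>(2) Id_Q_cls[OF orb(1) rep_mem[OF orb(1)]])
qed

section \<open>Trace maps on coinvariants\<close>

text \<open>
  \<open>trace \<beta> \<alpha> y x \<xi>\<close> is the sum of \<open>u\<^sup>-\<^sup>1 \<xi>(u y, u x)\<close> over \<open>u\<close> in \<open>G\<close>, written as a sum over
  the support of \<open>\<xi>\<close>; \<open>trace_comp\<close> gives the contribution of one component of \<open>\<xi>\<close>.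
\<close>

definition trace_comp where
  "trace_comp y x = (\<lambda>(y', x') f. let s = translation G \<phi> y y' in
     if \<phi> s x = x' then \<psi> (inv s) y' x' f else \<zero>\<^bsub>Hom C y x\<^esub>)"

definition trace where
  "trace \<beta> \<alpha> y x = direct_sum_lift (\<beta> \<times> \<alpha>) (\<lambda>(y, x). Hom C y x) (Hom C y x) (trace_comp y x)"

context
  fixes \<beta> \<alpha> y x
  assumes \<beta>: "\<beta> \<in> orbs" and \<alpha>: "\<alpha> \<in> orbs" and y: "y \<in> \<beta>" and x: "x \<in> \<alpha>"
begin

lemma trace_comp_act:
  assumes "s \<in> carrier G"
  shows "trace_comp y x (\<phi> s y, x') f =
    (if \<phi> s x = x' then \<psi> (inv s) (\<phi> s y) x' f else \<zero>\<^bsub>Hom C y x\<^esub>)"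
  using translation_eqI[OF orbits_memD[OF \<beta> y] assms refl] by (simp add: trace_comp_def)

lemma trace_comp_hom:
  assumes "i \<in> \<beta> \<times> \<alpha>"
  shows "trace_comp y x i \<in> module_hom k (case i of (y, x) \<Rightarrow> Hom C y x) (Hom C y x)"
proof -
  obtain y' x' where i: "i = (y', x')" "y' \<in> \<beta>" "x' \<in> \<alpha>"
    using assms by blast
  obtain s where s: "s \<in> carrier G" "\<phi> s y = y'"
    using orbits_transitive[OF \<beta> y i(2)] .
  have mem: "y \<in> Ob C" "x \<in> Ob C" "\<phi> s y \<in> Ob C" "\<phi> s x \<in> Ob C"
    using y x s(1) by (simp_all add: orbits_memD[OF \<beta>] orbits_memD[OF \<alpha>] act_closed)
  have eq: "trace_comp y x i = (\<lambda>f. if \<phi> s x = x' then \<psi> (inv s) y' x' f else \<zero>\<^bsub>Hom C y x\<^esub>)"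
    using trace_comp_act[OF s(1), of x'] s(2) i(1) by (simp add: fun_eq_iff)
  show ?thesis
  proof (cases "\<phi> s x = x'")
    case True
    then show ?thesis
      unfolding eq using act_linear[of "inv s" "\<phi> s x" "\<phi> s y"] mem s i(1)
        act_cancel(1)[OF s(1) mem(1)] act_cancel(1)[OF s(1) mem(2)] by simp
  next
    case False
    then show ?thesis
      unfolding eq by (simp add: module_hom_const_zero Hom_module mem)
  qed
qed

lemma trace_hom: "trace \<beta> \<alpha> y x \<in> module_hom k (X \<beta> \<alpha>) (Hom C y x)"
  unfolding trace_def orbit_module_def
  by (rule direct_sum_lift_hom[OF Hom_orbit_module[OF \<beta> \<alpha>] Hom_module[OF orbits_memD[OF \<alpha> x] orbits_memD[OF \<beta> y]]
        trace_comp_hom])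

lemma trace_\<iota>:
  assumes s: "s \<in> carrier G" and x': "x' \<in> \<alpha>" and f: "f \<in> carrier (Hom C (\<phi> s y) x')"
  shows "trace \<beta> \<alpha> y x (\<iota> \<beta> \<alpha> (\<phi> s y) x' f) =
    (if \<phi> s x = x' then \<psi> (inv s) (\<phi> s y) x' f else \<zero>\<^bsub>Hom C y x\<^esub>)"
proof -
  have "trace \<beta> \<alpha> y x (\<iota> \<beta> \<alpha> (\<phi> s y) x' f) = trace_comp y x (\<phi> s y, x') f"
    unfolding trace_def orbit_module_inj_def
    by (rule direct_sum_lift_inj[OF Hom_orbit_module[OF \<beta> \<alpha>]
          Hom_module[OF orbits_memD[OF \<alpha> x] orbits_memD[OF \<beta> y]] trace_comp_hom])
      (use s x' f orbits_act_closed[OF \<beta> y] in auto)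
  then show ?thesis
    by (simp add: trace_comp_act[OF s])
qed

text \<open>Reindexing the sum by u = s t: a component f at (t y, t x) contributes the inverse of t
  applied to f; the action of s moves it to (s t y, s t x), where it contributes the inverse of s t
  applied to s f, which is the same. Components off this orbit of pairs contribute zero before and
  after, as s is injective on objects.\<close>

lemma trace_\<sigma>:
  assumes s: "s \<in> carrier G" and \<xi>: "\<xi> \<in> carrier (X \<beta> \<alpha>)"
  shows "trace \<beta> \<alpha> y x (\<sigma> \<beta> \<alpha> s \<xi>) = trace \<beta> \<alpha> y x \<xi>"
proof (rule X_hom_eqI[OF \<beta> \<alpha> Hom_module[OF orbits_memD[OF \<alpha> x] orbits_memD[OF \<beta> y]]
      module_hom_comp[OF \<sigma>_hom[OF \<beta> \<alpha> s] trace_hom] trace_hom _ \<xi>])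
  fix y' x' f assume f: "y' \<in> \<beta>" "x' \<in> \<alpha>" "f \<in> carrier (Hom C y' x')"
  obtain t where t: "t \<in> carrier G" "\<phi> t y = y'"
    using orbits_transitive[OF \<beta> y f(1)] .
  have mem: "x' \<in> Ob C" "y' \<in> Ob C" "x \<in> Ob C" "y \<in> Ob C" "\<phi> t x \<in> Ob C" "\<phi> s x' \<in> \<alpha>" "\<phi> s x' \<in> Ob C" "\<phi> s y' \<in> Ob C"
    using y x f s t(1) by (simp_all add: orbits_memD[OF \<beta>] orbits_memD[OF \<alpha>] act_closed orbits_act_closed[OF \<alpha>])
  have st: "s \<otimes> t \<in> carrier G" "\<phi> (s \<otimes> t) y = \<phi> s y'" "\<phi> (s \<otimes> t) x = \<phi> s (\<phi> t x)"
    using s t mem by (simp_all add: composition_rule)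
  have iff: "\<phi> s (\<phi> t x) = \<phi> s x' \<longleftrightarrow> \<phi> t x = x'"
    using inj_onD[OF inj_prop[OF s]] mem by blast
  have sf: "\<psi> s y' x' f \<in> carrier (Hom C (\<phi> s y') (\<phi> s x'))"
    using act_closed_hom[OF s mem(1,2) f(3)] .
  have "\<psi> (inv (s \<otimes> t)) (\<phi> s y') (\<phi> s x') (\<psi> s y' x' f) = \<psi> (inv (s \<otimes> t) \<otimes> s) y' x' f"
    using act_mult[OF s _ mem(1,2) f(3), of "inv (s \<otimes> t)"] st(1) by simp
  also have "inv (s \<otimes> t) \<otimes> s = inv t"
    using s t(1) by (simp add: grp.inv_mult_group grp.m_assoc)
  finally have \<psi>: "\<psi> (inv (s \<otimes> t)) (\<phi> s y') (\<phi> s x') (\<psi> s y' x' f) = \<psi> (inv t) y' x' f" .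
  have "trace \<beta> \<alpha> y x (\<sigma> \<beta> \<alpha> s (\<iota> \<beta> \<alpha> y' x' f)) = trace \<beta> \<alpha> y x (\<iota> \<beta> \<alpha> (\<phi> s y') (\<phi> s x') (\<psi> s y' x' f))"
    using \<sigma>_\<iota>[OF \<beta> \<alpha> s f] by simp
  also have "\<dots> = (if \<phi> t x = x' then \<psi> (inv t) y' x' f else \<zero>\<^bsub>Hom C y x\<^esub>)"
    using trace_\<iota>[OF st(1) mem(6), unfolded st(2,3), OF sf] by (simp add: iff \<psi>)
  also have "\<dots> = trace \<beta> \<alpha> y x (\<iota> \<beta> \<alpha> y' x' f)"
    using trace_\<iota>[OF t(1) f(2), unfolded t(2), OF f(3)] by simp
  finally show "trace \<beta> \<alpha> y x (\<sigma> \<beta> \<alpha> s (\<iota> \<beta> \<alpha> y' x' f)) = trace \<beta> \<alpha> y x (\<iota> \<beta> \<alpha> y' x' f)" .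
qed

end

text \<open>The map induced by \<open>trace\<close> on classes. The arbitrary preimage is harmless
  by invariance (\<open>ctrace_cls\<close>).\<close>

definition ctrace where
  "ctrace \<beta> \<alpha> y x A = trace \<beta> \<alpha> y x (SOME \<xi>. \<xi> \<in> carrier (X \<beta> \<alpha>) \<and> cls \<beta> \<alpha> \<xi> = A)"

context
  fixes \<beta> \<alpha> y x
  assumes \<beta>: "\<beta> \<in> orbs" and \<alpha>: "\<alpha> \<in> orbs" and y: "y \<in> \<beta>" and x: "x \<in> \<alpha>"
begin

lemma ctrace_cls:
  assumes \<xi>: "\<xi> \<in> carrier (X \<beta> \<alpha>)"
  shows "ctrace \<beta> \<alpha> y x (cls \<beta> \<alpha> \<xi>) = trace \<beta> \<alpha> y x \<xi>"
proof -
  let ?\<xi> = "SOME \<xi>'. \<xi>' \<in> carrier (X \<beta> \<alpha>) \<and> cls \<beta> \<alpha> \<xi>' = cls \<beta> \<alpha> \<xi>"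
  have "?\<xi> \<in> carrier (X \<beta> \<alpha>) \<and> cls \<beta> \<alpha> ?\<xi> = cls \<beta> \<alpha> \<xi>"
    using \<xi> by (intro someI_ex[of "\<lambda>\<xi>'. \<xi>' \<in> carrier (X \<beta> \<alpha>) \<and> cls \<beta> \<alpha> \<xi>' = cls \<beta> \<alpha> \<xi>"]) blast
  then show ?thesis
    unfolding ctrace_def
    by (intro invariant_hom_cls[OF \<beta> \<alpha> Hom_module[OF orbits_memD[OF \<alpha> x] orbits_memD[OF \<beta> y]]
          trace_hom[OF \<beta> \<alpha> y x] trace_\<sigma>[OF \<beta> \<alpha> y x] _ \<xi>]) auto
qed

lemma ctrace_hom: "ctrace \<beta> \<alpha> y x \<in> module_hom k (Hom Q \<beta> \<alpha>) (Hom C y x)"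
  by (rule module_hom_factor[OF module_X[OF \<beta> \<alpha>] cls_hom[OF \<beta> \<alpha>] Q_carrier[OF \<beta> \<alpha>] trace_hom[OF \<beta> \<alpha> y x] ctrace_cls])

text \<open>The target is already y, so only u = 1 can contribute. Hence the trace at (y, x)
  recovers a morphism from x to y from its class and kills the classes coming from other sources;
  this is what separates the degrees.\<close>

lemma ctrace_\<iota>:
  assumes x': "x' \<in> \<alpha>" and f: "f \<in> carrier (Hom C y x')"
  shows "ctrace \<beta> \<alpha> y x (cls \<beta> \<alpha> (\<iota> \<beta> \<alpha> y x' f)) = (if x = x' then f else \<zero>\<^bsub>Hom C y x\<^esub>)"
proof -
  have mem: "y \<in> Ob C" "x \<in> Ob C" "x' \<in> Ob C"
    using y x x' by (simp_all add: orbits_memD[OF \<beta>] orbits_memD[OF \<alpha>])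
  show ?thesis
    using ctrace_cls[OF \<iota>_closed[OF \<beta> \<alpha> y x' f]] trace_\<iota>[OF \<beta> \<alpha> y x grp.one_closed x'] f mem
    by (simp add: act_one_object act_one)
qed

end

section \<open>The grading of the quotient category\<close>

definition homogeneous where
  "homogeneous s \<beta> \<alpha> f = cls \<beta> \<alpha> (\<iota> \<beta> \<alpha> (rep \<beta>) (\<phi> s (rep \<alpha>)) f)"

definition degree_part where
  "degree_part s \<beta> \<alpha> = homogeneous s \<beta> \<alpha> ` carrier (Hom C (rep \<beta>) (\<phi> s (rep \<alpha>)))"

definition component where
  "component s \<beta> \<alpha> = ctrace \<beta> \<alpha> (rep \<beta>) (\<phi> s (rep \<alpha>))"

lemma act_rep:
  assumes "\<alpha> \<in> orbs" and "s \<in> carrier G"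
  shows "\<phi> s (rep \<alpha>) \<in> \<alpha>" and "\<phi> s (rep \<alpha>) \<in> Ob C"
  using orbits_act_closed[OF assms(1) rep_mem[OF assms(1)] assms(2)] orbits_memD[OF assms(1)] by auto

context
  fixes \<beta> \<alpha>
  assumes \<beta>: "\<beta> \<in> orbs" and \<alpha>: "\<alpha> \<in> orbs"
begin

lemma module_Hom_rep: "s \<in> carrier G \<Longrightarrow> module k (Hom C (rep \<beta>) (\<phi> s (rep \<alpha>)))"
  using Hom_module[OF act_rep(2)[OF \<alpha>] rep_Ob[OF \<beta>]] .

lemma homogeneous_hom:
  assumes "s \<in> carrier G"
  shows "homogeneous s \<beta> \<alpha> \<in> module_hom k (Hom C (rep \<beta>) (\<phi> s (rep \<alpha>))) (Hom Q \<beta> \<alpha>)"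
  unfolding homogeneous_def[abs_def]
  by (rule module_hom_comp[OF \<iota>_hom[OF \<beta> \<alpha> rep_mem[OF \<beta>] act_rep(1)[OF \<alpha> assms]] cls_hom[OF \<beta> \<alpha>]])

lemma component_hom:
  assumes "s \<in> carrier G"
  shows "component s \<beta> \<alpha> \<in> module_hom k (Hom Q \<beta> \<alpha>) (Hom C (rep \<beta>) (\<phi> s (rep \<alpha>)))"
  unfolding component_def by (rule ctrace_hom[OF \<beta> \<alpha> rep_mem[OF \<beta>] act_rep(1)[OF \<alpha> assms]])

text \<open>By freeness the objects s (r \<alpha>) are distinct for distinct s, so
  \<open>ctrace_\<iota>\<close> gives orthogonality as well as recovery of f.\<close>

lemma component_homogeneous:
  assumes s: "s \<in> carrier G" and t: "t \<in> carrier G" and f: "f \<in> carrier (Hom C (rep \<beta>) (\<phi> t (rep \<alpha>)))"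
  shows "component s \<beta> \<alpha> (homogeneous t \<beta> \<alpha> f) = (if s = t then f else \<zero>\<^bsub>Hom C (rep \<beta>) (\<phi> s (rep \<alpha>))\<^esub>)"
  using ctrace_\<iota>[OF \<beta> \<alpha> rep_mem[OF \<beta>] act_rep(1)[OF \<alpha> s] act_rep(1)[OF \<alpha> t] f]
    act_free[OF rep_Ob[OF \<alpha>] s t] by (auto simp: component_def homogeneous_def)

lemma submodule_degree_part:
  assumes "s \<in> carrier G"
  shows "submodule (degree_part s \<beta> \<alpha>) k (Hom Q \<beta> \<alpha>)"
  unfolding degree_part_def
  by (rule module_hom_image_submodule[OF module_Hom_rep[OF assms] module_Q[OF \<beta> \<alpha>] homogeneous_hom[OF assms]])

text \<open>The class of a single component is homogeneous, and finite sums of homogeneous classes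
  are closed under addition after merging their index sets.\<close>

lemma cls_finite_sum:
  assumes \<xi>: "\<xi> \<in> carrier (X \<beta> \<alpha>)"
  shows "\<exists>c F. finite F \<and> F \<subseteq> carrier G \<and> c \<in> (\<Pi> s\<in>F. degree_part s \<beta> \<alpha>) \<and>
    cls \<beta> \<alpha> \<xi> = (\<Oplus>\<^bsub>Hom Q \<beta> \<alpha>\<^esub>s\<in>F. c s)" (is "?R (cls \<beta> \<alpha> \<xi>)")
proof -
  interpret QM: module k "Hom Q \<beta> \<alpha>"
    by (rule module_Q[OF \<beta> \<alpha>])
  show ?thesis
  proof (rule direct_sum_induct[OF cring_axioms Hom_orbit_module[OF \<beta> \<alpha>] \<xi>[unfolded orbit_module_def],
        where P = "\<lambda>\<xi>. ?R (cls \<beta> \<alpha> \<xi>)", folded orbit_module_def])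
    have "cls \<beta> \<alpha> \<zero>\<^bsub>X \<beta> \<alpha>\<^esub> = \<zero>\<^bsub>Hom Q \<beta> \<alpha>\<^esub>"
      by (rule module_hom_zero[OF module_X[OF \<beta> \<alpha>] module_Q[OF \<beta> \<alpha>] cls_hom[OF \<beta> \<alpha>]])
    then show "?R (cls \<beta> \<alpha> \<zero>\<^bsub>X \<beta> \<alpha>\<^esub>)"
      by (intro exI[of _ "\<lambda>_. undefined"] exI[of _ "{}"]) simp
  next
    fix i f assume "i \<in> \<beta> \<times> \<alpha>" "f \<in> carrier (case i of (y, x) \<Rightarrow> Hom C y x)"
    then obtain y x where i: "i = (y, x)" and f: "y \<in> \<beta>" "x \<in> \<alpha>" "f \<in> carrier (Hom C y x)"
      by auto
    \<comment> \<open>Acting by u moves the target to \<open>rep \<beta>\<close> without changing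
      the class; the degree s is then read off from the translated source.\<close>
    obtain u where u: "u \<in> carrier G" "\<phi> u y = rep \<beta>"
      using orbits_transitive[OF \<beta> f(1) rep_mem[OF \<beta>]] .
    obtain s where s: "s \<in> carrier G" "\<phi> s (rep \<alpha>) = \<phi> u x"
      using orbits_transitive[OF \<alpha> rep_mem[OF \<alpha>] orbits_act_closed[OF \<alpha> f(2) u(1)]] .
    have uf: "\<psi> u y x f \<in> carrier (Hom C (rep \<beta>) (\<phi> s (rep \<alpha>)))"
      using act_closed_hom[OF u(1) orbits_memD[OF \<alpha> f(2)] orbits_memD[OF \<beta> f(1)] f(3)] u(2) s(2) by simp
    have cls: "cls \<beta> \<alpha> (\<iota> \<beta> \<alpha> y x f) = homogeneous s \<beta> \<alpha> (\<psi> u y x f)"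
      using cls_\<iota>_act[OF \<beta> \<alpha> u(1) f] u(2) s(2) by (simp add: homogeneous_def)
    have "homogeneous s \<beta> \<alpha> (\<psi> u y x f) \<in> degree_part s \<beta> \<alpha>"
      using uf by (auto simp: degree_part_def)
    moreover have "homogeneous s \<beta> \<alpha> (\<psi> u y x f) \<in> carrier (Hom Q \<beta> \<alpha>)"
      using module_hom_closed[OF homogeneous_hom[OF s(1)] uf] .
    ultimately have "?R (homogeneous s \<beta> \<alpha> (\<psi> u y x f))"
      using s(1) by (intro exI[of _ "\<lambda>_. homogeneous s \<beta> \<alpha> (\<psi> u y x f)"] exI[of _ "{s}"]) auto
    then show "?R (cls \<beta> \<alpha> (direct_sum_inj (\<beta> \<times> \<alpha>) (\<lambda>(y, x). Hom C y x) i f))"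
      using cls by (simp add: i orbit_module_inj_def)
  next
    fix \<xi> \<eta> assume \<xi>: "\<xi> \<in> carrier (X \<beta> \<alpha>)" and \<eta>: "\<eta> \<in> carrier (X \<beta> \<alpha>)"
      and "?R (cls \<beta> \<alpha> \<xi>)" and "?R (cls \<beta> \<alpha> \<eta>)"
    then obtain c F d E where F: "finite F" "F \<subseteq> carrier G" "c \<in> (\<Pi> s\<in>F. degree_part s \<beta> \<alpha>)"
        "cls \<beta> \<alpha> \<xi> = (\<Oplus>\<^bsub>Hom Q \<beta> \<alpha>\<^esub>s\<in>F. c s)"
      and E: "finite E" "E \<subseteq> carrier G" "d \<in> (\<Pi> s\<in>E. degree_part s \<beta> \<alpha>)"
        "cls \<beta> \<alpha> \<eta> = (\<Oplus>\<^bsub>Hom Q \<beta> \<alpha>\<^esub>s\<in>E. d s)"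
      by blast
    show "?R (cls \<beta> \<alpha> (\<xi> \<oplus>\<^bsub>X \<beta> \<alpha>\<^esub> \<eta>))"
      unfolding module_hom_add[OF cls_hom[OF \<beta> \<alpha>] \<xi> \<eta>] F(4) E(4)
      using finite_sums_add[of k "Hom Q \<beta> \<alpha>" "carrier G" "\<lambda>s. degree_part s \<beta> \<alpha>" F c E d]
        module_Q[OF \<beta> \<alpha>] submodule_degree_part F(1-3) E(1-3) by blast
  qed
qed

text \<open>The projection to degree s takes the component and returns its class. Orthogonality is
  \<open>component_homogeneous\<close> and spanning is \<open>cls_finite_sum\<close>.\<close>

lemma Q_decomposition: "internal_direct_sum k (Hom Q \<beta> \<alpha>) (carrier G) (\<lambda>s. degree_part s \<beta> \<alpha>)"
proof (rule internal_direct_sumI[where p = "\<lambda>s A. homogeneous s \<beta> \<alpha> (component s \<beta> \<alpha> A)"])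
  show "module k (Hom Q \<beta> \<alpha>)"
    by (rule module_Q[OF \<beta> \<alpha>])
next
  fix s A assume "s \<in> carrier G" "A \<in> carrier (Hom Q \<beta> \<alpha>)"
  then show "homogeneous s \<beta> \<alpha> (component s \<beta> \<alpha> A) \<in> degree_part s \<beta> \<alpha>"
    unfolding degree_part_def using module_hom_closed[OF component_hom] by blast
next
  fix s A assume "s \<in> carrier G" "A \<in> degree_part s \<beta> \<alpha>"
  then show "homogeneous s \<beta> \<alpha> (component s \<beta> \<alpha> A) = A"
    by (auto simp: degree_part_def component_homogeneous)
next
  fix s t A assume "s \<in> carrier G" "t \<in> carrier G" "s \<noteq> t" "A \<in> degree_part t \<beta> \<alpha>"
  then show "homogeneous s \<beta> \<alpha> (component s \<beta> \<alpha> A) = \<zero>\<^bsub>Hom Q \<beta> \<alpha>\<^esub>"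
    by (auto simp: degree_part_def component_homogeneous
        module_hom_zero[OF module_Hom_rep module_Q[OF \<beta> \<alpha>] homogeneous_hom])
next
  fix A assume "A \<in> carrier (Hom Q \<beta> \<alpha>)"
  then show "\<exists>c F. finite F \<and> F \<subseteq> carrier G \<and> c \<in> (\<Pi> s\<in>F. degree_part s \<beta> \<alpha>) \<and>
      A = (\<Oplus>\<^bsub>Hom Q \<beta> \<alpha>\<^esub>s\<in>F. c s)"
    using cls_finite_sum by (auto simp: Q_carrier[OF \<beta> \<alpha>])
qed (auto intro: submodule_degree_part module_hom_comp[OF component_hom homogeneous_hom])

end

lemma Comp_homogeneous:
  assumes \<gamma>: "\<gamma> \<in> orbs" and \<beta>: "\<beta> \<in> orbs" and \<alpha>: "\<alpha> \<in> orbs" and s: "s \<in> carrier G" and t: "t \<in> carrier G"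
    and g: "g \<in> carrier (Hom C (rep \<gamma>) (\<phi> t (rep \<beta>)))" and f: "f \<in> carrier (Hom C (rep \<beta>) (\<phi> s (rep \<alpha>)))"
  shows "Comp Q \<gamma> \<beta> \<alpha> (homogeneous t \<gamma> \<beta> g) (homogeneous s \<beta> \<alpha> f) =
      homogeneous (t \<otimes> s) \<gamma> \<alpha> (Comp C (rep \<gamma>) (\<phi> t (rep \<beta>)) (\<phi> (t \<otimes> s) (rep \<alpha>)) g
        (\<psi> t (rep \<beta>) (\<phi> s (rep \<alpha>)) f))"
    and "Comp C (rep \<gamma>) (\<phi> t (rep \<beta>)) (\<phi> (t \<otimes> s) (rep \<alpha>)) g (\<psi> t (rep \<beta>) (\<phi> s (rep \<alpha>)) f)
      \<in> carrier (Hom C (rep \<gamma>) (\<phi> (t \<otimes> s) (rep \<alpha>)))"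
proof -
  note rep = rep_mem[OF \<gamma>] rep_mem[OF \<beta>] and sr = act_rep[OF \<alpha> s] and tr = act_rep[OF \<beta> t]
  have ts: "\<phi> (t \<otimes> s) (rep \<alpha>) = \<phi> t (\<phi> s (rep \<alpha>))"
    using composition_rule[OF rep_Ob[OF \<alpha>] t s] .
  show "Comp Q \<gamma> \<beta> \<alpha> (homogeneous t \<gamma> \<beta> g) (homogeneous s \<beta> \<alpha> f) =
      homogeneous (t \<otimes> s) \<gamma> \<alpha> (Comp C (rep \<gamma>) (\<phi> t (rep \<beta>)) (\<phi> (t \<otimes> s) (rep \<alpha>)) g
        (\<psi> t (rep \<beta>) (\<phi> s (rep \<alpha>)) f))"
    unfolding homogeneous_def ts
    using Comp_Q_cls[OF \<gamma> \<beta> \<alpha> \<iota>_closed[OF \<gamma> \<beta> rep(1) tr(1) g] \<iota>_closed[OF \<beta> \<alpha> rep(2) sr(1) f]]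
      P_\<iota>[OF \<gamma> \<beta> \<alpha> rep sr(1) t g f] by simp
  show "Comp C (rep \<gamma>) (\<phi> t (rep \<beta>)) (\<phi> (t \<otimes> s) (rep \<alpha>)) g (\<psi> t (rep \<beta>) (\<phi> s (rep \<alpha>)) f)
      \<in> carrier (Hom C (rep \<gamma>) (\<phi> (t \<otimes> s) (rep \<alpha>)))"
    unfolding ts
    using module_hom_closed[OF Comp_linear_right[OF act_closed[OF t sr(2)] tr(2) rep_Ob[OF \<gamma>] g]
        act_closed_hom[OF t sr(2) rep_Ob[OF \<beta>] f]] .
qed

lemma Id_homogeneous:
  assumes "\<alpha> \<in> orbs"
  shows "Id Q \<alpha> = homogeneous \<one> \<alpha> \<alpha> (Id C (rep \<alpha>))"
  using Id_Q_cls[OF assms rep_mem[OF assms]] by (simp add: homogeneous_def act_one_object[OF rep_Ob[OF assms]])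

lemma G_graded_Q: "G_graded_category k G Q degree_part"
proof (intro G_graded_category.intro G_graded_category_axioms.intro)
  fix \<alpha> \<beta> \<gamma> s t A B
  assume orb: "\<alpha> \<in> Ob Q" "\<beta> \<in> Ob Q" "\<gamma> \<in> Ob Q" and st: "s \<in> carrier G" "t \<in> carrier G"
    and A: "A \<in> degree_part s \<beta> \<alpha>" and B: "B \<in> degree_part t \<gamma> \<beta>"
  then obtain f g where f: "f \<in> carrier (Hom C (rep \<beta>) (\<phi> s (rep \<alpha>)))" "A = homogeneous s \<beta> \<alpha> f"
    and g: "g \<in> carrier (Hom C (rep \<gamma>) (\<phi> t (rep \<beta>)))" "B = homogeneous t \<gamma> \<beta> g"
    by (auto simp: degree_part_def)
  show "Comp Q \<gamma> \<beta> \<alpha> B A \<in> degree_part (t \<otimes> s) \<gamma> \<alpha>"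
    using Comp_homogeneous[OF orb(3,2,1)[unfolded Q_simps(1)] st g(1) f(1)]
    by (auto simp: degree_part_def f(2) g(2))
next
  fix \<alpha> assume "\<alpha> \<in> Ob Q"
  then have \<alpha>: "\<alpha> \<in> orbs" by (simp add: Q_simps(1))
  show "Id Q \<alpha> \<in> degree_part \<one> \<alpha> \<alpha>"
    unfolding degree_part_def Id_homogeneous[OF \<alpha>] act_one_object[OF rep_Ob[OF \<alpha>]]
    by (intro imageI Id_closed rep_Ob \<alpha>)
qed (use k_category_Q grp.is_group Q_decomposition in \<open>simp_all add: Q_simps(1)\<close>)

section \<open>The isomorphism from the smash product to the original category\<close>

definition unfold_ob where
  "unfold_ob = (\<lambda>(\<alpha>, s). \<phi> s (rep \<alpha>))"

text \<open>Going through \<open>component\<close> singles out the representing morphism by a linear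
  map defined on all classes, so that no choice of f enters; bijectivity appears only on the degree
  part.\<close>

definition unfold_hom where
  "unfold_hom = (\<lambda>(\<beta>, t) (\<alpha>, s) A.
     \<psi> t (rep \<beta>) (\<phi> (inv t \<otimes> s) (rep \<alpha>)) (component (inv t \<otimes> s) \<beta> \<alpha> A))"

abbreviation S where
  "S \<equiv> smash_product G Q degree_part"

lemma S_simps:
  "Ob S = orbs \<times> carrier G"
  "Hom S (\<beta>, t) (\<alpha>, s) = (Hom Q \<beta> \<alpha>)\<lparr>carrier := degree_part (inv t \<otimes> s) \<beta> \<alpha>\<rparr>"
  "Comp S (\<gamma>, u) (\<beta>, t) (\<alpha>, s) = Comp Q \<gamma> \<beta> \<alpha>"
  "Id S (\<alpha>, s) = Id Q \<alpha>"
  by (simp_all add: smash_product_def Q_simps(1))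

lemma act_inv_mult_rep:
  assumes "t \<in> carrier G" and "\<alpha> \<in> orbs" and "s \<in> carrier G"
  shows "\<phi> t (\<phi> (inv t \<otimes> s) (rep \<alpha>)) = \<phi> s (rep \<alpha>)"
  using assms act_rep[OF assms(2,3)] by (simp add: composition_rule rep_Ob act_cancel)

context
  fixes \<beta> t \<alpha> s
  assumes \<beta>: "\<beta> \<in> orbs" and t: "t \<in> carrier G" and \<alpha>: "\<alpha> \<in> orbs" and s: "s \<in> carrier G"
begin

lemma act_hom_rep:
  "\<psi> t (rep \<beta>) (\<phi> (inv t \<otimes> s) (rep \<alpha>))
    \<in> module_hom k (Hom C (rep \<beta>) (\<phi> (inv t \<otimes> s) (rep \<alpha>))) (Hom C (\<phi> t (rep \<beta>)) (\<phi> s (rep \<alpha>)))"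
  using act_linear[OF t act_rep(2)[OF \<alpha>] rep_Ob[OF \<beta>], of "inv t \<otimes> s"] t s by (simp add: act_inv_mult_rep[OF t \<alpha> s])

lemma unfold_hom_homogeneous:
  assumes "f \<in> carrier (Hom C (rep \<beta>) (\<phi> (inv t \<otimes> s) (rep \<alpha>)))"
  shows "unfold_hom (\<beta>, t) (\<alpha>, s) (homogeneous (inv t \<otimes> s) \<beta> \<alpha> f) =
    \<psi> t (rep \<beta>) (\<phi> (inv t \<otimes> s) (rep \<alpha>)) f"
  using assms s t by (simp add: unfold_hom_def component_homogeneous[OF \<beta> \<alpha>])

lemma unfold_hom_linear:
  "unfold_hom (\<beta>, t) (\<alpha>, s) \<in> module_hom k (Hom S (\<beta>, t) (\<alpha>, s)) (Hom C (\<phi> t (rep \<beta>)) (\<phi> s (rep \<alpha>)))"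
proof -
  have ts: "inv t \<otimes> s \<in> carrier G"
    using t s by simp
  have "unfold_hom (\<beta>, t) (\<alpha>, s) \<in> module_hom k (Hom Q \<beta> \<alpha>) (Hom C (\<phi> t (rep \<beta>)) (\<phi> s (rep \<alpha>)))"
    unfolding unfold_hom_def prod.case by (rule module_hom_comp[OF component_hom[OF \<beta> \<alpha> ts] act_hom_rep])
  \<comment> \<open>The target carrier is replaced by itself merely to fit the shape of
    \<open>module_hom_restrict\<close>.\<close>
  then have "unfold_hom (\<beta>, t) (\<alpha>, s) \<in> module_hom k (Hom S (\<beta>, t) (\<alpha>, s))
      (Hom C (\<phi> t (rep \<beta>)) (\<phi> s (rep \<alpha>))\<lparr>carrier := carrier (Hom C (\<phi> t (rep \<beta>)) (\<phi> s (rep \<alpha>)))\<rparr>)"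
    unfolding S_simps
  proof (rule module_hom_restrict)
    show sub: "degree_part (inv t \<otimes> s) \<beta> \<alpha> \<subseteq> carrier (Hom Q \<beta> \<alpha>)"
      using module.submoduleE(1)[OF module_Q[OF \<beta> \<alpha>] submodule_degree_part[OF \<beta> \<alpha> ts]] .
    show "unfold_hom (\<beta>, t) (\<alpha>, s) ` degree_part (inv t \<otimes> s) \<beta> \<alpha>
        \<subseteq> carrier (Hom C (\<phi> t (rep \<beta>)) (\<phi> s (rep \<alpha>)))"
      using module_hom_closed[OF \<open>unfold_hom _ _ \<in> _\<close>] sub by blast
  qed
  then show ?thesis
    by simp
qed

lemma unfold_hom_bij:
  "bij_betw (unfold_hom (\<beta>, t) (\<alpha>, s)) (carrier (Hom S (\<beta>, t) (\<alpha>, s)))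
    (carrier (Hom C (\<phi> t (rep \<beta>)) (\<phi> s (rep \<alpha>))))"
proof -
  let ?x = "\<phi> (inv t \<otimes> s) (rep \<alpha>)"
  \<comment> \<open>The inverse pulls h back along t, so that its target becomes
    \<open>rep \<beta>\<close>, and takes the class.\<close>
  let ?g = "\<lambda>h. homogeneous (inv t \<otimes> s) \<beta> \<alpha> (\<psi> (inv t) (\<phi> t (rep \<beta>)) (\<phi> s (rep \<alpha>)) h)"
  have ts: "inv t \<otimes> s \<in> carrier G" and x: "?x \<in> Ob C"
    using t s act_rep(2)[OF \<alpha>] by simp_all
  have inv_hom: "\<psi> (inv t) (\<phi> t (rep \<beta>)) (\<phi> s (rep \<alpha>)) h \<in> carrier (Hom C (rep \<beta>) ?x)"
    if "h \<in> carrier (Hom C (\<phi> t (rep \<beta>)) (\<phi> s (rep \<alpha>)))" for h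
    using act_closed_hom[OF grp.inv_closed[OF t] act_rep(2)[OF \<alpha> s] act_rep(2)[OF \<beta> t] that]
      act_cancel(1)[OF t rep_Ob[OF \<beta>]] act_cancel(1)[OF t x] by (simp add: act_inv_mult_rep[OF t \<alpha> s])
  show ?thesis
  proof (rule bij_betw_byWitness[where f' = ?g])
    show "\<forall>A\<in>carrier (Hom S (\<beta>, t) (\<alpha>, s)). ?g (unfold_hom (\<beta>, t) (\<alpha>, s) A) = A"
    proof
      fix A assume "A \<in> carrier (Hom S (\<beta>, t) (\<alpha>, s))"
      then obtain f where f: "f \<in> carrier (Hom C (rep \<beta>) ?x)" "A = homogeneous (inv t \<otimes> s) \<beta> \<alpha> f"
        by (auto simp: S_simps degree_part_def)
      have "\<psi> (inv t) (\<phi> t (rep \<beta>)) (\<phi> s (rep \<alpha>)) (\<psi> t (rep \<beta>) ?x f) = f"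
        using act_mult[OF t grp.inv_closed[OF t] x rep_Ob[OF \<beta>] f(1)] act_one[OF x rep_Ob[OF \<beta>] f(1)] t
        by (simp add: act_inv_mult_rep[OF t \<alpha> s])
      then show "?g (unfold_hom (\<beta>, t) (\<alpha>, s) A) = A"
        by (simp add: f(2) unfold_hom_homogeneous[OF f(1)])
    qed
    show "\<forall>h\<in>carrier (Hom C (\<phi> t (rep \<beta>)) (\<phi> s (rep \<alpha>))). unfold_hom (\<beta>, t) (\<alpha>, s) (?g h) = h"
    proof
      fix h assume h: "h \<in> carrier (Hom C (\<phi> t (rep \<beta>)) (\<phi> s (rep \<alpha>)))"
      have "\<psi> t (rep \<beta>) ?x (\<psi> (inv t) (\<phi> t (rep \<beta>)) (\<phi> s (rep \<alpha>)) h) = h"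
        using act_mult[OF grp.inv_closed[OF t] t act_rep(2)[OF \<alpha> s] act_rep(2)[OF \<beta> t] h]
          act_one[OF act_rep(2)[OF \<alpha> s] act_rep(2)[OF \<beta> t] h] t
          act_cancel(1)[OF t rep_Ob[OF \<beta>]] act_cancel(1)[OF t x] by (simp add: act_inv_mult_rep[OF t \<alpha> s])
      then show "unfold_hom (\<beta>, t) (\<alpha>, s) (?g h) = h"
        by (simp add: unfold_hom_homogeneous[OF inv_hom[OF h]])
    qed
    show "unfold_hom (\<beta>, t) (\<alpha>, s) ` carrier (Hom S (\<beta>, t) (\<alpha>, s))
        \<subseteq> carrier (Hom C (\<phi> t (rep \<beta>)) (\<phi> s (rep \<alpha>)))"
      using module_hom_closed[OF unfold_hom_linear] by blast
    show "?g ` carrier (Hom C (\<phi> t (rep \<beta>)) (\<phi> s (rep \<alpha>))) \<subseteq> carrier (Hom S (\<beta>, t) (\<alpha>, s))"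
      using inv_hom by (auto simp: S_simps degree_part_def)
  qed
qed

end

text \<open>With a and b the inverse of u times t and the inverse of t times s, the composite of
  classes is represented by g (a f). Applying u gives (u g)((u a) f) = (u g)(t f), since u a =
  t.\<close>

lemma unfold_hom_Comp:
  assumes \<gamma>: "\<gamma> \<in> orbs" "u \<in> carrier G" and \<beta>: "\<beta> \<in> orbs" "t \<in> carrier G" and \<alpha>: "\<alpha> \<in> orbs" "s \<in> carrier G"
    and A: "A \<in> carrier (Hom S (\<beta>, t) (\<alpha>, s))" and B: "B \<in> carrier (Hom S (\<gamma>, u) (\<beta>, t))"
  shows "unfold_hom (\<gamma>, u) (\<alpha>, s) (Comp Q \<gamma> \<beta> \<alpha> B A) =
    Comp C (\<phi> u (rep \<gamma>)) (\<phi> t (rep \<beta>)) (\<phi> s (rep \<alpha>)) (unfold_hom (\<gamma>, u) (\<beta>, t) B) (unfold_hom (\<beta>, t) (\<alpha>, s) A)"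
proof -
  define a where "a = inv u \<otimes> t"
  define b where "b = inv t \<otimes> s"
  have ab: "a \<in> carrier G" "b \<in> carrier G" "inv u \<otimes> s = a \<otimes> b"
    using \<gamma>(2) \<beta>(2) \<alpha>(2) by (simp_all add: a_def b_def grp.inv_mult_cancel_middle)
  have ua: "u \<otimes> a = t"
    using \<gamma>(2) \<beta>(2) by (simp add: a_def grp.m_assoc[symmetric])
  obtain f where f: "f \<in> carrier (Hom C (rep \<beta>) (\<phi> b (rep \<alpha>)))" "A = homogeneous b \<beta> \<alpha> f"
    using A by (auto simp: S_simps degree_part_def b_def)
  obtain g where g: "g \<in> carrier (Hom C (rep \<gamma>) (\<phi> a (rep \<beta>)))" "B = homogeneous a \<gamma> \<beta> g"
    using B by (auto simp: S_simps degree_part_def a_def)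
  note mem = act_rep(2)[OF \<alpha>(1) ab(2)] act_rep(2)[OF \<beta>(1) ab(1)] rep_Ob[OF \<gamma>(1)] rep_Ob[OF \<beta>(1)] rep_Ob[OF \<alpha>(1)]
  let ?x = "\<phi> (a \<otimes> b) (rep \<alpha>)"
  have x: "?x = \<phi> a (\<phi> b (rep \<alpha>))" "?x \<in> Ob C"
    using composition_rule[OF mem(5) ab(1,2)] act_rep(2)[OF \<alpha>(1), of "a \<otimes> b"] ab(1,2) by simp_all
  have xs: "\<phi> u ?x = \<phi> s (rep \<alpha>)" and at: "\<phi> u (\<phi> a (rep \<beta>)) = \<phi> t (rep \<beta>)"
    using act_inv_mult_rep[OF \<gamma>(2) \<alpha>] act_inv_mult_rep[OF \<gamma>(2) \<beta>] ab(3) by (simp_all add: a_def)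
  have af: "\<psi> a (rep \<beta>) (\<phi> b (rep \<alpha>)) f \<in> carrier (Hom C (\<phi> a (rep \<beta>)) ?x)"
    using act_closed_hom[OF ab(1) mem(1,4) f(1)] by (simp add: x)
  note comp = Comp_homogeneous[OF \<gamma>(1) \<beta>(1) \<alpha>(1) ab(2,1) g(1) f(1)]
  have "unfold_hom (\<gamma>, u) (\<alpha>, s) (Comp Q \<gamma> \<beta> \<alpha> B A) =
      \<psi> u (rep \<gamma>) ?x (Comp C (rep \<gamma>) (\<phi> a (rep \<beta>)) ?x g (\<psi> a (rep \<beta>) (\<phi> b (rep \<alpha>)) f))"
    using unfold_hom_homogeneous[OF \<gamma> \<alpha>, unfolded ab(3), OF comp(2)] comp(1) by (simp add: f(2) g(2))
  also have "\<dots> = Comp C (\<phi> u (rep \<gamma>)) (\<phi> t (rep \<beta>)) (\<phi> s (rep \<alpha>)) (\<psi> u (rep \<gamma>) (\<phi> a (rep \<beta>)) g)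
      (\<psi> u (\<phi> a (rep \<beta>)) ?x (\<psi> a (rep \<beta>) (\<phi> b (rep \<alpha>)) f))"
    using act_Comp[OF \<gamma>(2) x(2) mem(2,3) af g(1)] by (simp add: xs at)
  also have "\<psi> u (\<phi> a (rep \<beta>)) ?x (\<psi> a (rep \<beta>) (\<phi> b (rep \<alpha>)) f) = \<psi> t (rep \<beta>) (\<phi> b (rep \<alpha>)) f"
    using act_mult[OF ab(1) \<gamma>(2) mem(1,4) f(1)] by (simp add: x(1) ua)
  also have "\<dots> = unfold_hom (\<beta>, t) (\<alpha>, s) A"
    using unfold_hom_homogeneous[OF \<beta> \<alpha>] f by (simp add: b_def)
  also have "\<psi> u (rep \<gamma>) (\<phi> a (rep \<beta>)) g = unfold_hom (\<gamma>, u) (\<beta>, t) B"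
    using unfold_hom_homogeneous[OF \<gamma> \<beta>] g by (simp add: a_def)
  finally show ?thesis .
qed

lemma unfold_hom_Id:
  assumes \<alpha>: "\<alpha> \<in> orbs" and s: "s \<in> carrier G"
  shows "unfold_hom (\<alpha>, s) (\<alpha>, s) (Id Q \<alpha>) = Id C (\<phi> s (rep \<alpha>))"
  using unfold_hom_homogeneous[OF \<alpha> s \<alpha> s, of "Id C (rep \<alpha>)"] s rep_Ob[OF \<alpha>]
  by (simp add: Id_homogeneous[OF \<alpha>] act_one_object Id_closed act_Id)

text \<open>The orbits partition the objects, so s (r \<alpha>) determines \<alpha>; freeness then
  determines s, and transitivity on each orbit gives surjectivity.\<close>

lemma unfold_ob_bij: "bij_betw unfold_ob (orbs \<times> carrier G) (Ob C)"
proof (rule bij_betw_imageI)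
  show "inj_on unfold_ob (orbs \<times> carrier G)"
  proof (rule inj_onI)
    fix p q assume p: "p \<in> orbs \<times> carrier G" and q: "q \<in> orbs \<times> carrier G" and eq: "unfold_ob p = unfold_ob q"
    obtain \<alpha> s \<beta> t where pq: "p = (\<alpha>, s)" "q = (\<beta>, t)"
      by (metis surj_pair)
    have mem: "\<alpha> \<in> orbs" "s \<in> carrier G" "\<beta> \<in> orbs" "t \<in> carrier G"
      and eq: "\<phi> s (rep \<alpha>) = \<phi> t (rep \<beta>)"
      using p q eq by (simp_all add: pq unfold_ob_def)
    have "\<alpha> = \<beta>"
      using disjoint_union[OF mem(1,3)] act_rep(1)[OF mem(1,2)] act_rep(1)[OF mem(3,4)] eq by auto
    then show "p = q"
      using act_free[OF rep_Ob[OF mem(1)] mem(2,4)] eq by (simp add: pq)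
  qed
  show "unfold_ob ` (orbs \<times> carrier G) = Ob C"
  proof
    show "unfold_ob ` (orbs \<times> carrier G) \<subseteq> Ob C"
      using act_rep(2) by (auto simp: unfold_ob_def)
    show "Ob C \<subseteq> unfold_ob ` (orbs \<times> carrier G)"
    proof
      fix x assume "x \<in> Ob C"
      then obtain \<alpha> where \<alpha>: "\<alpha> \<in> orbs" "x \<in> \<alpha>"
        using orbits_coverture by blast
      obtain s where "s \<in> carrier G" "\<phi> s (rep \<alpha>) = x"
        using orbits_transitive[OF \<alpha>(1) rep_mem[OF \<alpha>(1)] \<alpha>(2)] .
      then show "x \<in> unfold_ob ` (orbs \<times> carrier G)"
        using \<alpha>(1) by (force simp: unfold_ob_def)
    qed
  qed
qed

lemma smash_quotient_isomorphic: "k_isomorphic k S C"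
  unfolding k_isomorphic_def
proof (intro exI conjI ballI)
  show "k_functor k S C unfold_ob unfold_hom"
  proof (intro k_functor.intro k_functor_axioms.intro)
    show "k_category k S"
      by (rule k_category_smash_product[OF G_graded_Q])
    show "k_category k C"
      by (rule k_category_axioms)
  next
    fix p assume "p \<in> Ob S"
    then show "unfold_ob p \<in> Ob C" and "unfold_hom p p (Id S p) = Id C (unfold_ob p)"
      by (auto simp: S_simps unfold_ob_def act_rep(2) unfold_hom_Id)
  next
    fix p q assume "p \<in> Ob S" "q \<in> Ob S"
    then show "unfold_hom q p \<in> module_hom k (Hom S q p) (Hom C (unfold_ob q) (unfold_ob p))"
      using unfold_hom_linear by (auto simp: S_simps(1) unfold_ob_def)
  next
    fix p q r A B assume "p \<in> Ob S" "q \<in> Ob S" "r \<in> Ob S" "A \<in> carrier (Hom S q p)" "B \<in> carrier (Hom S r q)"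
    then show "unfold_hom r p (Comp S r q p B A) =
        Comp C (unfold_ob r) (unfold_ob q) (unfold_ob p) (unfold_hom r q B) (unfold_hom q p A)"
      using unfold_hom_Comp by (auto simp: S_simps(1,3) unfold_ob_def)
  qed
  show "bij_betw unfold_ob (Ob S) (Ob C)"
    unfolding S_simps by (rule unfold_ob_bij)
next
  fix p q assume "p \<in> Ob S" "q \<in> Ob S"
  then show "bij_betw (unfold_hom q p) (carrier (Hom S q p)) (carrier (Hom C (unfold_ob q) (unfold_ob p)))"
    using unfold_hom_bij by (auto simp: S_simps(1) unfold_ob_def)
qed

end

theorem theorem3p8:
  fixes k :: "('k, 'r) ring_scheme"
    and G :: "('g, 'h) monoid_scheme"
    and C :: "('o, 'm, 'k) k_cat"
    and \<phi> :: "'g \<Rightarrow> 'o \<Rightarrow> 'o"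
    and \<psi> :: "'g \<Rightarrow> 'o \<Rightarrow> 'o \<Rightarrow> 'm \<Rightarrow> 'm"
  assumes "cring k"
    and "group G"
    and "free_G_category k G C \<phi> \<psi>"
  shows "\<exists>D. G_graded_category k G (quotient_category k G C \<phi> \<psi>) D \<and>
    k_isomorphic k (smash_product G (quotient_category k G C \<phi> \<psi>) D) C"
  using free_G_category.G_graded_Q[OF assms(3)] free_G_category.smash_quotient_isomorphic[OF assms(3)]
  by blast

end
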